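(* Let $(X,G)$ be a topological dynamical system with metric $d$, where $G$ is a countable infinite discrete amenable group, let $\mu\in\mathcal{M}(X,G)$, and let $\{F_n: n\in\mathbb{N}\}$ be a F\o lner sequence of $G$. Then the following statements are equivalent: (1) $\mu$ has discrete spectrum. (2) $\mu$ has bounded complexity w.r.t. $\{\overline{d}_{F_n}: n\in\mathbb{N}\}$. (3) $\mu$ has bounded complexity w.r.t. $\{\overline{H^\alpha}_{F_n}: n\in\mathbb{N}\}$ for any $\alpha\in\mathcal{P}_X$. (4) $\mu$ has bounded complexity w.r.t. $\{\overline{H^\alpha}_{F_n}: n\in\mathbb{N}\}$ for any $\alpha\in\mathcal{P}_X$ of the form $\alpha=\{A, X\setminus A\}$. Furthermore, if the F\o lner sequence $\{F_n: n\in\mathbb{N}\}$ is tempered, then (1), (2), (3) and (4) are equivalent to any of the following two statements: (5) $\mu$ is mean equicontinuous w.r.t. $\{F_n: n\in\mathbb{N}\}$. (6) $\mu$ is equicontinuous in the mean w.r.t. $\{F_n: n\in\mathbb{N}\}$.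
   Context: A topological dynamical system $(X,G)$ is a pair where $X$ is a compact metric space with metric $d$ and $G$ is a countable infinite discrete amenable group acting on $X$ as a group of homeomorphisms. $\mathcal{B}_X$ is the Borel $\sigma$-algebra of $X$, and $\mathcal{M}(X,G)$ is the set of $G$-invariant Borel probability measures on $X$. A F\o lner sequence of $G$ is a sequence of finite nonempty subsets $F_n\subset G$ with $\lim_{n\to\infty}|gF_n\Delta F_n|/|F_n|=0$ for every $g\in G$. It is tempered if there is a finite $C>0$ such that $|\bigcup_{k<n}F_k^{-1}F_n|\le C|F_n|$ for every $n\in\mathbb{N}$. Discrete spectrum: for $f\in L^2(X,\mu)$ and $g\in G$ put $(f\circ g)(x)=f(gx)$; let $H_c\subset L^2(X,\mu)$ be the closed subspace generated by all finite dimensional $G$-invariant subspaces of $L^2(X,\mu)$. The measure $\mu$ has discrete spectrum if $H_c=L^2(X,\mu)$. Semimetrics: a semimetric $w$ on $X$ is a map $w:X\times X\to[0,\infty)$ with $w(x,x)=0$, $w(x,y)=w(y,x)$ and $w(x,z)\le w(x,y)+w(y,z)$. For a semimetric $w$ put $\overline{w}_{F_n}(x,y)=\frac{1}{|F_n|}\sum_{g\in F_n}w(gx,gy)$ and $B_{\overline{w}_{F_n}}(x,r)=\{y\in X:\overline{w}_{F_n}(x,y)<r\}$. For $\epsilon>0$ the complexity function is $$C(\overline{w}_{F_n},\epsilon)=\min\Big\{m\in\mathbb{N}:\exists x_1,\dots,x_m\in X \text{ s.t. } \mu\Big(\bigcup_{i=1}^m B_{\overline{w}_{F_n}}(x_i,\epsilon/2)\Big)>1-\epsilon\Big\}.$$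 $\mu$ has bounded complexity w.r.t. $\{\overline{w}_{F_n}:n\in\mathbb{N}\}$ if for every $\epsilon>0$ there is $M=M(\epsilon)\in\mathbb{N}$ with $C(\overline{w}_{F_n},\epsilon)\le M$ for all $n\in\mathbb{N}$. Partitions: $\mathcal{P}_X$ is the set of all partitions of $X$, i.e. finite families $\alpha=\{A_1,\dots,A_l\}\subset\mathcal{B}_X$ of pairwise disjoint sets with union $X$. For such $\alpha$, $H^\alpha(x,y)=\frac12\sum_{i=1}^l|1_{A_i}(x)-1_{A_i}(y)|$ (so $\overline{H^\alpha}_{F_n}(x,y)$ is the proportion of $g\in F_n$ for which $gx$ and $gy$ lie in different elements of $\alpha$). Equicontinuity: a compact set $K\subset X$ is mean equicontinuous (respectively, equicontinuous in the mean) w.r.t. $\{F_n\}$ if for every $\epsilon>0$ there is $\delta>0$ such that $\limsup_{n\to\infty}\overline{d}_{F_n}(x,y)<\epsilon$ (respectively, $\overline{d}_{F_n}(x,y)<\epsilon$ for every $n\in\mathbb{N}$) whenever $x,y\in K$ satisfy $d(x,y)<\delta$. The measure $\mu$ is mean equicontinuous (respectively, equicontinuous in the mean) w.r.t. $\{F_n\}$ if for every $\tau>0$ there is a compact set $K\subset X$ with $\mu(K)>1-\tau$ that is mean equicontinuous (respectively, equicontinuous in the mean) w.r.t. $\{F_n\}$. *)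

theory Defs
  imports "HOL-Analysis.Analysis" "HOL-Probability.Probability" "HOL-Algebra.Group_Action"
begin

section \<open>Amenable groups and dynamical systems\<close>

definition folner_sequence :: "('g, 'm) monoid_scheme \<Rightarrow> (nat \<Rightarrow> 'g set) \<Rightarrow> bool" where
  "folner_sequence G F \<longleftrightarrow>
     (\<forall>n. finite (F n) \<and> F n \<noteq> {} \<and> F n \<subseteq> carrier G) \<and>
     (\<forall>g\<in>carrier G.
        (\<lambda>n. real (card (sym_diff (g <#\<^bsub>G\<^esub> F n) (F n))) / real (card (F n))) \<longlonglongrightarrow> 0)"

definition tempered :: "('g, 'm) monoid_scheme \<Rightarrow> (nat \<Rightarrow> 'g set) \<Rightarrow> bool" where
  "tempered G F \<longleftrightarrow>
     (\<exists>C::real. C > 0 \<and>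
        (\<forall>n. real (card (\<Union>k<n. (set_inv\<^bsub>G\<^esub> (F k)) <#>\<^bsub>G\<^esub> F n)) \<le> C * real (card (F n))))"

text \<open>For countable discrete groups amenability means the existence of a Folner sequence.\<close>

definition countable_amenable_group :: "('g, 'm) monoid_scheme \<Rightarrow> bool" where
  "countable_amenable_group G \<longleftrightarrow>
     group G \<and> countable (carrier G) \<and> (\<exists>F. folner_sequence G F)"

text \<open>The space is a whole type; since \<open>G\<close> is discrete, continuity of the action means that
  each group element acts by a homeomorphism.\<close>

locale topological_dynamical_system =
  group_action G "UNIV :: 'x::metric_space set" \<phi> for G (structure) and \<phi> +
  assumes compact_space: "compact (UNIV :: 'x set)"
    and infinite_group: "infinite (carrier G)"
    and amenable: "countable_amenable_group G"
    and homeomorphisms: "\<And>g. g \<in> carrier G \<Longrightarrow> \<exists>h. homeomorphism UNIV UNIV (\<phi> g) h"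

definition invariant_measures ::
  "('g, 'm) monoid_scheme \<Rightarrow> ('g \<Rightarrow> 'x \<Rightarrow> 'x) \<Rightarrow> 'x::topological_space measure set" where
  "invariant_measures G \<phi> =
     {M. sets M = sets borel \<and> prob_space M \<and> (\<forall>g\<in>carrier G. distr M M (\<phi> g) = M)}"

section \<open>Discrete spectrum\<close>

text \<open>The complex Hilbert space \<open>L\<^sup>2(X, \<mu>)\<close> is handled through representatives: a subspace
  of \<open>L\<^sup>2\<close> is a set of square-integrable functions that is closed under linear combinations
  and saturated under almost everywhere equality. Such sets correspond bijectively to the
  subspaces of the quotient by the null functions, and finite dimension, closedness and
  invariance below are those of the quotient.\<close>

definition l2_functions :: "'x measure \<Rightarrow> ('x \<Rightarrow> complex) set" where
  "l2_functions M = {f. f \<in> borel_measurable M \<and> integrable M (\<lambda>x. (cmod (f x))\<^sup>2)}"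

definition l2_norm :: "'x measure \<Rightarrow> ('x \<Rightarrow> complex) \<Rightarrow> real" where
  "l2_norm M f = sqrt (\<integral>x. (cmod (f x))\<^sup>2 \<partial>M)"

definition l2_subspace :: "'x measure \<Rightarrow> ('x \<Rightarrow> complex) set \<Rightarrow> bool" where
  "l2_subspace M V \<longleftrightarrow>
     V \<subseteq> l2_functions M \<and> (\<lambda>x. 0) \<in> V \<and>
     (\<forall>f\<in>V. \<forall>h\<in>V. (\<lambda>x. f x + h x) \<in> V) \<and>
     (\<forall>c. \<forall>f\<in>V. (\<lambda>x. c * f x) \<in> V) \<and>
     (\<forall>f\<in>V. \<forall>h\<in>l2_functions M. (AE x in M. f x = h x) \<longrightarrow> h \<in> V)"

definition l2_finite_dimensional :: "'x measure \<Rightarrow> ('x \<Rightarrow> complex) set \<Rightarrow> bool" where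
  "l2_finite_dimensional M V \<longleftrightarrow>
     (\<exists>B. finite B \<and> B \<subseteq> V \<and> (\<forall>f\<in>V. \<exists>c. AE x in M. f x = (\<Sum>b\<in>B. c b * b x)))"

definition l2_invariant ::
  "('g, 'm) monoid_scheme \<Rightarrow> ('g \<Rightarrow> 'x \<Rightarrow> 'x) \<Rightarrow> ('x \<Rightarrow> complex) set \<Rightarrow> bool" where
  "l2_invariant G \<phi> V \<longleftrightarrow> (\<forall>g\<in>carrier G. \<forall>f\<in>V. f \<circ> \<phi> g \<in> V)"

definition l2_closed :: "'x measure \<Rightarrow> ('x \<Rightarrow> complex) set \<Rightarrow> bool" where
  "l2_closed M W \<longleftrightarrow>
     (\<forall>f\<in>l2_functions M. (\<forall>e>0. \<exists>h\<in>W. l2_norm M (\<lambda>x. f x - h x) < e) \<longrightarrow> f \<in> W)"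

definition compact_part ::
  "('g, 'm) monoid_scheme \<Rightarrow> ('g \<Rightarrow> 'x \<Rightarrow> 'x) \<Rightarrow> 'x measure \<Rightarrow> ('x \<Rightarrow> complex) set" where
  "compact_part G \<phi> M =
     \<Inter> {W. l2_subspace M W \<and> l2_closed M W \<and>
          (\<forall>V. l2_subspace M V \<and> l2_finite_dimensional M V \<and> l2_invariant G \<phi> V \<longrightarrow> V \<subseteq> W)}"

definition discrete_spectrum ::
  "('g, 'm) monoid_scheme \<Rightarrow> ('g \<Rightarrow> 'x \<Rightarrow> 'x) \<Rightarrow> 'x measure \<Rightarrow> bool" where
  "discrete_spectrum G \<phi> M \<longleftrightarrow> compact_part G \<phi> M = l2_functions M"

section \<open>Averaged semimetrics and complexity\<close>

definition semimetric :: "('x \<Rightarrow> 'x \<Rightarrow> real) \<Rightarrow> bool" where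
  "semimetric w \<longleftrightarrow>
     (\<forall>x y. 0 \<le> w x y) \<and> (\<forall>x. w x x = 0) \<and> (\<forall>x y. w x y = w y x) \<and>
     (\<forall>x y z. w x z \<le> w x y + w y z)"

definition averaged ::
  "('g \<Rightarrow> 'x \<Rightarrow> 'x) \<Rightarrow> ('x \<Rightarrow> 'x \<Rightarrow> real) \<Rightarrow> 'g set \<Rightarrow> 'x \<Rightarrow> 'x \<Rightarrow> real" where
  "averaged \<phi> w F x y = (\<Sum>g\<in>F. w (\<phi> g x) (\<phi> g y)) / real (card F)"

definition semimetric_ball :: "('x \<Rightarrow> 'x \<Rightarrow> real) \<Rightarrow> 'x \<Rightarrow> real \<Rightarrow> 'x set" where
  "semimetric_ball w x r = {y. w x y < r}"

text \<open>The minimum is taken in the extended naturals, so that it is \<open>\<infinity>\<close> (and not an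
  unspecified number) should no finite family of balls suffice.\<close>

definition complexity :: "'x measure \<Rightarrow> ('x \<Rightarrow> 'x \<Rightarrow> real) \<Rightarrow> real \<Rightarrow> enat" where
  "complexity M w \<epsilon> =
     Inf {enat m | m. \<exists>x :: nat \<Rightarrow> 'x.
            measure M (\<Union>i\<in>{1..m}. semimetric_ball w (x i) (\<epsilon> / 2)) > 1 - \<epsilon>}"

definition bounded_complexity :: "'x measure \<Rightarrow> (nat \<Rightarrow> 'x \<Rightarrow> 'x \<Rightarrow> real) \<Rightarrow> bool" where
  "bounded_complexity M w \<longleftrightarrow>
     (\<forall>\<epsilon>>0. \<exists>K::nat. \<forall>n. complexity M (w n) \<epsilon> \<le> enat K)"

definition borel_partitions :: "'x::topological_space set set set" where
  "borel_partitions = {\<alpha>. finite \<alpha> \<and> \<alpha> \<subseteq> sets borel \<and> disjoint \<alpha> \<and> \<Union> \<alpha> = UNIV}"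

definition partition_semimetric :: "'x set set \<Rightarrow> 'x \<Rightarrow> 'x \<Rightarrow> real" where
  "partition_semimetric \<alpha> x y =
     (1 / 2) * (\<Sum>A\<in>\<alpha>. \<bar>indicator A x - indicator A y\<bar>)"

lemma semimetric_dist: "semimetric (dist :: 'x::metric_space \<Rightarrow> 'x \<Rightarrow> real)"
  by (simp add: semimetric_def dist_commute dist_triangle)

lemma semimetric_partition: "semimetric (partition_semimetric \<alpha>)"
proof -
  have "(\<Sum>A\<in>\<alpha>. \<bar>indicator A x - indicator A z :: real\<bar>)
      \<le> (\<Sum>A\<in>\<alpha>. \<bar>indicator A x - indicator A y\<bar>) + (\<Sum>A\<in>\<alpha>. \<bar>indicator A y - indicator A z\<bar>)"
    for x y z
    unfolding sum.distrib[symmetric] by (rule sum_mono) linarith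
  then have "partition_semimetric \<alpha> x z \<le> partition_semimetric \<alpha> x y + partition_semimetric \<alpha> y z"
    for x y z
    unfolding partition_semimetric_def distrib_left[symmetric] by (intro mult_left_mono) auto
  moreover have "partition_semimetric \<alpha> x y = partition_semimetric \<alpha> y x" for x y
    by (simp add: partition_semimetric_def abs_minus_commute)
  moreover have "0 \<le> partition_semimetric \<alpha> x y" "partition_semimetric \<alpha> x x = 0" for x y
    by (simp_all add: partition_semimetric_def sum_nonneg)
  ultimately show ?thesis
    unfolding semimetric_def by blast
qed

section \<open>Mean equicontinuity\<close>

definition mean_equicontinuous_on ::
  "('g \<Rightarrow> 'x \<Rightarrow> 'x) \<Rightarrow> (nat \<Rightarrow> 'g set) \<Rightarrow> 'x::metric_space set \<Rightarrow> bool" where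
  "mean_equicontinuous_on \<phi> F K \<longleftrightarrow>
     (\<forall>\<epsilon>>0. \<exists>\<delta>>0. \<forall>x\<in>K. \<forall>y\<in>K. dist x y < \<delta> \<longrightarrow>
        limsup (\<lambda>n. ereal (averaged \<phi> dist (F n) x y)) < ereal \<epsilon>)"

definition equicontinuous_in_mean_on ::
  "('g \<Rightarrow> 'x \<Rightarrow> 'x) \<Rightarrow> (nat \<Rightarrow> 'g set) \<Rightarrow> 'x::metric_space set \<Rightarrow> bool" where
  "equicontinuous_in_mean_on \<phi> F K \<longleftrightarrow>
     (\<forall>\<epsilon>>0. \<exists>\<delta>>0. \<forall>x\<in>K. \<forall>y\<in>K. dist x y < \<delta> \<longrightarrow>
        (\<forall>n. averaged \<phi> dist (F n) x y < \<epsilon>))"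

definition mean_equicontinuous_measure ::
  "('g \<Rightarrow> 'x \<Rightarrow> 'x) \<Rightarrow> (nat \<Rightarrow> 'g set) \<Rightarrow> 'x::metric_space measure \<Rightarrow> bool" where
  "mean_equicontinuous_measure \<phi> F M \<longleftrightarrow>
     (\<forall>\<tau>>0. \<exists>K. compact K \<and> measure M K > 1 - \<tau> \<and> mean_equicontinuous_on \<phi> F K)"

definition equicontinuous_in_mean_measure ::
  "('g \<Rightarrow> 'x \<Rightarrow> 'x) \<Rightarrow> (nat \<Rightarrow> 'g set) \<Rightarrow> 'x::metric_space measure \<Rightarrow> bool" where
  "equicontinuous_in_mean_measure \<phi> F M \<longleftrightarrow>
     (\<forall>\<tau>>0. \<exists>K. compact K \<and> measure M K > 1 - \<tau> \<and> equicontinuous_in_mean_on \<phi> F K)"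

end

theory Submission
  imports Defs "HOL-Complex_Analysis.Great_Picard"
begin

text \<open>
  Everything rests on invariant kernels. For a bounded measurable semimetric \<open>w\<close> the averages over
  \<open>F n\<close> converge in \<open>L\<^sup>1(\<mu> \<times> \<mu>)\<close>, by the mean ergodic theorem for the diagonal action, to an
  invariant kernel \<open>v\<close>. A symmetric invariant kernel defines a compact self-adjoint operator that
  commutes with the action, and its eigenspaces for nonzero eigenvalues are finite-dimensional and
  invariant, so the operator annihilates every \<open>h\<close> orthogonal to the compact part.

  Bounded complexity, and likewise mean equicontinuity, forces almost every point to have \<open>v\<close>-balls
  of positive measure. Averaging over these balls moves a function with
  \<open>\<bar>f x - f y\<bar> \<le> L * w x y\<close> only a little, since an invariant kernel integrates \<open>w\<close> and \<open>v\<close> alike;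
  hence such functions lie in the compact part.

  Conversely, under discrete spectrum bounded functions are approximated in \<open>L\<^sup>1\<close> by combinations
  of orthonormal bases \<open>e\<close> of finite-dimensional invariant subspaces. Along an orbit the
  oscillation of \<open>e\<close> is controlled by its oscillation at the starting points, so a finite partition
  into pieces of small oscillation of \<open>e\<close> works for all \<open>n\<close> at once. The error terms are
  handled by Markov's inequality for each \<open>n\<close>, and for all \<open>n\<close> simultaneously by the maximal
  inequality when the sequence is tempered.
\<close>

section \<open>Square-integrable functions\<close>

text \<open>In the first four statements the Folner sequence is arbitrary, so the averages are known
  to converge only in the mean, not along individual orbits. Hence every comparison of the averages
  with \<open>v\<close> is an integral over pairs, and bounded complexity is exploited at one
  \<open>n\<close> at a time, with a number of balls independent of \<open>n\<close>. Control at a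
  point for all \<open>n\<close> at once comes from the maximal inequality.

  A compact self-adjoint operator may have eigenvalues of either sign, and power iteration cannot
  tell them apart. The eigenvalue equation is therefore written for \<open>T (T e)\<close>; its
  eigenspaces are still finite-dimensional and invariant.

  The operator is not built from \<open>v\<close> but from the bump
  \<open>max 0 (1 - v x y / \<epsilon>)\<close>. It inherits symmetry and invariance from
  \<open>v\<close> and is supported where \<open>v\<close> is below \<epsilon>, so it averages over
  \<open>v\<close>-balls. Its mass at \<open>x\<close> is positive exactly when the ball is not
  null, and this is the form in which complexity and equicontinuity enter.\<close>

definition square_integrable :: "'a measure \<Rightarrow> ('a \<Rightarrow> 'b::euclidean_space) set" where
  "square_integrable M = {f \<in> borel_measurable M. integrable M (\<lambda>x. (norm (f x))\<^sup>2)}"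

text \<open>On complex functions this is the real part of the Hermitian product, so one development
  serves real and complex functions. Against a subspace closed under complex scalars, orthogonality
  has the same meaning for both products.\<close>

definition ip :: "'a measure \<Rightarrow> ('a \<Rightarrow> 'b::euclidean_space) \<Rightarrow> ('a \<Rightarrow> 'b) \<Rightarrow> real" where
  "ip M f g = (\<integral>x. f x \<bullet> g x \<partial>M)"

definition nrm :: "'a measure \<Rightarrow> ('a \<Rightarrow> 'b::euclidean_space) \<Rightarrow> real" where
  "nrm M f = sqrt (ip M f f)"

lemma square_integrable_measurable [measurable_dest]:
  "f \<in> square_integrable M \<Longrightarrow> f \<in> borel_measurable M"
  by (simp add: square_integrable_def)

lemma integrable_norm_power2:
  "f \<in> square_integrable M \<Longrightarrow> integrable M (\<lambda>x. (norm (f x))\<^sup>2)"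
  by (simp add: square_integrable_def)

lemma norm_power2_add_le: "(norm (a + b))\<^sup>2 \<le> 2 * (norm a)\<^sup>2 + 2 * (norm b)\<^sup>2"
  for a b :: "'b::real_normed_vector"
proof -
  have "(norm (a + b))\<^sup>2 \<le> (norm a + norm b)\<^sup>2"
    by (intro power_mono norm_triangle_ineq norm_ge_zero)
  also have "\<dots> \<le> 2 * (norm a)\<^sup>2 + 2 * (norm b)\<^sup>2"
    using sum_squares_bound[of "norm a" "norm b"] by (simp add: power2_sum)
  finally show ?thesis .
qed

lemma square_integrable_zero [simp]: "(\<lambda>x. 0) \<in> square_integrable M"
  by (simp add: square_integrable_def)

lemma square_integrable_add:
  assumes "f \<in> square_integrable M" "g \<in> square_integrable M"
  shows "(\<lambda>x. f x + g x) \<in> square_integrable M"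
proof -
  have [measurable]: "f \<in> borel_measurable M" "g \<in> borel_measurable M"
    using assms by auto
  have "integrable M (\<lambda>x. 2 * (norm (f x))\<^sup>2 + 2 * (norm (g x))\<^sup>2)"
    using assms by (auto simp: square_integrable_def)
  then have "integrable M (\<lambda>x. (norm (f x + g x))\<^sup>2)"
    by (rule Bochner_Integration.integrable_bound) (auto intro!: norm_power2_add_le)
  then show ?thesis by (simp add: square_integrable_def)
qed

lemma square_integrable_scaleR:
  "f \<in> square_integrable M \<Longrightarrow> (\<lambda>x. c *\<^sub>R f x) \<in> square_integrable M"
  by (auto simp: square_integrable_def power_mult_distrib)

lemma square_integrable_uminus:
  "f \<in> square_integrable M \<Longrightarrow> (\<lambda>x. - f x) \<in> square_integrable M"
  by (auto simp: square_integrable_def)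

lemma square_integrable_diff:
  "f \<in> square_integrable M \<Longrightarrow> g \<in> square_integrable M \<Longrightarrow> (\<lambda>x. f x - g x) \<in> square_integrable M"
  using square_integrable_add[of f M "\<lambda>x. - g x"] square_integrable_uminus[of g M] by simp

lemma square_integrable_sum:
  "(\<And>i. i \<in> I \<Longrightarrow> f i \<in> square_integrable M) \<Longrightarrow> (\<lambda>x. \<Sum>i\<in>I. f i x) \<in> square_integrable M"
  by (induction I rule: infinite_finite_induct) (auto intro: square_integrable_add)

lemma (in finite_measure) square_integrable_bounded:
  assumes "f \<in> borel_measurable M" "AE x in M. norm (f x) \<le> B"
  shows "f \<in> square_integrable M"
proof -
  have [measurable]: "f \<in> borel_measurable M" by fact
  have "AE x in M. (norm (f x))\<^sup>2 \<le> B\<^sup>2"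
    using assms(2) by eventually_elim (rule power_mono, auto)
  then have "integrable M (\<lambda>x. (norm (f x))\<^sup>2)"
    by (intro integrable_const_bound[where B="B\<^sup>2"]) auto
  then show ?thesis by (simp add: square_integrable_def)
qed

lemma (in finite_measure) square_integrable_imp_integrable_norm:
  assumes "f \<in> square_integrable M"
  shows "integrable M f"
proof -
  have [measurable]: "f \<in> borel_measurable M" using assms by auto
  have "integrable M (\<lambda>x. norm (f x))"
    by (rule square_integrable_imp_integrable) (use assms in \<open>auto simp: square_integrable_def\<close>)
  then show ?thesis by (simp add: integrable_norm_iff)
qed

lemma integrable_inner:
  assumes "f \<in> square_integrable M" "g \<in> square_integrable M"
  shows "integrable M (\<lambda>x. f x \<bullet> g x)"
proof -
  have [measurable]: "f \<in> borel_measurable M" "g \<in> borel_measurable M" using assms by auto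
  have "integrable M (\<lambda>x. (norm (f x))\<^sup>2 + (norm (g x))\<^sup>2)"
    using assms by (auto simp: square_integrable_def)
  moreover have "\<bar>a \<bullet> b\<bar> \<le> (norm a)\<^sup>2 + (norm b)\<^sup>2" for a b :: 'b
    using Cauchy_Schwarz_ineq2[of a b] sum_squares_bound[of "norm a" "norm b"]
      mult_nonneg_nonneg[OF norm_ge_zero norm_ge_zero, of a b] by linarith
  ultimately show ?thesis
    by (rule_tac Bochner_Integration.integrable_bound) auto
qed

lemma ip_commute: "ip M f g = ip M g f"
  by (simp add: ip_def inner_commute)

lemma ip_add_left:
  assumes "f \<in> square_integrable M" "g \<in> square_integrable M" "h \<in> square_integrable M"
  shows "ip M (\<lambda>x. f x + g x) h = ip M f h + ip M g h"
  using assms by (simp add: ip_def inner_add_left integrable_inner)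

lemma ip_diff_left:
  assumes "f \<in> square_integrable M" "g \<in> square_integrable M" "h \<in> square_integrable M"
  shows "ip M (\<lambda>x. f x - g x) h = ip M f h - ip M g h"
  using assms by (simp add: ip_def inner_diff_left integrable_inner)

lemma ip_scaleR_left: "ip M (\<lambda>x. c *\<^sub>R f x) h = c * ip M f h"
  by (simp add: ip_def)

lemma ip_add_right:
  assumes "f \<in> square_integrable M" "g \<in> square_integrable M" "h \<in> square_integrable M"
  shows "ip M h (\<lambda>x. f x + g x) = ip M h f + ip M h g"
  using ip_add_left[OF assms] by (simp add: ip_commute)

lemma ip_diff_right:
  assumes "f \<in> square_integrable M" "g \<in> square_integrable M" "h \<in> square_integrable M"
  shows "ip M h (\<lambda>x. f x - g x) = ip M h f - ip M h g"
  using ip_diff_left[OF assms] by (simp add: ip_commute)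

lemma ip_scaleR_right: "ip M h (\<lambda>x. c *\<^sub>R f x) = c * ip M h f"
  by (simp add: ip_def)

lemma ip_zero [simp]: "ip M (\<lambda>x. 0) f = 0" "ip M f (\<lambda>x. 0) = 0"
  by (simp_all add: ip_def)

lemma ip_sum_left:
  assumes "\<And>i. i \<in> I \<Longrightarrow> f i \<in> square_integrable M" "h \<in> square_integrable M"
  shows "ip M (\<lambda>x. \<Sum>i\<in>I. f i x) h = (\<Sum>i\<in>I. ip M (f i) h)"
  using assms(1)
  by (induction I rule: infinite_finite_induct)
     (auto simp: ip_add_left assms(2) square_integrable_sum)

lemma ip_AE_cong:
  assumes "f \<in> square_integrable M" "f' \<in> square_integrable M"
    "g \<in> square_integrable M" "g' \<in> square_integrable M"
    "AE x in M. f x = f' x" "AE x in M. g x = g' x"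
  shows "ip M f g = ip M f' g'"
  unfolding ip_def
  by (intro integral_cong_AE borel_measurable_inner)
     (use assms in \<open>auto elim: eventually_elim2\<close>)

lemma ip_self: "ip M f f = (\<integral>x. (norm (f x))\<^sup>2 \<partial>M)"
  by (simp add: ip_def dot_square_norm)

lemma ip_self_nonneg [simp]: "0 \<le> ip M f f"
  by (simp add: ip_self)

lemma nrm_nonneg [simp]: "0 \<le> nrm M f"
  by (simp add: nrm_def)

lemma nrm_power2: "(nrm M f)\<^sup>2 = ip M f f"
  by (simp add: nrm_def)

lemma nrm_zero [simp]: "nrm M (\<lambda>x. 0) = 0"
  by (simp add: nrm_def)

lemma nrm_scaleR: "nrm M (\<lambda>x. c *\<^sub>R f x) = \<bar>c\<bar> * nrm M f"
  by (simp add: nrm_def ip_scaleR_left ip_scaleR_right real_sqrt_mult[symmetric] abs_mult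
    flip: real_sqrt_abs2)

lemma nrm_AE_cong:
  assumes "f \<in> square_integrable M" "g \<in> square_integrable M" "AE x in M. f x = g x"
  shows "nrm M f = nrm M g"
  unfolding nrm_def by (subst ip_AE_cong[of f M g f g]) (use assms in auto)

lemma nrm_eq_0_AE:
  assumes "f \<in> square_integrable M" "nrm M f = 0"
  shows "AE x in M. f x = 0"
proof -
  have "(\<integral>x. (norm (f x))\<^sup>2 \<partial>M) = 0"
    using assms(2) by (simp add: nrm_def ip_self)
  then have "AE x in M. (norm (f x))\<^sup>2 = 0"
    using assms(1) by (subst (asm) integral_nonneg_eq_0_iff_AE) (auto simp: square_integrable_def)
  then show ?thesis by simp
qed

lemma ip_cauchy_schwarz:
  assumes f: "f \<in> square_integrable M" and g: "g \<in> square_integrable M"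
  shows "\<bar>ip M f g\<bar> \<le> nrm M f * nrm M g"
proof -
  have q: "0 \<le> ip M f f + 2 * t * ip M f g + t\<^sup>2 * ip M g g" for t
  proof -
    have "0 \<le> ip M (\<lambda>x. f x + t *\<^sub>R g x) (\<lambda>x. f x + t *\<^sub>R g x)" by simp
    also have "\<dots> = ip M f f + 2 * t * ip M f g + t\<^sup>2 * ip M g g"
      using f g
      by (simp add: ip_add_left ip_add_right square_integrable_add square_integrable_scaleR
          ip_scaleR_left ip_scaleR_right ip_commute[of M g f] power2_eq_square algebra_simps)
    finally show ?thesis .
  qed
  have "(ip M f g)\<^sup>2 \<le> ip M f f * ip M g g"
  proof (cases "ip M g g = 0")
    case True
    have "ip M f g = 0"
    proof (rule ccontr)
      assume n: "ip M f g \<noteq> 0"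
      \<comment> \<open>The quadratic is linear here, and this is the \<open>t\<close> at which it
        takes the value -1.\<close>
      have "0 \<le> ip M f f + 2 * (- (ip M f f + 1) / (2 * ip M f g)) * ip M f g"
        using q[of "- (ip M f f + 1) / (2 * ip M f g)"] True by simp
      also have "\<dots> = - 1" using n by (simp add: field_simps)
      finally show False by simp
    qed
    then show ?thesis by simp
  next
    case False
    then have pos: "ip M g g > 0" using ip_self_nonneg[of M g] by linarith
    \<comment> \<open>This \<open>t\<close> minimises the quadratic.\<close>
    have "0 \<le> ip M f f + 2 * (- ip M f g / ip M g g) * ip M f g + (- ip M f g / ip M g g)\<^sup>2 * ip M g g"
      by (rule q)
    also have "\<dots> = ip M f f - (ip M f g)\<^sup>2 / ip M g g"
      using pos by (simp add: power2_eq_square field_simps)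
    finally show ?thesis using pos by (simp add: field_simps)
  qed
  then have "sqrt ((ip M f g)\<^sup>2) \<le> sqrt (ip M f f * ip M g g)" by (rule real_sqrt_le_mono)
  then show ?thesis by (simp add: nrm_def real_sqrt_mult)
qed

lemma nrm_triangle:
  assumes f: "f \<in> square_integrable M" and g: "g \<in> square_integrable M"
  shows "nrm M (\<lambda>x. f x + g x) \<le> nrm M f + nrm M g"
proof (rule power2_le_imp_le)
  have "(nrm M (\<lambda>x. f x + g x))\<^sup>2 = ip M f f + 2 * ip M f g + ip M g g"
    using f g by (simp add: nrm_power2 ip_add_left ip_add_right square_integrable_add ip_commute[of M g f])
  also have "\<dots> \<le> (nrm M f)\<^sup>2 + 2 * (nrm M f * nrm M g) + (nrm M g)\<^sup>2"
    using ip_cauchy_schwarz[OF f g] by (simp add: nrm_power2)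
  finally show "(nrm M (\<lambda>x. f x + g x))\<^sup>2 \<le> (nrm M f + nrm M g)\<^sup>2"
    by (simp add: power2_sum algebra_simps)
qed simp

lemma nrm_diff_commute: "nrm M (\<lambda>x. f x - g x) = nrm M (\<lambda>x. g x - f x)"
  by (simp add: nrm_def ip_self norm_minus_commute)

lemma nrm_diff_triangle:
  assumes "f \<in> square_integrable M" "g \<in> square_integrable M" "h \<in> square_integrable M"
  shows "nrm M (\<lambda>x. f x - h x) \<le> nrm M (\<lambda>x. f x - g x) + nrm M (\<lambda>x. g x - h x)"
  using nrm_triangle[of "\<lambda>x. f x - g x" M "\<lambda>x. g x - h x"] assms
  by (simp add: square_integrable_diff)

lemma nrm_le_diff:
  assumes "f \<in> square_integrable M" "g \<in> square_integrable M"
  shows "nrm M f \<le> nrm M g + nrm M (\<lambda>x. f x - g x)"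
  using nrm_triangle[of g M "\<lambda>x. f x - g x"] assms by (simp add: square_integrable_diff)

lemma nrm_sum_le:
  assumes "\<And>i. i \<in> I \<Longrightarrow> f i \<in> square_integrable M"
  shows "nrm M (\<lambda>x. \<Sum>i\<in>I. f i x) \<le> (\<Sum>i\<in>I. nrm M (f i))"
  using assms
proof (induction I rule: infinite_finite_induct)
  case (insert i I)
  have "nrm M (\<lambda>x. f i x + (\<Sum>i\<in>I. f i x)) \<le> nrm M (f i) + nrm M (\<lambda>x. \<Sum>i\<in>I. f i x)"
    by (intro nrm_triangle square_integrable_sum) (use insert in auto)
  with insert show ?case by simp
qed auto

text \<open>Stated through the midpoint because the midpoint of two residuals \<open>f - d\<close>
  is again a residual, hence no shorter than the infimum.\<close>

lemma nrm_parallelogram: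
  assumes f: "f \<in> square_integrable M" and g: "g \<in> square_integrable M"
  shows "(nrm M (\<lambda>x. f x - g x))\<^sup>2 = 2 * (nrm M f)\<^sup>2 + 2 * (nrm M g)\<^sup>2 - 4 * (nrm M (\<lambda>x. (1/2) *\<^sub>R (f x + g x)))\<^sup>2"
  using f g by (simp add: nrm_scaleR power_mult_distrib nrm_power2 ip_add_left ip_add_right ip_diff_left ip_diff_right
      square_integrable_add square_integrable_diff ip_commute[of M g f] power_divide)
    (simp add: add_divide_distrib)

lemma (in prob_space) integral_norm_le_nrm:
  assumes "f \<in> square_integrable M"
  shows "(\<integral>x. norm (f x) \<partial>M) \<le> nrm M f"
proof -
  have n: "(\<lambda>x. norm (f x)) \<in> square_integrable M"
    using assms by (auto simp: square_integrable_def)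
  have o: "(\<lambda>x. 1::real) \<in> square_integrable M"
    by (simp add: square_integrable_def)
  have "ip M (\<lambda>x. norm (f x)) (\<lambda>x. 1) \<le> nrm M (\<lambda>x. norm (f x)) * nrm M (\<lambda>x. 1::real)"
    using ip_cauchy_schwarz[OF n o] by linarith
  then show ?thesis
    by (simp add: nrm_def ip_self) (simp add: ip_def prob_space)
qed

lemma (in prob_space) nrm_bounded_le:
  assumes "f \<in> borel_measurable M" "AE x in M. norm (f x) \<le> B" "0 \<le> B"
  shows "nrm M f \<le> B"
proof -
  have [measurable]: "f \<in> borel_measurable M" by fact
  have "AE x in M. (norm (f x))\<^sup>2 \<le> B\<^sup>2"
    using assms(2) by eventually_elim (rule power_mono, auto)
  moreover have "integrable M (\<lambda>x. (norm (f x))\<^sup>2)"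
    using square_integrable_bounded[OF assms(1,2)] by (simp add: square_integrable_def)
  ultimately have "(\<integral>x. (norm (f x))\<^sup>2 \<partial>M) \<le> (\<integral>x. B\<^sup>2 \<partial>M)"
    by (intro integral_mono_AE) auto
  also have "\<dots> = B\<^sup>2" by (simp add: prob_space)
  finally show ?thesis
    unfolding nrm_def ip_self using real_le_lsqrt assms(3) by blast
qed

lemma nrm_tendsto_ip:
  assumes u: "\<And>n. u n \<in> square_integrable M" and v: "v \<in> square_integrable M" and f: "f \<in> square_integrable M"
    and lim: "(\<lambda>n. nrm M (\<lambda>x. u n x - v x)) \<longlonglongrightarrow> 0"
  shows "(\<lambda>n. ip M (u n) f) \<longlonglongrightarrow> ip M v f"
proof (rule Lim_transform_bound[of "\<lambda>n. ip M (u n) f - ip M v f" "\<lambda>n. nrm M (\<lambda>x. u n x - v x) * nrm M f" for n, THEN LIM_zero_cancel])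
  show "\<forall>\<^sub>F n in sequentially. norm (ip M (u n) f - ip M v f) \<le> norm (nrm M (\<lambda>x. u n x - v x) * nrm M f)"
    using ip_cauchy_schwarz[OF square_integrable_diff[OF u v] f] u v f
    by (auto simp: ip_diff_left)
  show "(\<lambda>n. nrm M (\<lambda>x. u n x - v x) * nrm M f) \<longlonglongrightarrow> 0"
    using tendsto_mult_right[OF lim, of "nrm M f"] by simp
qed

lemma nrm_tendsto:
  assumes u: "\<And>n. u n \<in> square_integrable M" and v: "v \<in> square_integrable M"
    and lim: "(\<lambda>n. nrm M (\<lambda>x. u n x - v x)) \<longlonglongrightarrow> 0"
  shows "(\<lambda>n. nrm M (u n)) \<longlonglongrightarrow> nrm M v"
proof (rule Lim_transform_bound[OF _ lim, of "\<lambda>n. nrm M (u n) - nrm M v", THEN LIM_zero_cancel])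
  show "\<forall>\<^sub>F n in sequentially. norm (nrm M (u n) - nrm M v) \<le> norm (nrm M (\<lambda>x. u n x - v x))"
  proof (rule always_eventually, rule allI)
    fix n
    show "norm (nrm M (u n) - nrm M v) \<le> norm (nrm M (\<lambda>x. u n x - v x))"
      using nrm_le_diff[OF u[of n] v] nrm_le_diff[OF v u[of n]] nrm_diff_commute[of M "u n" v]
      by simp
  qed
qed

section \<open>Completeness and orthogonal residuals\<close>

text \<open>On a probability space an L2-Cauchy sequence is L1-Cauchy, so a subsequence converges
  almost everywhere; Fatou's lemma carries the Cauchy bound over to the distance from the
  limit.\<close>

lemma (in prob_space) square_integrable_complete:
  fixes u :: "nat \<Rightarrow> 'a \<Rightarrow> 'b::euclidean_space"
  assumes u: "\<And>n. u n \<in> square_integrable M"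
    and cauchy: "\<And>e. e > 0 \<Longrightarrow> \<exists>N. \<forall>i\<ge>N. \<forall>j\<ge>N. nrm M (\<lambda>x. u i x - u j x) < e"
  obtains v where "v \<in> square_integrable M" "(\<lambda>n. nrm M (\<lambda>x. u n x - v x)) \<longlonglongrightarrow> 0"
proof -
  have [measurable]: "u n \<in> borel_measurable M" for n using u by auto
  have "\<exists>N. \<forall>i\<ge>N. \<forall>j\<ge>N. (LINT x|M. norm (u i x - u j x)) < e" if "e > 0" for e
    using cauchy[OF that] integral_norm_le_nrm[OF square_integrable_diff[OF u u]]
    by (meson le_less_trans)
  then obtain r where r: "strict_mono r" "AE x in M. Cauchy (\<lambda>i. u (r i) x)"
    using cauchy_L1_AE_cauchy_subseq[of M u] square_integrable_imp_integrable_norm[OF u] by metis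
  define v where "v x = lim (\<lambda>i. u (r i) x)" for x
  have [measurable]: "v \<in> borel_measurable M" unfolding v_def by measurable
  have conv: "AE x in M. (\<lambda>i. u (r i) x) \<longlonglongrightarrow> v x"
    using r(2) by eventually_elim (simp add: v_def Cauchy_convergent_iff convergent_LIMSEQ_iff)
  have fatou: "(\<integral>\<^sup>+x. ennreal ((norm (u n x - v x))\<^sup>2) \<partial>M) \<le> ennreal (e\<^sup>2)"
    if n: "n \<ge> N" and e: "e > 0" and N: "\<forall>i\<ge>N. \<forall>j\<ge>N. nrm M (\<lambda>x. u i x - u j x) < e" for n N e
  proof -
    have "(\<integral>\<^sup>+x. ennreal ((norm (u n x - v x))\<^sup>2) \<partial>M)
        = (\<integral>\<^sup>+x. liminf (\<lambda>i. ennreal ((norm (u n x - u (r i) x))\<^sup>2)) \<partial>M)"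
    proof (rule nn_integral_cong_AE)
      show "AE x in M. ennreal ((norm (u n x - v x))\<^sup>2) = liminf (\<lambda>i. ennreal ((norm (u n x - u (r i) x))\<^sup>2))"
        using conv
      proof eventually_elim
        case (elim x)
        have "(\<lambda>i. ennreal ((norm (u n x - u (r i) x))\<^sup>2)) \<longlonglongrightarrow> ennreal ((norm (u n x - v x))\<^sup>2)"
          by (intro tendsto_intros elim)
        from lim_imp_Liminf[OF _ this] show ?case by simp
      qed
    qed
    also have "\<dots> \<le> liminf (\<lambda>i. \<integral>\<^sup>+x. ennreal ((norm (u n x - u (r i) x))\<^sup>2) \<partial>M)"
      by (rule nn_integral_liminf) measurable
    also have "\<dots> = liminf (\<lambda>i. ennreal ((nrm M (\<lambda>x. u n x - u (r i) x))\<^sup>2))"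
      using square_integrable_diff[OF u u]
      by (subst nn_integral_eq_integral) (auto simp: square_integrable_def nrm_power2 ip_self)
    also have "\<dots> \<le> liminf (\<lambda>i. ennreal (e\<^sup>2))"
    proof (rule Liminf_mono)
      have "\<forall>\<^sub>F i in sequentially. r i \<ge> N"
        using filterlim_subseq[OF r(1)] by (simp add: filterlim_at_top)
      then show "\<forall>\<^sub>F i in sequentially. ennreal ((nrm M (\<lambda>x. u n x - u (r i) x))\<^sup>2) \<le> ennreal (e\<^sup>2)"
      proof eventually_elim
        case (elim i)
        then have "nrm M (\<lambda>x. u n x - u (r i) x) < e" using N n by blast
        then show ?case by (intro ennreal_leI power_mono) auto
      qed
    qed
    also have "\<dots> = ennreal (e\<^sup>2)" by (simp add: Liminf_const)
    finally show ?thesis .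
  qed
  have si: "(\<lambda>x. u n x - v x) \<in> square_integrable M"
    and le: "nrm M (\<lambda>x. u n x - v x) \<le> e"
    if n: "n \<ge> N" and e: "e > 0" and N: "\<forall>i\<ge>N. \<forall>j\<ge>N. nrm M (\<lambda>x. u i x - u j x) < e" for n N e
  proof -
    note f = fatou[OF that]
    have "integrable M (\<lambda>x. (norm (u n x - v x))\<^sup>2)"
      by (rule integrableI_bounded) (use f in \<open>auto simp: le_less_trans[OF _ ennreal_less_top]\<close>)
    then show si: "(\<lambda>x. u n x - v x) \<in> square_integrable M" by (simp add: square_integrable_def)
    have "ennreal (ip M (\<lambda>x. u n x - v x) (\<lambda>x. u n x - v x)) \<le> ennreal (e\<^sup>2)"
      unfolding ip_self using f \<open>integrable M _\<close> by (subst (asm) nn_integral_eq_integral) auto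
    then show "nrm M (\<lambda>x. u n x - v x) \<le> e"
      using e by (simp add: nrm_def real_le_lsqrt)
  qed
  obtain N where "\<forall>i\<ge>N. \<forall>j\<ge>N. nrm M (\<lambda>x. u i x - u j x) < 1" using cauchy[of 1] by auto
  from si[OF order_refl zero_less_one this] have "(\<lambda>x. u N x - v x) \<in> square_integrable M" .
  from square_integrable_diff[OF u[of N] this] have v: "v \<in> square_integrable M" by simp
  have "(\<lambda>n. nrm M (\<lambda>x. u n x - v x)) \<longlonglongrightarrow> 0"
  proof (rule LIMSEQ_I)
    fix e :: real assume e: "e > 0"
    obtain N where N: "\<forall>i\<ge>N. \<forall>j\<ge>N. nrm M (\<lambda>x. u i x - u j x) < e / 2" using cauchy[of "e/2"] e by auto
    have "norm (nrm M (\<lambda>x. u n x - v x) - 0) < e" if "n \<ge> N" for n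
      using le[OF that _ N] e by simp
    then show "\<exists>N. \<forall>n\<ge>N. norm (nrm M (\<lambda>x. u n x - v x) - 0) < e" by blast
  qed
  with v show thesis by (rule that)
qed

text \<open>The residual \<open>r\<close> is the limit of \<open>f - d\<close> along a minimising sequence in \<open>D\<close>; the
  parallelogram identity makes that sequence Cauchy.\<close>

lemma (in prob_space) orthogonal_residual:
  fixes f :: "'a \<Rightarrow> 'b::euclidean_space"
  assumes D: "D \<subseteq> square_integrable M" and D0: "(\<lambda>x. 0) \<in> D"
    and Dadd: "\<And>u v. u \<in> D \<Longrightarrow> v \<in> D \<Longrightarrow> (\<lambda>x. u x + v x) \<in> D"
    and Dscale: "\<And>c u. u \<in> D \<Longrightarrow> (\<lambda>x. c *\<^sub>R u x) \<in> D"
    and f: "f \<in> square_integrable M"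
  shows "\<exists>r\<in>square_integrable M. (\<forall>d\<in>D. ip M r d = 0) \<and>
    (\<forall>e>0. \<exists>d\<in>D. nrm M (\<lambda>x. f x - d x - r x) < e)"
proof -
  define S where "S = (\<lambda>d. (nrm M (\<lambda>x. f x - d x))\<^sup>2) ` D"
  define c where "c = Inf S"
  have bdd: "bdd_below S" unfolding S_def by (intro bdd_belowI2[where m=0]) simp
  have ne: "S \<noteq> {}" using D0 by (auto simp: S_def)
  have cle: "c \<le> (nrm M (\<lambda>x. f x - d x))\<^sup>2" if "d \<in> D" for d
    unfolding c_def by (rule cInf_lower[OF _ bdd]) (use that in \<open>auto simp: S_def\<close>)
  have "\<exists>d\<in>D. (nrm M (\<lambda>x. f x - d x))\<^sup>2 < c + 1 / Suc n" for n
  proof -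
    have "c < c + 1 / Suc n" by simp
    then obtain s where "s \<in> S" "s < c + 1 / Suc n"
      unfolding c_def using cInf_lessD[OF ne] by metis
    then show ?thesis by (auto simp: S_def)
  qed
  then obtain d where d: "\<And>n. d n \<in> D" "\<And>n. (nrm M (\<lambda>x. f x - d n x))\<^sup>2 < c + 1 / Suc n" by metis
  have dL: "d n \<in> square_integrable M" for n using d D by auto
  define u where "u n x = f x - d n x" for n x
  have u: "u n \<in> square_integrable M" for n
    unfolding u_def by (intro square_integrable_diff f dL)
  have mid: "c \<le> (nrm M (\<lambda>x. (1/2) *\<^sub>R (u m x + u n x)))\<^sup>2" for m n
  proof -
    have "(\<lambda>x. (1/2) *\<^sub>R (d m x + d n x)) \<in> D" by (intro Dscale Dadd d)
    from cle[OF this] show ?thesis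
      by (simp add: u_def algebra_simps flip: scaleR_add_left)
  qed
  have uu: "(nrm M (\<lambda>x. u m x - u n x))\<^sup>2 < 2 / Suc m + 2 / Suc n" for m n
    unfolding nrm_parallelogram[OF u u] using mid[of m n] d(2)[of m] d(2)[of n]
    by (simp add: u_def[abs_def])
  have "\<exists>N. \<forall>i\<ge>N. \<forall>j\<ge>N. nrm M (\<lambda>x. u i x - u j x) < e" if e: "e > 0" for e
  proof -
    obtain N where N: "4 / e\<^sup>2 < real N" using reals_Archimedean2 by blast
    have "nrm M (\<lambda>x. u i x - u j x) < e" if "i \<ge> N" "j \<ge> N" for i j
    proof (rule power2_less_imp_less)
      have "0 < 4 / e\<^sup>2" using e by simp
      with N have "0 < real N" by linarith
      then have N0: "N > 0" by simp
      have "2 / real (Suc i) \<le> 2 / real N" "2 / real (Suc j) \<le> 2 / real N"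
        using that N0 by (auto intro!: divide_left_mono)
      then have "(nrm M (\<lambda>x. u i x - u j x))\<^sup>2 < 4 / real N"
        using uu[of i j] by simp
      also have "\<dots> < e\<^sup>2" using N N0 e by (simp add: field_simps)
      finally show "(nrm M (\<lambda>x. u i x - u j x))\<^sup>2 < e\<^sup>2" .
    qed (use e in simp)
    then show ?thesis by blast
  qed
  then obtain r where r: "r \<in> square_integrable M" "(\<lambda>n. nrm M (\<lambda>x. u n x - r x)) \<longlonglongrightarrow> 0"
    by (rule square_integrable_complete[of u, OF u])
  have rc: "(nrm M r)\<^sup>2 \<le> c"
  proof (rule LIMSEQ_le)
    show "(\<lambda>n. (nrm M (u n))\<^sup>2) \<longlonglongrightarrow> (nrm M r)\<^sup>2"
      by (intro tendsto_power nrm_tendsto u r)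
    show "(\<lambda>n. c + 1 / Suc n) \<longlonglongrightarrow> c"
      using tendsto_add[OF tendsto_const LIMSEQ_inverse_real_of_nat, of c] by (simp add: inverse_eq_divide)
    show "\<exists>N. \<forall>n\<ge>N. (nrm M (u n))\<^sup>2 \<le> c + 1 / real (Suc n)"
      using d(2) by (auto simp: u_def[abs_def] less_imp_le)
  qed
  have "ip M r e = 0" if e: "e \<in> D" for e
  proof -
    have eL: "e \<in> square_integrable M" using e D by auto
    have q: "c \<le> (nrm M r)\<^sup>2 - 2 * t * ip M r e + t\<^sup>2 * ip M e e" for t
    proof (rule LIMSEQ_le_const)
      have "(\<lambda>n. (nrm M (u n))\<^sup>2 - 2 * t * ip M (u n) e + t\<^sup>2 * ip M e e) \<longlonglongrightarrow> (nrm M r)\<^sup>2 - 2 * t * ip M r e + t\<^sup>2 * ip M e e"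
        by (intro tendsto_intros nrm_tendsto nrm_tendsto_ip u r eL)
      then show "(\<lambda>n. (nrm M (u n))\<^sup>2 - 2 * t * ip M (u n) e + t\<^sup>2 * ip M e e) \<longlonglongrightarrow> (nrm M r)\<^sup>2 - 2 * t * ip M r e + t\<^sup>2 * ip M e e" .
      have "c \<le> (nrm M (u n))\<^sup>2 - 2 * t * ip M (u n) e + t\<^sup>2 * ip M e e" for n
      proof -
        have "(\<lambda>x. d n x + t *\<^sub>R e x) \<in> D" by (intro Dadd Dscale d e)
        from cle[OF this] have "c \<le> (nrm M (\<lambda>x. u n x - t *\<^sub>R e x))\<^sup>2"
          by (simp add: u_def algebra_simps)
        also have "\<dots> = (nrm M (u n))\<^sup>2 - 2 * t * ip M (u n) e + t\<^sup>2 * ip M e e"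
          using u[of n] eL
          unfolding nrm_power2
          by (simp add: ip_diff_left ip_diff_right square_integrable_diff square_integrable_scaleR
              ip_scaleR_left ip_scaleR_right ip_commute[of M e "u n"] power2_eq_square algebra_simps)
        finally show ?thesis .
      qed
      then show "\<exists>N. \<forall>n\<ge>N. c \<le> (nrm M (u n))\<^sup>2 - 2 * t * ip M (u n) e + t\<^sup>2 * ip M e e" by blast
    qed
    have q': "2 * t * ip M r e \<le> t\<^sup>2 * ip M e e" for t using q[of t] rc by linarith
    define s where "s = ip M e e"
    have s: "s \<ge> 0" by (simp add: s_def)
    \<comment> \<open>The optimal step would be \<open>ip M r e / s\<close>; the denominator
      \<open>s + 1\<close> avoids the case \<open>s = 0\<close> and still forces
      \<open>t = 0\<close>.\<close>
    define t where "t = ip M r e / (s + 1)"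
    have X: "ip M r e = t * (s + 1)" using s by (simp add: t_def)
    have "t\<^sup>2 * (s + 2) \<le> 0"
      using q'[of t] unfolding X s_def[symmetric] by (simp add: power2_eq_square algebra_simps)
    then have "t = 0" using s by (simp add: mult_le_0_iff)
    then show ?thesis using X by simp
  qed
  moreover have "\<exists>d\<in>D. nrm M (\<lambda>x. f x - d x - r x) < e" if "e > 0" for e
  proof -
    have "\<forall>\<^sub>F n in sequentially. nrm M (\<lambda>x. u n x - r x) < e"
      using order_tendstoD(2)[OF r(2) that] .
    then obtain n where "nrm M (\<lambda>x. u n x - r x) < e" using eventually_happens by fastforce
    then show ?thesis using d(1)[of n] by (auto simp: u_def)
  qed
  ultimately show ?thesis using r(1) by blast
qed

section \<open>Measure-preserving actions and the mean ergodic theorem\<close>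

text \<open>The topology is dropped so that the product with the diagonal action is another
  instance. Countability of the group lets almost-everywhere identities, one for each element, hold
  together off a single null set.\<close>

locale measure_preserving_action = group G + prob_space M
  for G :: "('g, 'm) monoid_scheme" (structure) and M :: "'x measure" +
  fixes \<phi> :: "'g \<Rightarrow> 'x \<Rightarrow> 'x"
  assumes countable_carrier: "countable (carrier G)"
    and space_UNIV: "space M = UNIV"
    and action_measurable: "g \<in> carrier G \<Longrightarrow> \<phi> g \<in> measurable M M"
    and action_distr: "g \<in> carrier G \<Longrightarrow> distr M M (\<phi> g) = M"
    and action_mult: "g \<in> carrier G \<Longrightarrow> h \<in> carrier G \<Longrightarrow> \<phi> (g \<otimes> h) x = \<phi> g (\<phi> h x)"
begin

text \<open>For the diagonal action on pairs this becomes \<open>averaged\<close>.\<close>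

definition avg :: "'g set \<Rightarrow> ('x \<Rightarrow> 'b::real_vector) \<Rightarrow> 'x \<Rightarrow> 'b" where
  "avg A f x = (1 / real (card A)) *\<^sub>R (\<Sum>g\<in>A. f (\<phi> g x))"

lemma action_compose_measurable:
  "g \<in> carrier G \<Longrightarrow> f \<in> measurable M N \<Longrightarrow> (\<lambda>x. f (\<phi> g x)) \<in> measurable M N"
  using measurable_compose[OF action_measurable] by blast

lemma AE_action:
  assumes "g \<in> carrier G" "AE x in M. P x"
  shows "AE x in M. P (\<phi> g x)"
proof (rule AE_distrD[OF action_measurable[OF assms(1)]])
  show "AE x in distr M M (\<phi> g). P x" unfolding action_distr[OF assms(1)] by (rule assms(2))
qed

lemma AE_carrier:
  assumes "\<And>g. g \<in> carrier G \<Longrightarrow> AE x in M. P g x"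
  shows "AE x in M. \<forall>g\<in>carrier G. P g x"
  using AE_ball_countable[OF countable_carrier, of "\<lambda>x g. P g x" M] assms by blast

lemma integral_action:
  fixes f :: "'x \<Rightarrow> 'b::{banach, second_countable_topology}"
  assumes "g \<in> carrier G" "f \<in> borel_measurable M"
  shows "(\<integral>x. f (\<phi> g x) \<partial>M) = (\<integral>x. f x \<partial>M)"
  using integral_distr[OF action_measurable[OF assms(1)] assms(2)] assms(1) by (simp add: action_distr)

lemma integrable_action:
  fixes f :: "'x \<Rightarrow> 'b::{banach, second_countable_topology}"
  assumes "g \<in> carrier G" "integrable M f"
  shows "integrable M (\<lambda>x. f (\<phi> g x))"
  using integrable_distr[OF action_measurable[OF assms(1)], of f] assms by (simp add: action_distr)

lemma square_integrable_action:
  assumes "g \<in> carrier G" "f \<in> square_integrable M"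
  shows "(\<lambda>x. f (\<phi> g x)) \<in> square_integrable M"
  using action_compose_measurable[OF assms(1), of f borel]
    integrable_action[OF assms(1), of "\<lambda>x. (norm (f x))\<^sup>2"] assms
  by (auto simp: square_integrable_def)

lemma ip_action:
  assumes "g \<in> carrier G" "f \<in> square_integrable M" "h \<in> square_integrable M"
  shows "ip M (\<lambda>x. f (\<phi> g x)) (\<lambda>x. h (\<phi> g x)) = ip M f h"
proof -
  have [measurable]: "f \<in> borel_measurable M" "h \<in> borel_measurable M" using assms by auto
  show ?thesis unfolding ip_def by (rule integral_action[OF assms(1)]) measurable
qed

lemma nrm_action:
  assumes "g \<in> carrier G" "f \<in> square_integrable M"
  shows "nrm M (\<lambda>x. f (\<phi> g x)) = nrm M f"
  by (simp add: nrm_def ip_action assms)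

lemma square_integrable_avg:
  assumes "A \<subseteq> carrier G" "f \<in> square_integrable M"
  shows "avg A f \<in> square_integrable M"
  unfolding avg_def[abs_def]
  by (intro square_integrable_scaleR square_integrable_sum square_integrable_action) (use assms in auto)

lemma avg_measurable:
  fixes f :: "'x \<Rightarrow> 'b::{second_countable_topology, real_normed_vector}"
  assumes "A \<subseteq> carrier G" "f \<in> borel_measurable M"
  shows "avg A f \<in> borel_measurable M"
  unfolding avg_def[abs_def]
  by (intro borel_measurable_scaleR borel_measurable_sum borel_measurable_const action_compose_measurable)
     (use assms in auto)

lemma avg_add: "avg A (\<lambda>x. f x + h x) x = avg A f x + avg A h x"
  by (simp add: avg_def sum.distrib scaleR_add_right)

lemma avg_diff: "avg A (\<lambda>x. f x - h x) x = avg A f x - avg A h x"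
  by (simp add: avg_def sum_subtractf scaleR_diff_right)

lemma avg_scaleR: "avg A (\<lambda>x. c *\<^sub>R f x) x = c *\<^sub>R avg A f x"
  by (simp add: avg_def mult.commute flip: scaleR_sum_right)

lemma nrm_avg_le:
  assumes "finite A" "A \<subseteq> carrier G" "f \<in> square_integrable M"
  shows "nrm M (avg A f) \<le> nrm M f"
proof -
  have "nrm M (avg A f) = (1 / real (card A)) * nrm M (\<lambda>x. \<Sum>g\<in>A. f (\<phi> g x))"
    unfolding avg_def[abs_def] nrm_scaleR by simp
  also have "\<dots> \<le> (1 / real (card A)) * (\<Sum>g\<in>A. nrm M (\<lambda>x. f (\<phi> g x)))"
    by (intro mult_left_mono nrm_sum_le square_integrable_action) (use assms in auto)
  also have "(\<Sum>g\<in>A. nrm M (\<lambda>x. f (\<phi> g x))) = (\<Sum>g\<in>A. nrm M f)"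
    by (intro sum.cong refl nrm_action) (use assms in auto)
  also have "(1 / real (card A)) * \<dots> \<le> nrm M f" by simp
  finally show ?thesis .
qed

lemma integral_avg:
  fixes f :: "'x \<Rightarrow> real"
  assumes "finite A" "A \<noteq> {}" "A \<subseteq> carrier G" "integrable M f"
  shows "integrable M (avg A f)" "(\<integral>x. avg A f x \<partial>M) = (\<integral>x. f x \<partial>M)"
proof -
  have i: "integrable M (\<lambda>x. f (\<phi> g x))" if "g \<in> A" for g
    using integrable_action[of g f] assms that by auto
  show "integrable M (avg A f)"
    unfolding avg_def[abs_def] using i by auto
  have "(\<integral>x. avg A f x \<partial>M) = (1 / real (card A)) * (\<Sum>g\<in>A. \<integral>x. f (\<phi> g x) \<partial>M)"
    unfolding avg_def[abs_def] using i by simp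
  also have "(\<Sum>g\<in>A. \<integral>x. f (\<phi> g x) \<partial>M) = (\<Sum>g\<in>A. \<integral>x. f x \<partial>M)"
    by (intro sum.cong refl integral_action) (use assms in auto)
  finally show "(\<integral>x. avg A f x \<partial>M) = (\<integral>x. f x \<partial>M)" using assms by simp
qed

text \<open>Composing with \<open>\<phi> h\<close> turns the sum over \<open>A\<close> into one over
  the left translate \<open>h <# A\<close>. The common part cancels, and each remaining term has the
  norm of \<open>f\<close>.\<close>

lemma nrm_avg_coboundary_le:
  assumes A: "finite A" "A \<subseteq> carrier G" and h: "h \<in> carrier G" and f: "f \<in> square_integrable M"
  shows "nrm M (\<lambda>x. avg A (\<lambda>x. f (\<phi> h x)) x - avg A f x)
      \<le> real (card (sym_diff (h <# A) A)) / real (card A) * nrm M f"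
proof -
  have hA: "h <# A = (\<lambda>g. h \<otimes> g) ` A" by (auto simp: l_coset_def)
  have inj: "inj_on (\<lambda>g. h \<otimes> g) A"
    using inj_on_multc[OF h] h A(2) by (auto simp: inj_on_def subset_iff)
  have fin: "finite (h <# A)" using A by (simp add: hA)
  have sub: "h <# A \<subseteq> carrier G" using A h by (auto simp: hA)
  have "(\<Sum>g\<in>A. f (\<phi> h (\<phi> g x))) = (\<Sum>k\<in>(h <# A). f (\<phi> k x))" for x
    unfolding hA sum.reindex[OF inj] o_def
    by (intro sum.cong refl) (use A h in \<open>auto simp: action_mult\<close>)
  moreover have "(\<Sum>k\<in>(h <# A). f (\<phi> k x)) - (\<Sum>k\<in>A. f (\<phi> k x))
      = (\<Sum>k\<in>(h <# A) - A. f (\<phi> k x)) - (\<Sum>k\<in>A - (h <# A). f (\<phi> k x))" for x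
    using sum.Int_Diff[OF fin, of "\<lambda>k. f (\<phi> k x)" A] sum.Int_Diff[OF A(1), of "\<lambda>k. f (\<phi> k x)" "h <# A"]
    by (simp add: Int_commute)
  ultimately have eq: "avg A (\<lambda>x. f (\<phi> h x)) x - avg A f x
      = (1 / real (card A)) *\<^sub>R ((\<Sum>k\<in>(h <# A) - A. f (\<phi> k x)) - (\<Sum>k\<in>A - (h <# A). f (\<phi> k x)))" for x
    by (simp add: avg_def flip: scaleR_diff_right)
  have s: "(\<lambda>x. \<Sum>k\<in>B. f (\<phi> k x)) \<in> square_integrable M" if "B \<subseteq> carrier G" for B
    by (intro square_integrable_sum square_integrable_action f) (use that in auto)
  have n: "nrm M (\<lambda>x. \<Sum>k\<in>B. f (\<phi> k x)) \<le> real (card B) * nrm M f" if "B \<subseteq> carrier G" for B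
  proof -
    have "nrm M (\<lambda>x. \<Sum>k\<in>B. f (\<phi> k x)) \<le> (\<Sum>k\<in>B. nrm M (\<lambda>x. f (\<phi> k x)))"
      by (intro nrm_sum_le square_integrable_action f) (use that in auto)
    also have "\<dots> = (\<Sum>k\<in>B. nrm M f)"
      by (intro sum.cong refl nrm_action f) (use that in auto)
    finally show ?thesis by simp
  qed
  have sub1: "(h <# A) - A \<subseteq> carrier G" and sub2: "A - (h <# A) \<subseteq> carrier G" using sub A by auto
  have "nrm M (\<lambda>x. (\<Sum>k\<in>(h <# A) - A. f (\<phi> k x)) - (\<Sum>k\<in>A - (h <# A). f (\<phi> k x)))
      \<le> nrm M (\<lambda>x. \<Sum>k\<in>(h <# A) - A. f (\<phi> k x)) + nrm M (\<lambda>x. \<Sum>k\<in>A - (h <# A). f (\<phi> k x))"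
    using nrm_diff_triangle[OF s[OF sub1] square_integrable_zero s[OF sub2]]
    unfolding nrm_diff_commute[of M "\<lambda>x. 0" "\<lambda>x. \<Sum>k\<in>A - (h <# A). f (\<phi> k x)"] by simp
  also have "\<dots> \<le> real (card ((h <# A) - A)) * nrm M f + real (card (A - (h <# A))) * nrm M f"
    using n[OF sub1] n[OF sub2] by linarith
  also have "\<dots> = real (card (sym_diff (h <# A) A)) * nrm M f"
    by (subst card_Un_disjoint) (use fin A in \<open>auto simp: algebra_simps\<close>)
  finally have "nrm M (\<lambda>x. (\<Sum>k\<in>(h <# A) - A. f (\<phi> k x)) - (\<Sum>k\<in>A - (h <# A). f (\<phi> k x)))
     \<le> real (card (sym_diff (h <# A) A)) * nrm M f" .
  from mult_left_mono[OF this, of "1 / real (card A)"] show ?thesis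
    unfolding eq nrm_scaleR by simp
qed

text \<open>The space \<open>D\<close> of functions with vanishing averages contains all coboundaries, and a
  function orthogonal to all coboundaries is invariant.\<close>

proposition mean_ergodic:
  fixes w :: "'x \<Rightarrow> 'b::euclidean_space"
  assumes F: "folner_sequence G F" and w: "w \<in> square_integrable M"
  obtains r where "r \<in> square_integrable M"
    "\<And>g. g \<in> carrier G \<Longrightarrow> AE x in M. r (\<phi> g x) = r x"
    "(\<lambda>n. nrm M (\<lambda>x. avg (F n) w x - r x)) \<longlonglongrightarrow> 0"
proof -
  have Ffin: "finite (F n)" and Fne: "F n \<noteq> {}" and Fsub: "F n \<subseteq> carrier G" for n
    using F by (auto simp: folner_sequence_def)
  have Flim: "(\<lambda>n. real (card (sym_diff (h <# F n) (F n))) / real (card (F n))) \<longlonglongrightarrow> 0"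
    if "h \<in> carrier G" for h
    using F that by (auto simp: folner_sequence_def)
  define D :: "('x \<Rightarrow> 'b) set" where "D = {d \<in> square_integrable M. (\<lambda>n. nrm M (avg (F n) d)) \<longlonglongrightarrow> 0}"
  have Dadd: "(\<lambda>x. u x + v x) \<in> D" if "u \<in> D" "v \<in> D" for u v :: "'x \<Rightarrow> 'b"
  proof -
    have "(\<lambda>n. nrm M (avg (F n) (\<lambda>x. u x + v x))) \<longlonglongrightarrow> 0"
    proof (rule tendsto_sandwich[OF _ _ tendsto_const])
      show "(\<lambda>n. nrm M (avg (F n) u) + nrm M (avg (F n) v)) \<longlonglongrightarrow> 0"
        using that tendsto_add[of "\<lambda>n. nrm M (avg (F n) u)" 0 sequentially "\<lambda>n. nrm M (avg (F n) v)" 0]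
        by (simp add: D_def)
      show "\<forall>\<^sub>F n in sequentially. nrm M (avg (F n) (\<lambda>x. u x + v x)) \<le> nrm M (avg (F n) u) + nrm M (avg (F n) v)"
        using that by (auto simp: D_def avg_add[abs_def] intro!: always_eventually nrm_triangle square_integrable_avg Fsub)
    qed auto
    with that show ?thesis by (auto simp: D_def intro: square_integrable_add)
  qed
  have Dscale: "(\<lambda>x. c *\<^sub>R u x) \<in> D" if "u \<in> D" for c and u :: "'x \<Rightarrow> 'b"
    using that tendsto_mult_right[of "\<lambda>n. nrm M (avg (F n) u)" 0 sequentially "\<bar>c\<bar>"]
    by (auto simp: D_def avg_scaleR[abs_def] nrm_scaleR mult.commute intro: square_integrable_scaleR)
  have D0: "(\<lambda>x. 0) \<in> D" by (simp add: D_def avg_def[abs_def])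
  have DL: "D \<subseteq> square_integrable M" by (auto simp: D_def)
  obtain r where r: "r \<in> square_integrable M" and orth: "\<And>d. d \<in> D \<Longrightarrow> ip M r d = 0"
    and approx: "\<And>e. e > 0 \<Longrightarrow> \<exists>d\<in>D. nrm M (\<lambda>x. w x - d x - r x) < e"
    using orthogonal_residual[OF DL D0 Dadd Dscale w] by blast
  have inv: "AE x in M. r (\<phi> g x) = r x" if g: "g \<in> carrier G" for g
  proof -
    have rg: "(\<lambda>x. r (\<phi> g x)) \<in> square_integrable M" by (rule square_integrable_action[OF g r])
    have "(\<lambda>n. nrm M (avg (F n) (\<lambda>x. r (\<phi> g x) - r x))) \<longlonglongrightarrow> 0"
    proof (rule tendsto_sandwich[OF _ _ tendsto_const])
      show "(\<lambda>n. real (card (sym_diff (g <# F n) (F n))) / real (card (F n)) * nrm M r) \<longlonglongrightarrow> 0"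
        using tendsto_mult_right[OF Flim[OF g], of "nrm M r"] by simp
      show "\<forall>\<^sub>F n in sequentially. nrm M (avg (F n) (\<lambda>x. r (\<phi> g x) - r x))
          \<le> real (card (sym_diff (g <# F n) (F n))) / real (card (F n)) * nrm M r"
        using nrm_avg_coboundary_le[OF Ffin Fsub g r] by (simp add: avg_diff[abs_def])
    qed auto
    then have "(\<lambda>x. r (\<phi> g x) - r x) \<in> D"
      using rg r by (simp add: D_def square_integrable_diff)
    \<comment> \<open>Since \<open>r\<close> and its translate have the same norm, this equality
      makes the squared norm of their difference vanish.\<close>
    from orth[OF this] have "ip M r (\<lambda>x. r (\<phi> g x)) = ip M r r"
      using rg r by (simp add: ip_diff_right)
    then have "(nrm M (\<lambda>x. r (\<phi> g x) - r x))\<^sup>2 = 0"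
      using rg r ip_action[OF g r r]
      by (simp add: nrm_power2 ip_diff_left ip_diff_right square_integrable_diff ip_commute[of M "\<lambda>x. r (\<phi> g x)" r])
    then have "AE x in M. r (\<phi> g x) - r x = 0"
      using nrm_eq_0_AE[OF square_integrable_diff[OF rg r]] by simp
    then show ?thesis by simp
  qed
  \<comment> \<open>One null set for all elements is needed for the averages over \<open>F n\<close>
    to fix \<open>r\<close>.\<close>
  have "AE x in M. \<forall>g\<in>carrier G. r (\<phi> g x) = r x"
    by (rule AE_carrier) (rule inv)
  then have avg_r: "AE x in M. avg (F n) r x = r x" for n
  proof eventually_elim
    case (elim x)
    then have "(\<Sum>g\<in>F n. r (\<phi> g x)) = (\<Sum>g\<in>F n. r x)"
      using Fsub[of n] by (intro sum.cong refl) auto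
    then show ?case using Ffin[of n] Fne[of n] by (simp add: avg_def sum_constant_scaleR)
  qed
  have "(\<lambda>n. nrm M (\<lambda>x. avg (F n) w x - r x)) \<longlonglongrightarrow> 0"
  proof (rule LIMSEQ_I)
    fix e :: real assume e: "e > 0"
    obtain d where d: "d \<in> D" "nrm M (\<lambda>x. w x - d x - r x) < e / 2" using approx[of "e/2"] e by auto
    have dL: "d \<in> square_integrable M" using d by (simp add: D_def)
    have "(\<lambda>n. nrm M (avg (F n) d)) \<longlonglongrightarrow> 0" using d by (simp add: D_def)
    then have "\<forall>\<^sub>F n in sequentially. nrm M (avg (F n) d) < e / 2"
      using order_tendstoD(2) e by (metis half_gt_zero)
    then obtain N where N: "\<And>n. n \<ge> N \<Longrightarrow> nrm M (avg (F n) d) < e / 2"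
      by (auto simp: eventually_sequentially)
    have "nrm M (\<lambda>x. avg (F n) w x - r x) < e" if "n \<ge> N" for n
    proof -
      have s: "(\<lambda>x. w x - d x - r x) \<in> square_integrable M"
        by (intro square_integrable_diff w dL r)
      have "nrm M (\<lambda>x. avg (F n) w x - r x) = nrm M (\<lambda>x. avg (F n) (\<lambda>x. w x - d x - r x) x + avg (F n) d x)"
        using avg_r[of n]
        by (intro nrm_AE_cong square_integrable_add square_integrable_diff square_integrable_avg Fsub w r s dL)
           (auto simp: avg_diff elim: eventually_mono)
      also have "\<dots> \<le> nrm M (avg (F n) (\<lambda>x. w x - d x - r x)) + nrm M (avg (F n) d)"
        by (intro nrm_triangle square_integrable_avg Fsub s dL)
      also have "nrm M (avg (F n) (\<lambda>x. w x - d x - r x)) \<le> nrm M (\<lambda>x. w x - d x - r x)"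
        by (intro nrm_avg_le Ffin Fsub s)
      finally show ?thesis using d(2) N[OF that] by linarith
    qed
    then show "\<exists>N. \<forall>n\<ge>N. norm (nrm M (\<lambda>x. avg (F n) w x - r x) - 0) < e" by auto
  qed
  with r inv show thesis by (rule that)
qed

section \<open>The diagonal action and limits of averaged kernels\<close>

sublocale PP: pair_prob_space M M ..

lemma pair_action: "measure_preserving_action G (M \<Otimes>\<^sub>M M) (\<lambda>g (x, y). (\<phi> g x, \<phi> g y))"
proof
  show "countable (carrier G)" by (rule countable_carrier)
  show "space (M \<Otimes>\<^sub>M M) = UNIV" by (simp add: space_pair_measure space_UNIV)
next
  fix g assume g: "g \<in> carrier G"
  note [measurable] = action_measurable[OF g]
  show "(\<lambda>(x, y). (\<phi> g x, \<phi> g y)) \<in> (M \<Otimes>\<^sub>M M) \<rightarrow>\<^sub>M (M \<Otimes>\<^sub>M M)" by measurable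
  have "sigma_finite_measure (distr M M (\<phi> g))"
    by (simp add: action_distr[OF g] sigma_finite_measure_axioms)
  from pair_measure_distr[OF action_measurable[OF g] action_measurable[OF g] this]
  show "distr (M \<Otimes>\<^sub>M M) (M \<Otimes>\<^sub>M M) (\<lambda>(x, y). (\<phi> g x, \<phi> g y)) = M \<Otimes>\<^sub>M M"
    by (simp add: action_distr[OF g])
next
  fix g h and p :: "'x \<times> 'x" assume "g \<in> carrier G" "h \<in> carrier G"
  then show "(case p of (x, y) \<Rightarrow> (\<phi> (g \<otimes> h) x, \<phi> (g \<otimes> h) y))
      = (case case p of (x, y) \<Rightarrow> (\<phi> h x, \<phi> h y) of (x, y) \<Rightarrow> (\<phi> g x, \<phi> g y))"
    by (cases p) (simp add: action_mult)
qed

text \<open>The mean ergodic limit has its properties only almost everywhere. Clamping it to the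
  interval from 0 to \<open>B\<close> and averaging it with its transpose makes bounds and symmetry
  hold at every point. Neither operation increases the L1 distance to the averages, which are
  themselves symmetric with values in that interval.\<close>

proposition invariant_kernel:
  fixes w :: "'x \<Rightarrow> 'x \<Rightarrow> real"
  assumes F: "folner_sequence G F"
    and wm [measurable]: "(\<lambda>(x, y). w x y) \<in> borel_measurable (M \<Otimes>\<^sub>M M)"
    and w0: "\<And>x y. 0 \<le> w x y" and wB: "\<And>x y. w x y \<le> B" and sym: "\<And>x y. w x y = w y x"
  obtains v :: "'x \<Rightarrow> 'x \<Rightarrow> real" where
    "(\<lambda>(x, y). v x y) \<in> borel_measurable (M \<Otimes>\<^sub>M M)"
    "\<And>x y. 0 \<le> v x y" "\<And>x y. v x y \<le> B" "\<And>x y. v x y = v y x"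
    "\<And>g. g \<in> carrier G \<Longrightarrow> AE (x, y) in M \<Otimes>\<^sub>M M. v (\<phi> g x) (\<phi> g y) = v x y"
    "(\<lambda>n. \<integral>(x, y). \<bar>averaged \<phi> w (F n) x y - v x y\<bar> \<partial>(M \<Otimes>\<^sub>M M)) \<longlonglongrightarrow> 0"
proof -
  interpret Q: measure_preserving_action G "M \<Otimes>\<^sub>M M" "\<lambda>g (x, y). (\<phi> g x, \<phi> g y)"
    by (rule pair_action)
  have Ffin: "finite (F n)" and Fne: "F n \<noteq> {}" and Fsub: "F n \<subseteq> carrier G" for n
    using F by (auto simp: folner_sequence_def)
  have B0: "0 \<le> B" using w0 wB order_trans by blast
  have wL: "(\<lambda>(x, y). w x y) \<in> square_integrable (M \<Otimes>\<^sub>M M)"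
    by (rule PP.square_integrable_bounded[where B=B]) (use w0 wB in auto)
  obtain r where r: "r \<in> square_integrable (M \<Otimes>\<^sub>M M)"
    and rinv: "\<And>g. g \<in> carrier G \<Longrightarrow> AE p in M \<Otimes>\<^sub>M M. r (case p of (x, y) \<Rightarrow> (\<phi> g x, \<phi> g y)) = r p"
    and rlim: "(\<lambda>n. nrm (M \<Otimes>\<^sub>M M) (\<lambda>p. Q.avg (F n) (\<lambda>(x, y). w x y) p - r p)) \<longlonglongrightarrow> 0"
    using Q.mean_ergodic[OF F wL] by blast
  have [measurable]: "r \<in> borel_measurable (M \<Otimes>\<^sub>M M)" using r by auto
  have avg_eq: "Q.avg (F n) (\<lambda>(x, y). w x y) (x, y) = averaged \<phi> w (F n) x y" for n x y
    by (simp add: Q.avg_def averaged_def)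
  have avg_le: "averaged \<phi> w (F n) x y \<le> B" for n x y
  proof -
    have "(\<Sum>g\<in>F n. w (\<phi> g x) (\<phi> g y)) \<le> real (card (F n)) * B"
      using sum_bounded_above[of "F n" "\<lambda>g. w (\<phi> g x) (\<phi> g y)" B] wB by simp
    then show ?thesis
      using Ffin[of n] Fne[of n] by (simp add: averaged_def divide_le_eq mult.commute card_gt_0_iff)
  qed
  have avg_ge: "0 \<le> averaged \<phi> w (F n) x y" for n x y
    by (simp add: averaged_def sum_nonneg w0)
  have avg_sym: "averaged \<phi> w (F n) x y = averaged \<phi> w (F n) y x" for n x y
    by (simp add: averaged_def sym)
  define c :: "real \<Rightarrow> real" where "c t = max 0 (min B t)" for t
  have c: "\<bar>a - c t\<bar> \<le> \<bar>a - t\<bar>" if "0 \<le> a" "a \<le> B" for a t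
    using that by (auto simp: c_def max_def min_def)
  have [measurable]: "c \<in> borel_measurable borel" unfolding c_def by measurable
  define v where "v x y = (c (r (x, y)) + c (r (y, x))) / 2" for x y
  have rsw: "(\<lambda>(x, y). r (y, x)) \<in> borel_measurable (M \<Otimes>\<^sub>M M)"
    using measurable_compose[OF measurable_pair_swap', of r M M borel] by (simp add: case_prod_beta')
  have [measurable]: "(\<lambda>(x, y). v x y) \<in> borel_measurable (M \<Otimes>\<^sub>M M)"
    unfolding v_def using rsw by measurable
  have avm [measurable]: "(\<lambda>(x, y). averaged \<phi> w (F n) x y) \<in> borel_measurable (M \<Otimes>\<^sub>M M)" for n
  proof -
    have "Q.avg (F n) (\<lambda>(x, y). w x y) = (\<lambda>(x, y). averaged \<phi> w (F n) x y)"
      by (auto simp: avg_eq)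
    with Q.avg_measurable[OF Fsub[of n] wm] show ?thesis by simp
  qed
  \<comment> \<open>Swapping the coordinates preserves the product measure, so the invariance of
    \<open>r\<close> also holds with its arguments transposed.\<close>
  have rinv': "AE p in M \<Otimes>\<^sub>M M. r (case p of (x, y) \<Rightarrow> (\<phi> g y, \<phi> g x)) = r (case p of (x, y) \<Rightarrow> (y, x))"
    if g: "g \<in> carrier G" for g
  proof -
    have "AE p in distr (M \<Otimes>\<^sub>M M) (M \<Otimes>\<^sub>M M) (\<lambda>(x, y). (y, x)).
        r (case p of (x, y) \<Rightarrow> (\<phi> g x, \<phi> g y)) = r p"
      using rinv[OF g] unfolding PP.distr_pair_swap[symmetric] .
    from AE_distrD[OF measurable_pair_swap' this] show ?thesis
      by (simp add: case_prod_beta')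
  qed
  have inv: "AE (x, y) in M \<Otimes>\<^sub>M M. v (\<phi> g x) (\<phi> g y) = v x y" if g: "g \<in> carrier G" for g
    using rinv[OF g] rinv'[OF g]
    by eventually_elim (auto simp: v_def)
  have int_r: "integrable (M \<Otimes>\<^sub>M M) r"
    using PP.square_integrable_imp_integrable_norm[OF r] .
  have int_av: "integrable (M \<Otimes>\<^sub>M M) (\<lambda>(x, y). averaged \<phi> w (F n) x y)" for n
    by (rule PP.integrable_const_bound[where B=B]) (use avg_le avg_ge in auto)
  define I where "I n = (\<integral>p. \<bar>(case p of (x, y) \<Rightarrow> averaged \<phi> w (F n) x y) - r p\<bar> \<partial>(M \<Otimes>\<^sub>M M))" for n
  have Ilim: "I \<longlonglongrightarrow> 0"
  proof (rule tendsto_sandwich[OF _ _ tendsto_const rlim])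
    show "\<forall>\<^sub>F n in sequentially. I n \<le> nrm (M \<Otimes>\<^sub>M M) (\<lambda>p. Q.avg (F n) (\<lambda>(x, y). w x y) p - r p)"
    proof (intro always_eventually allI)
      fix n
      have "(\<lambda>p. Q.avg (F n) (\<lambda>(x, y). w x y) p - r p) \<in> square_integrable (M \<Otimes>\<^sub>M M)"
        by (intro square_integrable_diff Q.square_integrable_avg Fsub wL r)
      from PP.integral_norm_le_nrm[OF this]
      show "I n \<le> nrm (M \<Otimes>\<^sub>M M) (\<lambda>p. Q.avg (F n) (\<lambda>(x, y). w x y) p - r p)"
        by (simp add: I_def avg_eq case_prod_beta' flip: avg_eq)
    qed
  qed (auto simp: I_def)
  have Iv: "(\<integral>(x, y). \<bar>averaged \<phi> w (F n) x y - v x y\<bar> \<partial>(M \<Otimes>\<^sub>M M)) \<le> I n" for n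
  proof -
    let ?d = "\<lambda>(x, y). \<bar>averaged \<phi> w (F n) x y - r (x, y)\<bar>"
    have i1: "integrable (M \<Otimes>\<^sub>M M) ?d"
      using integrable_abs[OF Bochner_Integration.integrable_diff[OF int_av[of n] int_r]] by (simp add: case_prod_beta')
    have i2: "integrable (M \<Otimes>\<^sub>M M) (\<lambda>(x, y). ?d (y, x))"
      using PP.integrable_product_swap[OF i1] by simp
    have "(\<integral>(x, y). \<bar>averaged \<phi> w (F n) x y - v x y\<bar> \<partial>(M \<Otimes>\<^sub>M M))
        \<le> (\<integral>p. (?d p + (case p of (x, y) \<Rightarrow> ?d (y, x))) / 2 \<partial>(M \<Otimes>\<^sub>M M))"
    proof (rule integral_mono_AE)
      have "integrable (M \<Otimes>\<^sub>M M) (\<lambda>(x, y). v x y)"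
        by (rule PP.integrable_const_bound[where B=B]) (use B0 in \<open>auto simp: v_def c_def\<close>)
      from integrable_abs[OF Bochner_Integration.integrable_diff[OF int_av[of n] this]]
      show "integrable (M \<Otimes>\<^sub>M M) (\<lambda>(x, y). \<bar>averaged \<phi> w (F n) x y - v x y\<bar>)"
        by (simp add: case_prod_beta')
      show "integrable (M \<Otimes>\<^sub>M M) (\<lambda>p. (?d p + (case p of (x, y) \<Rightarrow> ?d (y, x))) / 2)"
        using i1 i2 by auto
      show "AE p in M \<Otimes>\<^sub>M M. (case p of (x, y) \<Rightarrow> \<bar>averaged \<phi> w (F n) x y - v x y\<bar>)
          \<le> (?d p + (case p of (x, y) \<Rightarrow> ?d (y, x))) / 2"
      proof (intro AE_I2)
        fix p :: "'x \<times> 'x"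
        obtain x y where p: "p = (x, y)" by force
        have mean: "\<bar>a - (p + q) / 2\<bar> \<le> (s + t) / 2" if "\<bar>a - p\<bar> \<le> s" "\<bar>a - q\<bar> \<le> t"
          for a p q s t :: real
          using that by (simp add: abs_le_iff field_simps)
        show "(case p of (x, y) \<Rightarrow> \<bar>averaged \<phi> w (F n) x y - v x y\<bar>)
          \<le> (?d p + (case p of (x, y) \<Rightarrow> ?d (y, x))) / 2"
          using mean[OF c[OF avg_ge avg_le, of n x y "r (x, y)"] c[OF avg_ge avg_le, of n x y "r (y, x)"]]
          by (simp add: p v_def avg_sym[of n y x])
      qed
    qed
    also have "\<dots> = I n"
      using i1 i2 PP.integral_product_swap[of ?d] borel_measurable_integrable[OF i1]
      by (simp add: I_def case_prod_beta' add_divide_distrib)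
    finally show ?thesis .
  qed
  have "(\<lambda>n. \<integral>(x, y). \<bar>averaged \<phi> w (F n) x y - v x y\<bar> \<partial>(M \<Otimes>\<^sub>M M)) \<longlonglongrightarrow> 0"
    by (rule tendsto_sandwich[OF _ _ tendsto_const Ilim])
       (use Iv in \<open>auto intro!: always_eventually Bochner_Integration.integral_nonneg\<close>)
  then show thesis
    by (rule that[rotated -1]) (use inv B0 in \<open>auto simp: v_def c_def\<close>)
qed

end

section \<open>Orthonormal families\<close>

definition orthonormal :: "'a measure \<Rightarrow> ('a \<Rightarrow> 'b::euclidean_space) set \<Rightarrow> bool" where
  "orthonormal M E \<longleftrightarrow> finite E \<and> E \<subseteq> square_integrable M \<and>
     (\<forall>e\<in>E. \<forall>e'\<in>E. ip M e e' = (if e = e' then 1 else 0))"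

text \<open>For orthonormal \<open>E\<close> this is membership in the real span up to a null set,
  written with the only coefficients possible.\<close>

definition spanned_AE :: "'a measure \<Rightarrow> ('a \<Rightarrow> 'b::euclidean_space) set \<Rightarrow> ('a \<Rightarrow> 'b) \<Rightarrow> bool" where
  "spanned_AE M E f \<longleftrightarrow> (AE x in M. f x = (\<Sum>e\<in>E. ip M f e *\<^sub>R e x))"

lemma bessel:
  assumes E: "orthonormal M E" and f: "f \<in> square_integrable M"
  shows "(nrm M (\<lambda>x. f x - (\<Sum>e\<in>E. ip M f e *\<^sub>R e x)))\<^sup>2 = (nrm M f)\<^sup>2 - (\<Sum>e\<in>E. (ip M f e)\<^sup>2)"
    and "(\<Sum>e\<in>E. (ip M f e)\<^sup>2) \<le> (nrm M f)\<^sup>2"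
    and "e \<in> E \<Longrightarrow> ip M (\<lambda>x. f x - (\<Sum>e\<in>E. ip M f e *\<^sub>R e x)) e = 0"
proof -
  have fin: "finite E" and EL: "\<And>e. e \<in> E \<Longrightarrow> e \<in> square_integrable M"
    and on: "\<And>e e'. e \<in> E \<Longrightarrow> e' \<in> E \<Longrightarrow> ip M e e' = (if e = e' then 1 else 0)"
    using E by (auto simp: orthonormal_def)
  define p where "p = (\<lambda>x. \<Sum>e\<in>E. ip M f e *\<^sub>R e x)"
  have pL: "p \<in> square_integrable M"
    unfolding p_def by (intro square_integrable_sum square_integrable_scaleR EL)
  have pe: "ip M p e = ip M f e" if "e \<in> E" for e
  proof -
    have "ip M p e = (\<Sum>e'\<in>E. ip M (\<lambda>x. ip M f e' *\<^sub>R e' x) e)"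
      unfolding p_def by (rule ip_sum_left) (use that EL in \<open>auto intro: square_integrable_scaleR\<close>)
    also have "\<dots> = (\<Sum>e'\<in>E. if e' = e then ip M f e else 0)"
      by (intro sum.cong refl) (use that on in \<open>auto simp: ip_scaleR_left\<close>)
    also have "\<dots> = ip M f e" using fin that by simp
    finally show ?thesis .
  qed
  have pg: "ip M p g = (\<Sum>e\<in>E. ip M f e * ip M e g)" if "g \<in> square_integrable M" for g
    unfolding p_def using that EL
    by (subst ip_sum_left) (auto intro: square_integrable_scaleR simp: ip_scaleR_left)
  have pf: "ip M p f = (\<Sum>e\<in>E. (ip M f e)\<^sup>2)"
    unfolding pg[OF f] by (intro sum.cong refl) (simp add: power2_eq_square ip_commute)
  have pp: "ip M p p = (\<Sum>e\<in>E. (ip M f e)\<^sup>2)"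
    unfolding pg[OF pL] using pe by (intro sum.cong refl) (simp add: power2_eq_square ip_commute)
  have res: "(\<lambda>x. f x - (\<Sum>e\<in>E. ip M f e *\<^sub>R e x)) = (\<lambda>x. f x - p x)"
    by (simp add: p_def)
  show 1: "(nrm M (\<lambda>x. f x - (\<Sum>e\<in>E. ip M f e *\<^sub>R e x)))\<^sup>2 = (nrm M f)\<^sup>2 - (\<Sum>e\<in>E. (ip M f e)\<^sup>2)"
    unfolding res nrm_power2 using f pL pf pp
    by (simp add: ip_diff_left ip_diff_right square_integrable_diff ip_commute[of M f p])
  show "(\<Sum>e\<in>E. (ip M f e)\<^sup>2) \<le> (nrm M f)\<^sup>2"
    using 1 zero_le_power2[of "nrm M (\<lambda>x. f x - (\<Sum>e\<in>E. ip M f e *\<^sub>R e x))"] by linarith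
  show "ip M (\<lambda>x. f x - (\<Sum>e\<in>E. ip M f e *\<^sub>R e x)) e = 0" if "e \<in> E"
    unfolding res using f pL that EL pe by (simp add: ip_diff_left)
qed

text \<open>\<open>f\<close> lies in the span of \<open>E\<close>, so it is orthogonal to the
  members of \<open>E'\<close> outside \<open>E\<close>, and their coefficients vanish.\<close>

lemma spanned_AE_mono:
  assumes E': "orthonormal M E'" and sub: "E \<subseteq> E'" and f: "f \<in> square_integrable M" and s: "spanned_AE M E f"
  shows "spanned_AE M E' f"
proof -
  have E: "orthonormal M E" using E' sub finite_subset[OF sub] by (auto simp: orthonormal_def subset_iff)
  have fin: "finite E'" using E' by (simp add: orthonormal_def)
  have EL: "\<And>e. e \<in> E \<Longrightarrow> e \<in> square_integrable M" using E by (auto simp: orthonormal_def)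
  have "ip M f e' = 0" if e': "e' \<in> E' - E" for e'
  proof -
    have e'L: "e' \<in> square_integrable M" using E' e' by (auto simp: orthonormal_def)
    have "ip M f e' = ip M (\<lambda>x. \<Sum>e\<in>E. ip M f e *\<^sub>R e x) e'"
      using s unfolding spanned_AE_def
      by (intro ip_AE_cong f e'L square_integrable_sum square_integrable_scaleR EL) auto
    also have "\<dots> = (\<Sum>e\<in>E. ip M f e * ip M e e')"
      using EL e'L by (subst ip_sum_left) (auto intro: square_integrable_scaleR simp: ip_scaleR_left)
    also have "\<dots> = 0"
      using E' e' sub by (intro sum.neutral) (auto simp: orthonormal_def subset_iff)
    finally show ?thesis .
  qed
  then have "(\<Sum>e\<in>E'. ip M f e *\<^sub>R e x) = (\<Sum>e\<in>E. ip M f e *\<^sub>R e x)" for x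
    by (intro sum.mono_neutral_right fin sub) auto
  then show ?thesis using s by (simp add: spanned_AE_def)
qed

definition real_subspace :: "'a measure \<Rightarrow> ('a \<Rightarrow> 'b::euclidean_space) set \<Rightarrow> bool" where
  "real_subspace M V \<longleftrightarrow> V \<subseteq> square_integrable M \<and> (\<lambda>x. 0) \<in> V \<and>
     (\<forall>f\<in>V. \<forall>g\<in>V. (\<lambda>x. f x + g x) \<in> V) \<and> (\<forall>c. \<forall>f\<in>V. (\<lambda>x. c *\<^sub>R f x) \<in> V)"

lemma real_subspace_sum:
  assumes "real_subspace M V" "\<And>i. i \<in> I \<Longrightarrow> f i \<in> V"
  shows "(\<lambda>x. \<Sum>i\<in>I. c i *\<^sub>R f i x) \<in> V"
  using assms(2)
  by (induction I rule: infinite_finite_induct) (use assms(1) in \<open>auto simp: real_subspace_def\<close>)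

lemma real_subspace_diff:
  assumes "real_subspace M V" "f \<in> V" "g \<in> V"
  shows "(\<lambda>x. f x - g x) \<in> V"
proof -
  have "(\<lambda>x. f x + (-1) *\<^sub>R g x) \<in> V"
    using assms unfolding real_subspace_def by fast
  then show ?thesis by simp
qed

text \<open>One Gram-Schmidt step. The cardinality clause is what makes an orthonormal family of
  maximal size span all of \<open>V\<close>.\<close>

lemma orthonormal_extend:
  assumes V: "real_subspace M V" and E: "orthonormal M E" "E \<subseteq> V" and f: "f \<in> V"
  obtains E' where "orthonormal M E'" "E \<subseteq> E'" "E' \<subseteq> V" "spanned_AE M E' f"
    "\<not> spanned_AE M E f \<Longrightarrow> card E' = Suc (card E)"
proof (cases "spanned_AE M E f")
  case True
  then show thesis using that[of E] E by blast
next
  case False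
  have fL: "f \<in> square_integrable M" using V f by (auto simp: real_subspace_def)
  have fin: "finite E" using E by (simp add: orthonormal_def)
  define d where "d = (\<lambda>x. f x - (\<Sum>e\<in>E. ip M f e *\<^sub>R e x))"
  have dV: "d \<in> V"
    unfolding d_def using E by (intro real_subspace_diff[OF V] real_subspace_sum[OF V] f) auto
  have dL: "d \<in> square_integrable M" using V dV by (auto simp: real_subspace_def)
  have de: "ip M d e = 0" if "e \<in> E" for e
    unfolding d_def by (rule bessel(3)[OF E(1) fL that])
  have "nrm M d \<noteq> 0"
  proof
    assume "nrm M d = 0"
    from nrm_eq_0_AE[OF dL this] have "spanned_AE M E f"
      by (simp add: spanned_AE_def d_def)
    with False show False by contradiction
  qed
  then have pos: "nrm M d > 0" using nrm_nonneg[of M d] by linarith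
  define n where "n = (\<lambda>x. (1 / nrm M d) *\<^sub>R d x)"
  have nV: "n \<in> V" unfolding n_def using V dV by (auto simp: real_subspace_def)
  have nL: "n \<in> square_integrable M" using V nV by (auto simp: real_subspace_def)
  have nn: "ip M n n = 1"
    using pos by (simp add: n_def ip_scaleR_left ip_scaleR_right power2_eq_square flip: nrm_power2)
  have ne: "ip M n e = 0" if "e \<in> E" for e
    using de[OF that] by (simp add: n_def ip_scaleR_left)
  have ne': "ip M e n = 0" if "e \<in> E" for e
    using ne[OF that] by (simp add: ip_commute)
  have nE: "n \<notin> E" using ne nn by fastforce
  have on: "orthonormal M (insert n E)"
    using E nL nn ne ne' by (auto simp: orthonormal_def)
  have fn: "ip M f n = nrm M d"
  proof -
    have "ip M d n = ip M f n - ip M (\<lambda>x. \<Sum>e\<in>E. ip M f e *\<^sub>R e x) n"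
      unfolding d_def using E(1)
      by (intro ip_diff_left fL nL square_integrable_sum square_integrable_scaleR) (auto simp: orthonormal_def)
    also have "ip M (\<lambda>x. \<Sum>e\<in>E. ip M f e *\<^sub>R e x) n = (\<Sum>e\<in>E. ip M f e * ip M e n)"
      using E(1) nL by (subst ip_sum_left) (auto simp: ip_scaleR_left orthonormal_def intro: square_integrable_scaleR)
    also have "\<dots> = 0" using ne' by (intro sum.neutral) simp
    finally have "ip M f n = ip M d n" by simp
    also have "\<dots> = nrm M d"
      using pos by (simp add: n_def ip_scaleR_right power2_eq_square flip: nrm_power2)
    finally show ?thesis .
  qed
  have "spanned_AE M (insert n E) f"
    using fin nE pos by (simp add: spanned_AE_def fn) (simp add: n_def d_def)
  then show thesis
    using that[of "insert n E"] on E nV fin nE by auto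
qed

lemma gram_schmidt:
  assumes V: "real_subspace M V" and B: "finite B" "B \<subseteq> V"
  shows "\<exists>E. orthonormal M E \<and> E \<subseteq> V \<and> (\<forall>b\<in>B. spanned_AE M E b)"
  using B
proof (induction B rule: finite_induct)
  case empty
  show ?case by (rule exI[of _ "{}"]) (simp add: orthonormal_def)
next
  case (insert b B)
  then obtain E where E: "orthonormal M E" "E \<subseteq> V" "\<forall>b\<in>B. spanned_AE M E b" by auto
  have "b \<in> V" using insert by auto
  with orthonormal_extend[OF V E(1,2)] obtain E' where
    E': "orthonormal M E'" "E \<subseteq> E'" "E' \<subseteq> V" "spanned_AE M E' b" by metis
  have "spanned_AE M E' b'" if "b' \<in> B" for b'
    using spanned_AE_mono[OF E'(1,2)] E(3) that insert.prems V by (auto simp: real_subspace_def)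
  with E' show ?case by auto
qed

text \<open>A family of largest cardinality cannot be extended. A bound on the cardinalities is the
  form in which eigenspaces are shown to be finite-dimensional.\<close>

lemma orthonormal_basis_exists:
  assumes V: "real_subspace M V"
    and bound: "\<And>E. orthonormal M E \<Longrightarrow> E \<subseteq> V \<Longrightarrow> card E \<le> N"
  shows "\<exists>E. orthonormal M E \<and> E \<subseteq> V \<and> (\<forall>f\<in>V. spanned_AE M E f)"
proof -
  define P where "P n \<longleftrightarrow> (\<exists>E. orthonormal M E \<and> E \<subseteq> V \<and> card E = n)" for n
  have "P 0" unfolding P_def by (rule exI[of _ "{}"]) (simp add: orthonormal_def)
  moreover have bd: "\<forall>n. P n \<longrightarrow> n \<le> N" using bound by (auto simp: P_def)
  ultimately have "P (GREATEST n. P n)" using GreatestI_nat[of P 0 N] by blast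
  then obtain E where E: "orthonormal M E" "E \<subseteq> V" "card E = (GREATEST n. P n)" by (auto simp: P_def)
  have "spanned_AE M E f" if f: "f \<in> V" for f
  proof (rule ccontr)
    assume n: "\<not> spanned_AE M E f"
    obtain E' where "orthonormal M E'" "E' \<subseteq> V" "card E' = Suc (card E)"
      using orthonormal_extend[OF V E(1,2) f] n by metis
    then have "P (Suc (card E))" by (auto simp: P_def)
    then have "Suc (card E) \<le> (GREATEST n. P n)"
      using bd by (intro Greatest_le_nat[where b=N]) auto
    then show False using E(3) by simp
  qed
  with E show ?thesis by blast
qed

text \<open>The space \<open>D\<close> of functions against which the subsequence converges is closed, contains
  every \<open>u m\<close> and everything orthogonal to all of them.\<close>

lemma (in prob_space) weakly_convergent_subsequence:
  fixes u :: "nat \<Rightarrow> 'a \<Rightarrow> 'b::euclidean_space"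
  assumes u: "\<And>n. u n \<in> square_integrable M" and u1: "\<And>n. nrm M (u n) \<le> 1"
  obtains r :: "nat \<Rightarrow> nat" where "strict_mono r"
    "\<And>f. f \<in> square_integrable M \<Longrightarrow> convergent (\<lambda>n. ip M (u (r n)) f)"
proof -
  have le1: "norm (ip M (u n) (u m)) \<le> 1" for n m
    using ip_cauchy_schwarz[OF u u, of n m] mult_mono[OF u1[of n] u1[of m]] by simp
  \<comment> \<open>Diagonal extraction: the numbers \<open>ip M (u n) (u m)\<close> are bounded, so
    one subsequence makes them converge for every \<open>m\<close>.\<close>
  obtain r :: "nat \<Rightarrow> nat" where r: "strict_mono r"
    "\<And>m. \<exists>l. (\<lambda>n. ip M (u (r n)) (u m)) \<longlonglongrightarrow> l"
  proof (rule function_convergent_subsequence[of UNIV "\<lambda>n m. ip M (u n) (u m)" 1])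
    show "norm (ip M (u n) (u m)) \<le> 1" for n m by (rule le1)
  qed (auto intro: that)
  define D where "D = {d \<in> square_integrable M. convergent (\<lambda>n. ip M (u (r n)) d)}"
  have "\<exists>s\<in>square_integrable M. (\<forall>d\<in>D. ip M s d = 0) \<and> (\<forall>e>0. \<exists>d\<in>D. nrm M (\<lambda>x. f x - d x - s x) < e)"
    if "f \<in> square_integrable M" for f
  proof (rule orthogonal_residual[OF _ _ _ _ that])
    show "D \<subseteq> square_integrable M" "(\<lambda>x. 0) \<in> D" by (auto simp: D_def convergent_const)
    show "(\<lambda>x. a x + b x) \<in> D" if "a \<in> D" "b \<in> D" for a b
      using that u by (auto simp: D_def square_integrable_add ip_add_right intro: convergent_add)
    show "(\<lambda>x. c *\<^sub>R a x) \<in> D" if "a \<in> D" for c a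
      using that by (auto simp: D_def square_integrable_scaleR ip_scaleR_right intro: convergent_mult convergent_const)
  qed
  moreover have uD: "u m \<in> D" for m using u r(2)[of m] by (auto simp: D_def convergent_def)
  ultimately have approx: "\<exists>d\<in>square_integrable M. convergent (\<lambda>n. ip M (u (r n)) d) \<and> nrm M (\<lambda>x. f x - d x) < e"
    if f: "f \<in> square_integrable M" and e: "e > 0" for f and e :: real
  proof -
    obtain s where s: "s \<in> square_integrable M" "\<forall>d\<in>D. ip M s d = 0"
      "\<forall>e>0. \<exists>d\<in>D. nrm M (\<lambda>x. f x - d x - s x) < e"
      using \<open>\<And>f. f \<in> square_integrable M \<Longrightarrow> _ f\<close>[OF f] by blast
    obtain d where d: "d \<in> D" "nrm M (\<lambda>x. f x - d x - s x) < e" using s(3) e by blast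
    have dL: "d \<in> square_integrable M" using d by (simp add: D_def)
    \<comment> \<open>The residual \<open>s\<close> is orthogonal to every \<open>u m\<close>, so
      adding it to \<open>d\<close> does not affect the sequence of inner products.\<close>
    have "ip M (u (r n)) s = 0" for n using s(2) uD ip_commute[of M s] by metis
    then have "convergent (\<lambda>n. ip M (u (r n)) (\<lambda>x. d x + s x))"
      using d(1) dL s(1) u by (simp add: D_def ip_add_right)
    moreover have "(\<lambda>x. f x - (d x + s x)) = (\<lambda>x. f x - d x - s x)" by (auto simp: algebra_simps)
    ultimately show ?thesis using d(2) dL s(1) by (intro bexI[of _ "\<lambda>x. d x + s x"]) (auto intro: square_integrable_add)
  qed
  have "convergent (\<lambda>n. ip M (u (r n)) f)" if f: "f \<in> square_integrable M" for f
  proof -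
    have "Cauchy (\<lambda>n. ip M (u (r n)) f)"
    proof (rule CauchyI)
      fix e :: real assume e: "e > 0"
      obtain d where d: "d \<in> square_integrable M" "convergent (\<lambda>n. ip M (u (r n)) d)" "nrm M (\<lambda>x. f x - d x) < e / 3"
        using approx[OF f, of "e/3"] e by auto
      have "\<exists>N. \<forall>m\<ge>N. \<forall>n\<ge>N. norm (ip M (u (r m)) d - ip M (u (r n)) d) < e / 3"
        using d(2) e by (intro CauchyD) (auto simp: Cauchy_convergent_iff)
      then obtain N where N: "\<And>m n. m \<ge> N \<Longrightarrow> n \<ge> N \<Longrightarrow> norm (ip M (u (r m)) d - ip M (u (r n)) d) < e / 3"
        by blast
      have close: "\<bar>ip M (u k) f - ip M (u k) d\<bar> < e / 3" for k
      proof -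
        have "\<bar>ip M (u k) (\<lambda>x. f x - d x)\<bar> \<le> nrm M (u k) * nrm M (\<lambda>x. f x - d x)"
          by (intro ip_cauchy_schwarz u square_integrable_diff f d)
        also have "\<dots> \<le> 1 * nrm M (\<lambda>x. f x - d x)"
          by (intro mult_right_mono u1) simp
        finally show ?thesis using d u f by (simp add: ip_diff_right)
      qed
      have "norm (ip M (u (r m)) f - ip M (u (r n)) f) < e" if "m \<ge> N" "n \<ge> N" for m n
        using N[OF that] close[of "r m"] close[of "r n"] unfolding real_norm_def by linarith
      then show "\<exists>N. \<forall>m\<ge>N. \<forall>n\<ge>N. norm (ip M (u (r m)) f - ip M (u (r n)) f) < e" by blast
    qed
    then show ?thesis by (simp add: Cauchy_convergent_iff)
  qed
  with r(1) show thesis by (rule that)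
qed

section \<open>Symmetric bounded kernels\<close>

text \<open>Bound and symmetry are required at every point, so that \<open>T u\<close> has a
  definite value everywhere and estimates can be made pointwise.\<close>

locale symmetric_kernel = prob_space M for M :: "'x measure" +
  fixes k :: "'x \<Rightarrow> 'x \<Rightarrow> real" and B :: real
  assumes space_all: "space M = UNIV"
    and kernel_measurable [measurable]: "(\<lambda>(x, y). k x y) \<in> borel_measurable (M \<Otimes>\<^sub>M M)"
    and kernel_bound: "\<bar>k x y\<bar> \<le> B"
    and kernel_sym: "k x y = k y x"
begin

text \<open>The kernel is real while functions may be vector-valued; on complex functions the
  operator is therefore complex linear.\<close>

definition T :: "('x \<Rightarrow> 'b::euclidean_space) \<Rightarrow> 'x \<Rightarrow> 'b" where
  "T u x = (\<integral>y. k x y *\<^sub>R u y \<partial>M)"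

lemma B_nonneg: "0 \<le> B"
  using kernel_bound[of undefined undefined] by linarith

lemma kernel_section_measurable [measurable]: "k x \<in> borel_measurable M"
  using measurable_compose_Pair1[of x M "\<lambda>(x, y). k x y" M borel] kernel_measurable
  by (simp add: space_all)

lemma kernel_times_integrable:
  assumes "u \<in> square_integrable M"
  shows "integrable M (\<lambda>y. k x y *\<^sub>R u y)"
proof -
  have [measurable]: "u \<in> borel_measurable M" using assms by auto
  have "integrable M (\<lambda>y. B * norm (u y))"
    using square_integrable_imp_integrable_norm[OF assms] by auto
  then show ?thesis
    by (rule Bochner_Integration.integrable_bound)
       (use kernel_bound B_nonneg in \<open>auto simp: abs_mult intro!: mult_right_mono\<close>)
qed

lemma T_measurable:
  assumes "u \<in> square_integrable M"
  shows "T u \<in> borel_measurable M"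
proof -
  have [measurable]: "u \<in> borel_measurable M" using assms by auto
  show ?thesis unfolding T_def[abs_def] by (rule borel_measurable_lebesgue_integral) measurable
qed

text \<open>This is stronger than boundedness in norm: an L2 ball has a uniformly bounded image,
  which supplies the dominating function for compactness.\<close>

lemma norm_T_le:
  assumes "u \<in> square_integrable M"
  shows "norm (T u x) \<le> B * nrm M u"
proof -
  have "norm (T u x) \<le> (\<integral>y. norm (k x y *\<^sub>R u y) \<partial>M)"
    unfolding T_def by (rule integral_norm_bound)
  also have "\<dots> \<le> (\<integral>y. B * norm (u y) \<partial>M)"
    by (intro integral_mono integrable_norm kernel_times_integrable assms integrable_mult_right
        square_integrable_imp_integrable_norm) (auto intro!: mult_right_mono kernel_bound)
  also have "\<dots> = B * (\<integral>y. norm (u y) \<partial>M)" by simp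
  also have "\<dots> \<le> B * nrm M u"
    by (intro mult_left_mono integral_norm_le_nrm assms B_nonneg)
  finally show ?thesis .
qed

lemma square_integrable_T: "u \<in> square_integrable M \<Longrightarrow> T u \<in> square_integrable M"
  by (rule square_integrable_bounded[where B="B * nrm M u"]) (auto simp: T_measurable norm_T_le)

lemma nrm_T_le: "u \<in> square_integrable M \<Longrightarrow> nrm M (T u) \<le> B * nrm M u"
  by (rule nrm_bounded_le) (auto simp: T_measurable norm_T_le B_nonneg)

lemma T_add:
  "u \<in> square_integrable M \<Longrightarrow> v \<in> square_integrable M \<Longrightarrow> T (\<lambda>x. u x + v x) x = T u x + T v x"
  by (simp add: T_def scaleR_add_right kernel_times_integrable)

lemma T_diff:
  "u \<in> square_integrable M \<Longrightarrow> v \<in> square_integrable M \<Longrightarrow> T (\<lambda>x. u x - v x) x = T u x - T v x"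
  by (simp add: T_def scaleR_diff_right kernel_times_integrable)

lemma T_scaleR: "T (\<lambda>x. c *\<^sub>R u x) x = c *\<^sub>R T u x"
proof -
  have "T (\<lambda>x. c *\<^sub>R u x) x = (\<integral>y. c *\<^sub>R (k x y *\<^sub>R u y) \<partial>M)"
    by (simp add: T_def mult.commute)
  also have "\<dots> = c *\<^sub>R T u x"
    unfolding T_def by (rule integral_scaleR_right)
  finally show ?thesis .
qed

lemma T_AE_cong:
  assumes "u \<in> square_integrable M" "v \<in> square_integrable M" "AE x in M. u x = v x"
  shows "T u = T v"
proof
  fix x
  have [measurable]: "u \<in> borel_measurable M" "v \<in> borel_measurable M" using assms by auto
  show "T u x = T v x"
    unfolding T_def by (rule integral_cong_AE) (use assms(3) in auto)
qed

text \<open>Coordinates of \<open>T u x\<close> are inner products with a section of the kernel.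
  Thus weak convergence of \<open>u\<close> becomes pointwise convergence of \<open>T u\<close>, and
  Bessel's inequality applies to orthonormal families.\<close>

lemma T_inner:
  assumes "u \<in> square_integrable M"
  shows "T u x \<bullet> b = ip M (\<lambda>y. k x y *\<^sub>R b) u"
proof -
  have "T u x \<bullet> b = (\<integral>y. (k x y *\<^sub>R u y) \<bullet> b \<partial>M)"
    unfolding T_def by (rule integral_inner_left[symmetric]) (use kernel_times_integrable[OF assms] in auto)
  then show ?thesis by (simp add: ip_def inner_commute)
qed

lemma kernel_section_square_integrable: "(\<lambda>y. k x y *\<^sub>R b) \<in> square_integrable M"
  by (rule square_integrable_bounded[where B="B * norm b"])
     (use kernel_bound in \<open>auto intro!: mult_right_mono\<close>)

text \<open>Fubini; absolute integrability follows by integrating out \<open>y\<close> first, which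
  leaves at most a multiple of \<open>norm (v x)\<close>.\<close>

lemma T_self_adjoint:
  assumes u: "u \<in> square_integrable M" and v: "v \<in> square_integrable M"
  shows "ip M (T u) v = ip M u (T v)"
proof -
  interpret PP: pair_prob_space M M ..
  have [measurable]: "u \<in> borel_measurable M" "v \<in> borel_measurable M" using u v by auto
  define f where "f = (\<lambda>(x, y). k x y * (u y \<bullet> v x))"
  have [measurable]: "f \<in> borel_measurable (M \<Otimes>\<^sub>M M)" unfolding f_def by measurable
  have in1: "integrable M (\<lambda>y. f (x, y))" for x
    using integrable_inner_left[of "v x" M "\<lambda>y. k x y *\<^sub>R u y"] kernel_times_integrable[OF u] by (simp add: f_def)
  have "integrable M (\<lambda>x. \<integral>y. norm (f (x, y)) \<partial>M)"
  proof (rule Bochner_Integration.integrable_bound)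
    show "integrable M (\<lambda>x. B * nrm M u * norm (v x))"
      using square_integrable_imp_integrable_norm[OF v] by auto
    show "AE x in M. norm (\<integral>y. norm (f (x, y)) \<partial>M) \<le> norm (B * nrm M u * norm (v x))"
    proof (rule AE_I2)
      fix x
      have "(\<integral>y. norm (f (x, y)) \<partial>M) \<le> (\<integral>y. (B * norm (v x)) * norm (u y) \<partial>M)"
      proof (rule integral_mono)
        show "integrable M (\<lambda>y. norm (f (x, y)))" using in1 by auto
        show "integrable M (\<lambda>y. (B * norm (v x)) * norm (u y))"
          using square_integrable_imp_integrable_norm[OF u] by auto
        show "norm (f (x, y)) \<le> (B * norm (v x)) * norm (u y)" for y
          using mult_mono[OF kernel_bound[of x y] Cauchy_Schwarz_ineq2[of "u y" "v x"]] B_nonneg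
          by (simp add: f_def abs_mult mult_ac)
      qed
      also have "\<dots> = (B * norm (v x)) * (\<integral>y. norm (u y) \<partial>M)" by simp
      also have "\<dots> \<le> (B * norm (v x)) * nrm M u"
        by (intro mult_left_mono integral_norm_le_nrm u) (simp add: B_nonneg)
      finally show "norm (\<integral>y. norm (f (x, y)) \<partial>M) \<le> norm (B * nrm M u * norm (v x))"
        using B_nonneg by (simp add: mult_ac abs_mult)
    qed
  qed measurable
  then have "integrable (M \<Otimes>\<^sub>M M) f"
    by (intro PP.Fubini_integrable) (use in1 in auto)
  from PP.Fubini_integral[of "\<lambda>x y. f (x, y)"] this
  have "(\<integral>y. (\<integral>x. f (x, y) \<partial>M) \<partial>M) = (\<integral>x. (\<integral>y. f (x, y) \<partial>M) \<partial>M)" by (simp add: case_prod_beta')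
  moreover have "(\<integral>y. f (x, y) \<partial>M) = T u x \<bullet> v x" for x
    unfolding f_def T_def
    by (subst integral_inner_left[symmetric]) (use kernel_times_integrable[OF u] in auto)
  moreover have "(\<integral>x. f (x, y) \<partial>M) = u y \<bullet> T v y" for y
  proof -
    have "(\<integral>x. f (x, y) \<partial>M) = (\<integral>x. u y \<bullet> (k y x *\<^sub>R v x) \<partial>M)"
      by (simp add: f_def kernel_sym[of y])
    also have "\<dots> = u y \<bullet> T v y"
      unfolding T_def by (rule integral_inner_right) (use kernel_times_integrable[OF v] in auto)
    finally show ?thesis .
  qed
  ultimately show ?thesis by (simp add: ip_def)
qed

text \<open>Along a weakly convergent subsequence the images converge at every point, and they are
  bounded by \<open>B\<close>, so dominated convergence gives convergence in norm.\<close>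

lemma T_compact:
  fixes u :: "nat \<Rightarrow> 'x \<Rightarrow> 'b::euclidean_space"
  assumes u: "\<And>n. u n \<in> square_integrable M" and u1: "\<And>n. nrm M (u n) \<le> 1"
  obtains r :: "nat \<Rightarrow> nat" and t where "strict_mono r" "t \<in> square_integrable M"
    "(\<lambda>n. nrm M (\<lambda>x. T (u (r n)) x - t x)) \<longlonglongrightarrow> 0"
proof -
  obtain r :: "nat \<Rightarrow> nat" where r: "strict_mono r"
    "\<And>f. f \<in> square_integrable M \<Longrightarrow> convergent (\<lambda>n. ip M (u (r n)) f)"
    using weakly_convergent_subsequence[of u, OF u u1] by blast
  have "\<exists>l. (\<lambda>n. T (u (r n)) x) \<longlonglongrightarrow> l" for x
  proof -
    have "convergent (\<lambda>n. T (u (r n)) x \<bullet> b)" for b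
      using r(2)[OF kernel_section_square_integrable[of x b]]
      unfolding T_inner[OF u] ip_commute[of M "\<lambda>y. k x y *\<^sub>R b"] .
    then obtain l where l: "\<And>b. (\<lambda>n. T (u (r n)) x \<bullet> b) \<longlonglongrightarrow> l b"
      unfolding convergent_def by metis
    have "(\<lambda>n. T (u (r n)) x) \<longlonglongrightarrow> (\<Sum>b\<in>Basis. l b *\<^sub>R b)"
      using l by (subst tendsto_componentwise_iff) simp
    then show ?thesis by blast
  qed
  then obtain t where t: "\<And>x. (\<lambda>n. T (u (r n)) x) \<longlonglongrightarrow> t x" by metis
  have Tm [measurable]: "T (u n) \<in> borel_measurable M" for n by (rule T_measurable[OF u])
  have tm [measurable]: "t \<in> borel_measurable M"
    by (rule borel_measurable_LIMSEQ_metric[of "\<lambda>n. T (u (r n))"]) (use t in auto)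
  have Tb: "norm (T (u n) x) \<le> B" for n x
    using norm_T_le[OF u, of n x] mult_left_mono[OF u1[of n] B_nonneg] by simp
  have tb: "norm (t x) \<le> B" for x
    by (rule LIMSEQ_le_const2[OF tendsto_norm[OF t]]) (use Tb in auto)
  have tL: "t \<in> square_integrable M" by (rule square_integrable_bounded[OF tm]) (use tb in auto)
  have "(\<lambda>n. \<integral>x. (norm (T (u (r n)) x - t x))\<^sup>2 \<partial>M) \<longlonglongrightarrow> (\<integral>x. 0 \<partial>M)"
  proof (rule integral_dominated_convergence[where w="\<lambda>x. (2 * B)\<^sup>2"])
    show "AE x in M. (\<lambda>n. (norm (T (u (r n)) x - t x))\<^sup>2) \<longlonglongrightarrow> 0"
    proof (rule AE_I2)
      fix x
      have "(\<lambda>n. (norm (T (u (r n)) x - t x))\<^sup>2) \<longlonglongrightarrow> (norm (t x - t x))\<^sup>2"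
        by (intro tendsto_intros t)
      then show "(\<lambda>n. (norm (T (u (r n)) x - t x))\<^sup>2) \<longlonglongrightarrow> 0" by simp
    qed
    show "AE x in M. norm ((norm (T (u (r n)) x - t x))\<^sup>2) \<le> (2 * B)\<^sup>2" for n
    proof (rule AE_I2)
      fix x
      have "norm (T (u (r n)) x - t x) \<le> 2 * B"
        using norm_triangle_ineq4[of "T (u (r n)) x" "t x"] Tb[of "r n" x] tb[of x] by linarith
      then show "norm ((norm (T (u (r n)) x - t x))\<^sup>2) \<le> (2 * B)\<^sup>2"
        using power_mono[of "norm (T (u (r n)) x - t x)" "2 * B" 2] by simp
    qed
  qed auto
  from tendsto_real_sqrt[OF this] have "(\<lambda>n. nrm M (\<lambda>x. T (u (r n)) x - t x)) \<longlonglongrightarrow> 0"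
    by (simp add: nrm_def ip_self)
  with r(1) tL show thesis by (rule that)
qed

end

section \<open>Eigenvectors of the kernel operator\<close>

context symmetric_kernel
begin

lemma T_power_square_integrable:
  "u \<in> square_integrable M \<Longrightarrow> (T ^^ n) u \<in> square_integrable M"
  by (induction n) (auto intro: square_integrable_T)

text \<open>Power iteration: the ratios of the norms of the iterates \<open>T\<^sup>n h\<close> increase to some \<open>\<rho>\<close>, so the
  normalised iterates are approximate eigenvectors of \<open>T\<^sup>2\<close>, and compactness yields an
  eigenvector. Orthogonality to the eigenspace is preserved along the iteration.\<close>

proposition eigenvector_exists:
  fixes h :: "'x \<Rightarrow> 'b::euclidean_space"
  assumes h: "h \<in> square_integrable M" and Th: "nrm M (T h) \<noteq> 0"
  shows "\<exists>\<rho>>0. \<exists>e\<in>square_integrable M. (AE x in M. T (T e) x = \<rho>\<^sup>2 *\<^sub>R e x) \<and> ip M h e \<noteq> 0"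
proof (rule ccontr)
  assume neg: "\<not> ?thesis"
  define x where "x n = (T ^^ n) h" for n
  have x: "x n \<in> square_integrable M" for n
    unfolding x_def by (rule T_power_square_integrable[OF h])
  have xS: "x (Suc n) = T (x n)" for n by (simp add: x_def)
  define a where "a n = nrm M (x n)" for n
  have a1: "a 1 \<noteq> 0" using Th by (simp add: a_def x_def)
  \<comment> \<open>Log-convexity of the norms, a consequence of self-adjointness; it makes the
    ratios \<open>q\<close> increase.\<close>
  have a2: "(a (Suc n))\<^sup>2 \<le> a n * a (Suc (Suc n))" for n
  proof -
    have "(a (Suc n))\<^sup>2 = ip M (x n) (x (Suc (Suc n)))"
      unfolding a_def nrm_power2 using T_self_adjoint[OF x x, of n "Suc n"] by (simp add: xS)
    also have "\<dots> \<le> a n * a (Suc (Suc n))"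
      using ip_cauchy_schwarz[OF x x, of n "Suc (Suc n)"] by (simp add: a_def)
    finally show ?thesis .
  qed
  have aSuc: "a (Suc n) \<noteq> 0" for n
  proof (induction n)
    case (Suc n)
    then have "0 < (a (Suc n))\<^sup>2" by simp
    then have "0 < a n * a (Suc (Suc n))" using a2[of n] by linarith
    then show ?case by auto
  qed (use a1 in simp)
  have a0: "a 0 \<noteq> 0"
  proof
    assume "a 0 = 0"
    then have "nrm M h = 0" by (simp add: a_def x_def)
    then have "nrm M (T h) \<le> 0" using nrm_T_le[OF h] by simp
    then show False using Th nrm_nonneg[of M "T h"] by linarith
  qed
  have a: "a n > 0" for n
    using a0 aSuc[of "n - 1"] nrm_nonneg[of M "x n"] by (cases n) (auto simp: a_def less_le)
  define q where "q n = a (Suc n) / a n" for n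
  have q: "q n > 0" for n using a by (simp add: q_def)
  have qB: "q n \<le> B" for n
    using nrm_T_le[OF x[of n]] a[of n] by (simp add: q_def divide_le_eq) (simp add: a_def xS)
  have "incseq q"
  proof (rule incseq_SucI)
    show "q n \<le> q (Suc n)" for n
      using a2[of n] a[of n] a[of "Suc n"] by (simp add: q_def field_simps power2_eq_square)
  qed
  then obtain \<rho> where \<rho>: "q \<longlonglongrightarrow> \<rho>" "\<forall>i. q i \<le> \<rho>"
    using incseq_convergent[of q B] qB by blast
  have \<rho>0: "\<rho> > 0" using q[of 0] \<rho>(2) by (metis less_le_trans)
  define u where "u n = (\<lambda>y. (1 / a n) *\<^sub>R x n y)" for n
  have u: "u n \<in> square_integrable M" for n
    unfolding u_def by (intro square_integrable_scaleR x)
  have u1: "nrm M (u n) = 1" for n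
    using a[of n] by (simp add: u_def nrm_scaleR) (simp add: a_def)
  have Tu: "T (u n) = (\<lambda>y. (1 / a n) *\<^sub>R x (Suc n) y)" for n
    by (rule ext) (simp add: u_def T_scaleR xS)
  have TTu: "T (T (u n)) = (\<lambda>y. (1 / a n) *\<^sub>R x (Suc (Suc n)) y)" for n
    by (rule ext) (simp add: Tu T_scaleR xS)
  have TuL: "T (u n) \<in> square_integrable M" and TTuL: "T (T (u n)) \<in> square_integrable M" for n
    by (intro square_integrable_T u)+
  have nTu: "nrm M (T (u n)) = q n" for n
    using a[of n] unfolding Tu nrm_scaleR by (simp add: q_def a_def)
  have nTTu: "nrm M (T (T (u n))) = q n * q (Suc n)" for n
    using a[of n] a[of "Suc n"] unfolding TTu nrm_scaleR by (simp add: q_def a_def)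
  \<comment> \<open>Expanding the square involves only the norms and
    \<open>ip M (T (T (u n))) (u n)\<close>, which is the square of \<open>q n\<close>. Since
    consecutive ratios have the same limit \<rho>, everything cancels.\<close>
  have "(\<lambda>n. (nrm M (\<lambda>y. T (T (u n)) y - \<rho>\<^sup>2 *\<^sub>R u n y))\<^sup>2) \<longlonglongrightarrow> (\<rho> * \<rho>)\<^sup>2 - 2 * \<rho>\<^sup>2 * \<rho>\<^sup>2 + \<rho>^4"
  proof -
    have "(nrm M (\<lambda>y. T (T (u n)) y - \<rho>\<^sup>2 *\<^sub>R u n y))\<^sup>2
        = (q n * q (Suc n))\<^sup>2 - 2 * \<rho>\<^sup>2 * (q n)\<^sup>2 + \<rho>^4" for n
    proof -
      have "ip M (T (T (u n))) (u n) = (q n)\<^sup>2"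
        unfolding T_self_adjoint[OF TuL u] nrm_power2[symmetric] nTu ..
      then show ?thesis
        unfolding nTTu[symmetric] nrm_power2 using u1[of n] nrm_power2[of M "u n"] u[of n] TTuL[of n]
        by (simp add: ip_diff_left ip_diff_right square_integrable_scaleR square_integrable_diff
            ip_scaleR_left ip_scaleR_right ip_commute[of M "u n" "T (T (u n))"] algebra_simps
            flip: power_add power2_eq_square)
    qed
    then show ?thesis
      using \<rho>(1) LIMSEQ_Suc[OF \<rho>(1)] by (auto intro!: tendsto_intros)
  qed
  moreover have "(\<rho> * \<rho>)\<^sup>2 - 2 * \<rho>\<^sup>2 * \<rho>\<^sup>2 + \<rho>^4 = 0" by (simp add: power2_eq_square power4_eq_xxxx)
  ultimately have "(\<lambda>n. (nrm M (\<lambda>y. T (T (u n)) y - \<rho>\<^sup>2 *\<^sub>R u n y))\<^sup>2) \<longlonglongrightarrow> 0" by simp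
  from tendsto_real_sqrt[OF this]
  have approx: "(\<lambda>n. nrm M (\<lambda>y. T (T (u n)) y - \<rho>\<^sup>2 *\<^sub>R u n y)) \<longlonglongrightarrow> 0" by simp
  obtain r :: "nat \<Rightarrow> nat" and t where r: "strict_mono r" and t: "t \<in> square_integrable M"
    and lim: "(\<lambda>n. nrm M (\<lambda>x. T (u (r n)) x - t x)) \<longlonglongrightarrow> 0"
  proof (rule T_compact[of u, OF u])
    show "nrm M (u n) \<le> 1" for n by (simp add: u1)
  qed (rule that)
  have TtL: "T t \<in> square_integrable M" by (rule square_integrable_T[OF t])
  \<comment> \<open>\<open>T (T (u (r n)))\<close> tends to \<open>T t\<close> and is asymptotically
    \<open>\<rho>\<^sup>2\<close> times \<open>u (r n)\<close>, so \<open>u (r n)\<close> itself has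
    to converge, to this \<open>v\<close>.\<close>
  define v where "v = (\<lambda>y. (1 / \<rho>\<^sup>2) *\<^sub>R T t y)"
  have v: "v \<in> square_integrable M" unfolding v_def by (intro square_integrable_scaleR TtL)
  have Tv: "T t y = \<rho>\<^sup>2 *\<^sub>R v y" for y using \<rho>0 by (simp add: v_def)
  have TT: "nrm M (\<lambda>x. T f x - T g x) \<le> B * nrm M (\<lambda>x. f x - g x)"
    if "f \<in> square_integrable M" "g \<in> square_integrable M" for f g :: "'x \<Rightarrow> 'b"
  proof -
    have "T (\<lambda>x. f x - g x) = (\<lambda>x. T f x - T g x)" by (rule ext) (rule T_diff[OF that])
    then show ?thesis using nrm_T_le[OF square_integrable_diff[OF that]] by simp
  qed
  have vlim: "(\<lambda>n. nrm M (\<lambda>y. u (r n) y - v y)) \<longlonglongrightarrow> 0"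
  proof (rule tendsto_sandwich[OF _ _ tendsto_const])
    show "(\<lambda>n. (1 / \<rho>\<^sup>2) * (nrm M (\<lambda>y. T (T (u (r n))) y - \<rho>\<^sup>2 *\<^sub>R u (r n) y)
        + B * nrm M (\<lambda>x. T (u (r n)) x - t x))) \<longlonglongrightarrow> 0"
      using tendsto_mult_left[OF tendsto_add[OF LIMSEQ_subseq_LIMSEQ[OF approx r] tendsto_mult_left[OF lim, of B]], of "1 / \<rho>\<^sup>2"]
      by (simp add: o_def)
    have "nrm M (\<lambda>y. u (r n) y - v y) \<le> (1 / \<rho>\<^sup>2) * (nrm M (\<lambda>y. T (T (u (r n))) y - \<rho>\<^sup>2 *\<^sub>R u (r n) y)
        + B * nrm M (\<lambda>x. T (u (r n)) x - t x))" for n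
    proof -
      have "nrm M (\<lambda>y. \<rho>\<^sup>2 *\<^sub>R u (r n) y - T t y)
          \<le> nrm M (\<lambda>y. \<rho>\<^sup>2 *\<^sub>R u (r n) y - T (T (u (r n))) y) + nrm M (\<lambda>y. T (T (u (r n))) y - T t y)"
        by (intro nrm_diff_triangle square_integrable_scaleR u TTuL TtL)
      also have "\<dots> \<le> nrm M (\<lambda>y. T (T (u (r n))) y - \<rho>\<^sup>2 *\<^sub>R u (r n) y) + B * nrm M (\<lambda>x. T (u (r n)) x - t x)"
        using TT[OF TuL t, of "r n"] unfolding nrm_diff_commute[of M "\<lambda>y. \<rho>\<^sup>2 *\<^sub>R u (r n) y"] by simp
      finally have *: "nrm M (\<lambda>y. \<rho>\<^sup>2 *\<^sub>R u (r n) y - T t y) \<le> \<dots>" .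
      have "(\<lambda>y. \<rho>\<^sup>2 *\<^sub>R u (r n) y - T t y) = (\<lambda>y. \<rho>\<^sup>2 *\<^sub>R (u (r n) y - v y))"
        by (simp add: Tv scaleR_diff_right)
      with * have "\<rho>\<^sup>2 * nrm M (\<lambda>y. u (r n) y - v y) \<le> nrm M (\<lambda>y. T (T (u (r n))) y - \<rho>\<^sup>2 *\<^sub>R u (r n) y)
        + B * nrm M (\<lambda>x. T (u (r n)) x - t x)" by (simp add: nrm_scaleR)
      then show ?thesis using \<rho>0 by (simp add: field_simps)
    qed
    then show "\<forall>\<^sub>F n in sequentially. nrm M (\<lambda>y. u (r n) y - v y) \<le> (1 / \<rho>\<^sup>2) * (nrm M (\<lambda>y. T (T (u (r n))) y - \<rho>\<^sup>2 *\<^sub>R u (r n) y)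
        + B * nrm M (\<lambda>x. T (u (r n)) x - t x))" by simp
  qed auto
  have TvL: "T v \<in> square_integrable M" and TTvL: "T (T v) \<in> square_integrable M"
    by (intro square_integrable_T v)+
  have eig: "AE y in M. T (T v) y = \<rho>\<^sup>2 *\<^sub>R v y"
  proof -
    have "nrm M (\<lambda>y. T (T v) y - \<rho>\<^sup>2 *\<^sub>R v y) \<le> 0"
    proof (rule LIMSEQ_le_const)
      show "(\<lambda>n. B * (B * nrm M (\<lambda>y. u (r n) y - v y)) + nrm M (\<lambda>y. T (T (u (r n))) y - \<rho>\<^sup>2 *\<^sub>R u (r n) y)
          + \<rho>\<^sup>2 * nrm M (\<lambda>y. u (r n) y - v y)) \<longlonglongrightarrow> 0"
        using tendsto_add[OF tendsto_add[OF tendsto_mult_left[OF tendsto_mult_left[OF vlim, of B], of B] LIMSEQ_subseq_LIMSEQ[OF approx r]]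
            tendsto_mult_left[OF vlim, of "\<rho>\<^sup>2"]] by (simp add: o_def)
      have "nrm M (\<lambda>y. T (T v) y - \<rho>\<^sup>2 *\<^sub>R v y) \<le> B * (B * nrm M (\<lambda>y. u k y - v y))
          + nrm M (\<lambda>y. T (T (u k)) y - \<rho>\<^sup>2 *\<^sub>R u k y) + \<rho>\<^sup>2 * nrm M (\<lambda>y. u k y - v y)" for k
      proof -
        have "nrm M (\<lambda>y. T (T v) y - \<rho>\<^sup>2 *\<^sub>R v y) \<le> nrm M (\<lambda>y. T (T v) y - T (T (u k)) y) + nrm M (\<lambda>y. T (T (u k)) y - \<rho>\<^sup>2 *\<^sub>R v y)"
          by (intro nrm_diff_triangle square_integrable_scaleR v TTuL TTvL)
        moreover have "nrm M (\<lambda>y. T (T (u k)) y - \<rho>\<^sup>2 *\<^sub>R v y) \<le> nrm M (\<lambda>y. T (T (u k)) y - \<rho>\<^sup>2 *\<^sub>R u k y) + nrm M (\<lambda>y. \<rho>\<^sup>2 *\<^sub>R u k y - \<rho>\<^sup>2 *\<^sub>R v y)"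
          by (intro nrm_diff_triangle square_integrable_scaleR v u TTuL)
        moreover have "nrm M (\<lambda>y. \<rho>\<^sup>2 *\<^sub>R u k y - \<rho>\<^sup>2 *\<^sub>R v y) = \<rho>\<^sup>2 * nrm M (\<lambda>y. u k y - v y)"
          by (simp add: nrm_scaleR flip: scaleR_diff_right)
        moreover have "nrm M (\<lambda>y. T (T v) y - T (T (u k)) y) \<le> B * (B * nrm M (\<lambda>y. v y - u k y))"
          using TT[OF TvL TuL, of k] mult_left_mono[OF TT[OF v u, of k] B_nonneg] by linarith
        ultimately show ?thesis unfolding nrm_diff_commute[of M v] by linarith
      qed
      then show "\<exists>N. \<forall>n\<ge>N. nrm M (\<lambda>y. T (T v) y - \<rho>\<^sup>2 *\<^sub>R v y) \<le> B * (B * nrm M (\<lambda>y. u (r n) y - v y))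
          + nrm M (\<lambda>y. T (T (u (r n))) y - \<rho>\<^sup>2 *\<^sub>R u (r n) y) + \<rho>\<^sup>2 * nrm M (\<lambda>y. u (r n) y - v y)" by blast
    qed
    then have "nrm M (\<lambda>y. T (T v) y - \<rho>\<^sup>2 *\<^sub>R v y) = 0" using nrm_nonneg antisym by blast
    from nrm_eq_0_AE[OF _ this] show ?thesis by (simp add: square_integrable_diff square_integrable_scaleR v TTvL)
  qed
  \<comment> \<open>With \<open>e\<close> also \<open>T e\<close> satisfies the eigenvalue equation,
    so self-adjointness moves the powers of \<open>T\<close> from \<open>h\<close> to the
    eigenvector one at a time. The negated goal is the base case.\<close>
  have xe: "ip M (x n) e = 0" if "e \<in> square_integrable M" "AE y in M. T (T e) y = \<rho>\<^sup>2 *\<^sub>R e y" for n e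
    using that
  proof (induction n arbitrary: e)
    case 0
    then show ?case using neg \<rho>0 by (auto simp: x_def)
  next
    case (Suc n)
    have TeL: "T e \<in> square_integrable M" by (rule square_integrable_T[OF Suc.prems(1)])
    have "T (T (T e)) = T (\<lambda>y. \<rho>\<^sup>2 *\<^sub>R e y)"
      by (intro T_AE_cong square_integrable_T TeL square_integrable_scaleR Suc.prems)
    then have "AE y in M. T (T (T e)) y = \<rho>\<^sup>2 *\<^sub>R T e y" by (simp add: T_scaleR)
    from Suc.IH[OF TeL this] show ?case
      unfolding xS T_self_adjoint[OF x Suc.prems(1)] .
  qed
  have "ip M (u n) v = 0" for n
    unfolding u_def ip_scaleR_left using xe[OF v eig] by simp
  \<comment> \<open>The limit \<open>v\<close> has norm one, yet all \<open>u n\<close> are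
    orthogonal to it.\<close>
  then have "ip M v v = 0"
    using nrm_tendsto_ip[OF u v v vlim] by (simp add: LIMSEQ_const_iff)
  moreover have "nrm M v = 1"
    using nrm_tendsto[OF u v vlim] u1 by (simp add: LIMSEQ_const_iff)
  ultimately show False using nrm_power2[of M v] by simp
qed

text \<open>A Hilbert-Schmidt count. At fixed \<open>x\<close>, Bessel's inequality for the kernel
  section in each coordinate direction bounds the sum of \<open>(norm (T e x))\<^sup>2\<close> by
  \<open>DIM('b) * B\<^sup>2\<close>, while each \<open>e\<close> contributes
  \<open>\<rho>\<^sup>2\<close> to the integral of this sum.\<close>

lemma eigenspace_orthonormal_card:
  fixes E :: "('x \<Rightarrow> 'b::euclidean_space) set"
  assumes E: "orthonormal M E" and eig: "\<And>e. e \<in> E \<Longrightarrow> AE x in M. T (T e) x = \<rho>\<^sup>2 *\<^sub>R e x"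
  shows "real (card E) * \<rho>\<^sup>2 \<le> DIM('b) * B\<^sup>2"
proof -
  have EL: "e \<in> square_integrable M" if "e \<in> E" for e using E that by (auto simp: orthonormal_def)
  have "(\<Sum>e\<in>E. (norm (T e x))\<^sup>2) \<le> DIM('b) * B\<^sup>2" for x
  proof -
    have "(\<Sum>e\<in>E. (norm (T e x))\<^sup>2) = (\<Sum>e\<in>E. \<Sum>b\<in>Basis. (ip M (\<lambda>y. k x y *\<^sub>R b) e)\<^sup>2)"
    proof (intro sum.cong refl)
      fix e assume "e \<in> E"
      have "(norm (T e x))\<^sup>2 = (\<Sum>b\<in>Basis. (T e x \<bullet> b)\<^sup>2)"
        unfolding power2_norm_eq_inner euclidean_inner[of "T e x" "T e x"] by (simp add: power2_eq_square)
      then show "(norm (T e x))\<^sup>2 = (\<Sum>b\<in>Basis. (ip M (\<lambda>y. k x y *\<^sub>R b) e)\<^sup>2)"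
        by (simp add: T_inner[OF EL[OF \<open>e \<in> E\<close>]])
    qed
    also have "\<dots> = (\<Sum>b\<in>Basis. \<Sum>e\<in>E. (ip M (\<lambda>y. k x y *\<^sub>R b) e)\<^sup>2)" by (rule sum.swap)
    also have "\<dots> \<le> (\<Sum>b\<in>(Basis :: 'b set). B\<^sup>2)"
    proof (rule sum_mono)
      fix b :: 'b assume b: "b \<in> Basis"
      have "(\<Sum>e\<in>E. (ip M (\<lambda>y. k x y *\<^sub>R b) e)\<^sup>2) \<le> (nrm M (\<lambda>y. k x y *\<^sub>R b))\<^sup>2"
        by (rule bessel(2)[OF E kernel_section_square_integrable])
      also have "\<dots> \<le> B\<^sup>2"
        by (intro power_mono nrm_bounded_le) (use b kernel_bound B_nonneg in auto)
      finally show "(\<Sum>e\<in>E. (ip M (\<lambda>y. k x y *\<^sub>R b) e)\<^sup>2) \<le> B\<^sup>2" .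
    qed
    also have "\<dots> = DIM('b) * B\<^sup>2" by simp
    finally show ?thesis .
  qed
  moreover have int: "integrable M (\<lambda>x. (norm (T e x))\<^sup>2)" if "e \<in> E" for e
    using square_integrable_T[OF EL[OF that]] by (rule integrable_norm_power2)
  ultimately have "(\<integral>x. (\<Sum>e\<in>E. (norm (T e x))\<^sup>2) \<partial>M) \<le> (\<integral>x. DIM('b) * B\<^sup>2 \<partial>M)"
    by (intro integral_mono) auto
  also have "(\<integral>x. (\<Sum>e\<in>E. (norm (T e x))\<^sup>2) \<partial>M) = (\<Sum>e\<in>E. \<rho>\<^sup>2)"
  proof -
    have "(\<integral>x. (norm (T e x))\<^sup>2 \<partial>M) = \<rho>\<^sup>2" if e: "e \<in> E" for e
    proof -
      have TL: "T e \<in> square_integrable M" by (rule square_integrable_T[OF EL[OF e]])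
      have "(\<integral>x. (norm (T e x))\<^sup>2 \<partial>M) = ip M e (T (T e))"
        using T_self_adjoint[OF EL[OF e] TL] by (simp add: ip_self)
      also have "\<dots> = ip M e (\<lambda>x. \<rho>\<^sup>2 *\<^sub>R e x)"
        by (intro ip_AE_cong EL e square_integrable_T TL square_integrable_scaleR) (use eig[OF e] in auto)
      also have "\<dots> = \<rho>\<^sup>2" using E e by (auto simp: ip_scaleR_right orthonormal_def)
      finally show ?thesis .
    qed
    then show ?thesis using int by simp
  qed
  finally show ?thesis by (simp add: prob_space)
qed

end

section \<open>Operators of invariant kernels\<close>

lemma l2_functions_eq: "l2_functions M = square_integrable M"
  by (auto simp: l2_functions_def square_integrable_def)

lemma l2_norm_eq: "l2_norm M f = nrm M f"
  by (simp add: l2_norm_def nrm_def ip_self)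

lemma l2_subspace_imp_real_subspace:
  assumes "l2_subspace M V"
  shows "real_subspace M V"
proof -
  have "(\<lambda>x. c *\<^sub>R f x) \<in> V" if "f \<in> V" for c f
  proof -
    have "(\<lambda>x. complex_of_real c * f x) \<in> V" using assms that by (auto simp: l2_subspace_def)
    then show ?thesis by (simp add: scaleR_conv_of_real)
  qed
  with assms show ?thesis by (auto simp: l2_subspace_def real_subspace_def l2_functions_eq)
qed

locale invariant_kernel_operator = measure_preserving_action G M \<phi> + symmetric_kernel M k B
  for G :: "('g, 'm) monoid_scheme" (structure) and M :: "'x measure" and \<phi> k B +
  assumes kernel_invariant: "g \<in> carrier G \<Longrightarrow> AE (x, y) in M \<Otimes>\<^sub>M M. k (\<phi> g x) (\<phi> g y) = k x y"
begin

text \<open>Substitute \<open>\<phi> g y\<close> for \<open>y\<close> under the integral. The kernel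
  is invariant only almost everywhere, so this works for almost every \<open>x\<close>.\<close>

lemma T_action:
  assumes g: "g \<in> carrier G" and u: "u \<in> square_integrable M"
  shows "AE x in M. T (\<lambda>y. u (\<phi> g y)) x = T u (\<phi> g x)"
proof -
  have [measurable]: "u \<in> borel_measurable M" using u by auto
  note [measurable] = action_measurable[OF g]
  have "AE x in M. AE y in M. k (\<phi> g x) (\<phi> g y) = k x y"
    using PP.AE_pair[OF kernel_invariant[OF g]] by simp
  then show ?thesis
  proof eventually_elim
    case (elim x)
    have "T (\<lambda>y. u (\<phi> g y)) x = (\<integral>y. k (\<phi> g x) (\<phi> g y) *\<^sub>R u (\<phi> g y) \<partial>M)"
      unfolding T_def by (rule integral_cong_AE) (use elim in auto)
    also have "\<dots> = T u (\<phi> g x)"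
      unfolding T_def by (rule integral_action[OF g, of "\<lambda>y. k (\<phi> g x) y *\<^sub>R u y"]) measurable
    finally show ?case .
  qed
qed

text \<open>Otherwise \<open>h\<close> is not orthogonal to some eigenvector \<open>e\<close>, and
  the eigenspace of \<open>T (T _)\<close> containing \<open>e\<close> is one of the
  finite-dimensional invariant subspaces to which \<open>orth\<close> applies.\<close>

proposition T_vanishes_on_complement:
  fixes h :: "'x \<Rightarrow> complex"
  assumes h: "h \<in> square_integrable M"
    and orth: "\<And>V e. l2_subspace M V \<Longrightarrow> l2_finite_dimensional M V \<Longrightarrow> l2_invariant G \<phi> V \<Longrightarrow>
      e \<in> V \<Longrightarrow> ip M h e = 0"
  shows "AE x in M. T h x = 0"
proof -
  have "nrm M (T h) = 0"
  proof (rule ccontr)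
    assume "nrm M (T h) \<noteq> 0"
    then obtain \<rho> e where \<rho>: "\<rho> > 0" and e: "e \<in> square_integrable M"
      "AE x in M. T (T e) x = \<rho>\<^sup>2 *\<^sub>R e x" "ip M h e \<noteq> 0"
      using eigenvector_exists[OF h] by blast
    define V :: "('x \<Rightarrow> complex) set" where
      "V = {f \<in> square_integrable M. AE x in M. T (T f) x = \<rho>\<^sup>2 *\<^sub>R f x}"
    have Tadd: "T (\<lambda>x. f x + g x) = (\<lambda>x. T f x + T g x)"
      if "f \<in> square_integrable M" "g \<in> square_integrable M" for f g :: "'x \<Rightarrow> complex"
      using that by (auto simp: T_add)
    have Tmult: "T (\<lambda>x. c * f x) = (\<lambda>x. c * T f x)" for c :: complex and f
      unfolding T_def by (simp add: mult_scaleR_right[symmetric] del: mult_scaleR_right)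
    have sub: "l2_subspace M V"
      unfolding l2_subspace_def l2_functions_eq
    proof (intro conjI ballI allI impI)
      show "V \<subseteq> square_integrable M" by (auto simp: V_def)
      show "(\<lambda>x. 0) \<in> V" by (auto simp: V_def T_def)
      show "(\<lambda>x. f x + g x) \<in> V" if "f \<in> V" "g \<in> V" for f g
        using that by (auto simp: V_def Tadd square_integrable_T square_integrable_add scaleR_add_right)
      show "(\<lambda>x. c * f x) \<in> V" if "f \<in> V" for c f
      proof -
        have "(\<lambda>x. c * f x) \<in> square_integrable M"
          using that by (auto simp: V_def square_integrable_def norm_mult power_mult_distrib)
        then show ?thesis using that by (auto simp: V_def Tmult)
      qed
      show "g \<in> V" if "f \<in> V" "g \<in> square_integrable M" "AE x in M. f x = g x" for f g
      proof -
        have "T f = T g" by (rule T_AE_cong) (use that in \<open>auto simp: V_def\<close>)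
        with that show ?thesis by (auto simp: V_def elim!: eventually_elim2)
      qed
    qed
    have rs: "real_subspace M V" by (rule l2_subspace_imp_real_subspace[OF sub])
    have "card E \<le> nat \<lfloor>DIM(complex) * B\<^sup>2 / \<rho>\<^sup>2\<rfloor>" if "orthonormal M E" "E \<subseteq> V" for E
    proof -
      have "real (card E) * \<rho>\<^sup>2 \<le> DIM(complex) * B\<^sup>2"
        by (rule eigenspace_orthonormal_card) (use that in \<open>auto simp: V_def\<close>)
      then have "real (card E) \<le> DIM(complex) * B\<^sup>2 / \<rho>\<^sup>2" using \<rho> by (simp add: field_simps)
      then show ?thesis by (simp add: le_nat_floor)
    qed
    from orthonormal_basis_exists[OF rs this] obtain E where
      E: "orthonormal M E" "E \<subseteq> V" "\<And>f. f \<in> V \<Longrightarrow> spanned_AE M E f" by blast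
    have fd: "l2_finite_dimensional M V"
      unfolding l2_finite_dimensional_def
    proof (intro exI conjI ballI)
      show "finite E" using E(1) by (simp add: orthonormal_def)
      show "E \<subseteq> V" by fact
      show "AE x in M. f x = (\<Sum>e\<in>E. complex_of_real (ip M f e) * e x)" if "f \<in> V" for f
        using E(3)[OF that] by (simp add: spanned_AE_def scaleR_conv_of_real)
    qed
    have inv: "l2_invariant G \<phi> V"
      unfolding l2_invariant_def
    proof (intro ballI)
      fix g f assume g: "g \<in> carrier G" and f: "f \<in> V"
      have fL: "f \<in> square_integrable M" and eig: "AE x in M. T (T f) x = \<rho>\<^sup>2 *\<^sub>R f x"
        using f by (auto simp: V_def)
      have fg: "(\<lambda>x. f (\<phi> g x)) \<in> square_integrable M" by (rule square_integrable_action[OF g fL])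
      have TL: "T f \<in> square_integrable M" by (rule square_integrable_T[OF fL])
      have "T (T (\<lambda>x. f (\<phi> g x))) = T (\<lambda>x. T f (\<phi> g x))"
        by (intro T_AE_cong square_integrable_T fg square_integrable_action g TL T_action fL)
      then have "AE x in M. T (T (\<lambda>x. f (\<phi> g x))) x = \<rho>\<^sup>2 *\<^sub>R f (\<phi> g x)"
        using T_action[OF g TL] AE_action[OF g eig] by (auto elim!: eventually_elim2)
      then show "f \<circ> \<phi> g \<in> V" using fg by (simp add: V_def o_def)
    qed
    have "e \<in> V" using e by (simp add: V_def)
    from orth[OF sub fd inv this] e(3) show False by contradiction
  qed
  then show ?thesis by (rule nrm_eq_0_AE[OF square_integrable_T[OF h]])
qed

end

section \<open>From invariant kernels to discrete spectrum\<close>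

text \<open>Continuity from above for the sets where \<open>s\<close> is at most
  \<open>1 / Suc n\<close>. The uniform lower bound off a small set makes the reciprocal of a
  kernel's mass bounded there.\<close>

lemma (in finite_measure) measure_le_threshold:
  fixes s :: "'a \<Rightarrow> real"
  assumes [measurable]: "s \<in> borel_measurable M" and pos: "AE x in M. 0 < s x" and \<delta>: "\<delta> > 0"
  obtains \<eta> where "\<eta> > 0" "measure M {x \<in> space M. s x \<le> \<eta>} < \<delta>"
proof -
  define A where "A n = {x \<in> space M. s x \<le> 1 / Suc n}" for n
  have [measurable]: "A n \<in> sets M" for n unfolding A_def by measurable
  have dec: "decseq A"
  proof (rule decseq_SucI)
    have "1 / real (Suc (Suc n)) \<le> 1 / real (Suc n)" for n by (simp add: field_simps)
    then show "A (Suc n) \<subseteq> A n" for n unfolding A_def by (auto intro: order_trans)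
  qed
  have "(\<Inter>n. A n) \<subseteq> {x \<in> space M. \<not> 0 < s x}"
  proof
    fix x assume x: "x \<in> (\<Inter>n. A n)"
    have "\<not> 0 < s x"
    proof
      assume "0 < s x"
      then obtain n where "1 / real (Suc n) < s x" using nat_approx_posE by metis
      moreover have "s x \<le> 1 / real (Suc n)" using x by (auto simp: A_def)
      ultimately show False by linarith
    qed
    then show "x \<in> {x \<in> space M. \<not> 0 < s x}" using x by (auto simp: A_def)
  qed
  moreover have "measure M {x \<in> space M. \<not> 0 < s x} = 0"
    using pos by (intro measure_eq_0_null_sets) (auto simp: AE_iff_null)
  ultimately have "measure M (\<Inter>n. A n) = 0"
    using finite_measure_mono[of "\<Inter>n. A n" "{x \<in> space M. \<not> 0 < s x}"] by (simp add: measure_le_0_iff)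
  moreover have "(\<lambda>n. measure M (A n)) \<longlonglongrightarrow> measure M (\<Inter>n. A n)"
    by (rule finite_Lim_measure_decseq[OF _ dec]) auto
  ultimately have "\<forall>\<^sub>F n in sequentially. measure M (A n) < \<delta>"
    using order_tendstoD(2) \<delta> by metis
  then obtain n where "measure M (A n) < \<delta>" using eventually_happens by fastforce
  then show thesis using that[of "1 / Suc n"] by (simp add: A_def)
qed

lemma square_integrable_cmult:
  "f \<in> square_integrable M \<Longrightarrow> (\<lambda>x. c * f x) \<in> square_integrable M" for c :: complex
  by (auto simp: square_integrable_def norm_mult power_mult_distrib)

context measure_preserving_action
begin

lemma pair_integrable_bounded:
  fixes f :: "'x \<Rightarrow> 'x \<Rightarrow> real"
  assumes "(\<lambda>(x, y). f x y) \<in> borel_measurable (M \<Otimes>\<^sub>M M)" "\<And>x y. \<bar>f x y\<bar> \<le> C"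
  shows "integrable (M \<Otimes>\<^sub>M M) (\<lambda>(x, y). f x y)"
  by (rule PP.integrable_const_bound[where B=C]) (use assms in \<open>auto simp: case_prod_beta'\<close>)

text \<open>Collects what \<open>invariant_kernel\<close> produces; the upper bound is existential
  because only its existence is used.\<close>

definition limit_kernel :: "(nat \<Rightarrow> 'g set) \<Rightarrow> ('x \<Rightarrow> 'x \<Rightarrow> real) \<Rightarrow> ('x \<Rightarrow> 'x \<Rightarrow> real) \<Rightarrow> bool" where
  "limit_kernel F w v \<longleftrightarrow> (\<lambda>(x, y). v x y) \<in> borel_measurable (M \<Otimes>\<^sub>M M) \<and>
     (\<forall>x y. 0 \<le> v x y) \<and> (\<exists>B. \<forall>x y. v x y \<le> B) \<and> (\<forall>x y. v x y = v y x) \<and>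
     (\<forall>g\<in>carrier G. AE (x, y) in M \<Otimes>\<^sub>M M. v (\<phi> g x) (\<phi> g y) = v x y) \<and>
     (\<lambda>n. \<integral>(x, y). \<bar>averaged \<phi> w (F n) x y - v x y\<bar> \<partial>(M \<Otimes>\<^sub>M M)) \<longlonglongrightarrow> 0"

text \<open>Testing against the generating subspaces suffices, and since these are closed under
  complex scalars the real product is enough.\<close>

definition orthogonal_to_compact_part :: "('x \<Rightarrow> complex) \<Rightarrow> bool" where
  "orthogonal_to_compact_part h \<longleftrightarrow> h \<in> square_integrable M \<and>
     (\<forall>V e. l2_subspace M V \<longrightarrow> l2_finite_dimensional M V \<longrightarrow> l2_invariant G \<phi> V \<longrightarrow>
        e \<in> V \<longrightarrow> ip M h e = 0)"

text \<open>The residual of \<open>f\<close> against any closed subspace containing the generators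
  is orthogonal to the compact part, hence null, so that subspace contains \<open>f\<close>.\<close>

lemma discrete_spectrumI:
  assumes "\<And>h. orthogonal_to_compact_part h \<Longrightarrow> AE x in M. h x = 0"
  shows "discrete_spectrum G \<phi> M"
proof -
  have sub: "l2_subspace M (l2_functions M)"
    unfolding l2_subspace_def l2_functions_eq
    by (intro conjI ballI allI impI square_integrable_add square_integrable_cmult) auto
  have "compact_part G \<phi> M \<subseteq> l2_functions M"
    unfolding compact_part_def
    by (rule Inter_lower) (use sub in \<open>auto simp: l2_closed_def l2_subspace_def\<close>)
  moreover have "f \<in> W" if f: "f \<in> l2_functions M" and W: "l2_subspace M W" "l2_closed M W"
    and V: "\<And>V. l2_subspace M V \<and> l2_finite_dimensional M V \<and> l2_invariant G \<phi> V \<Longrightarrow> V \<subseteq> W" for f W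
  proof -
    have rs: "real_subspace M W" by (rule l2_subspace_imp_real_subspace[OF W(1)])
    have "\<exists>r\<in>square_integrable M. (\<forall>d\<in>W. ip M r d = 0) \<and> (\<forall>e>0. \<exists>d\<in>W. nrm M (\<lambda>x. f x - d x - r x) < e)"
      by (rule orthogonal_residual) (use rs f in \<open>auto simp: real_subspace_def l2_functions_eq\<close>)
    then obtain r where r: "r \<in> square_integrable M" "\<And>d. d \<in> W \<Longrightarrow> ip M r d = 0"
      and ap: "\<And>e. e > 0 \<Longrightarrow> \<exists>d\<in>W. nrm M (\<lambda>x. f x - d x - r x) < e" by blast
    have "orthogonal_to_compact_part r"
      using r V unfolding orthogonal_to_compact_part_def by blast
    from assms[OF this] have r0: "AE x in M. r x = 0" .
    have "\<exists>d\<in>W. l2_norm M (\<lambda>x. f x - d x) < e" if e: "e > 0" for e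
    proof -
      obtain d where d: "d \<in> W" "nrm M (\<lambda>x. f x - d x - r x) < e" using ap[OF e] by blast
      have "d \<in> square_integrable M" using d rs by (auto simp: real_subspace_def)
      then have "nrm M (\<lambda>x. f x - d x) = nrm M (\<lambda>x. f x - d x - r x)"
        using f r r0 by (intro nrm_AE_cong square_integrable_diff) (auto simp: l2_functions_eq)
      with d show ?thesis by (intro bexI[of _ d]) (simp_all add: l2_norm_eq)
    qed
    then show ?thesis using W(2) f by (auto simp: l2_closed_def)
  qed
  ultimately show ?thesis by (auto simp: discrete_spectrum_def compact_part_def)
qed

text \<open>An invariant weight cannot distinguish \<open>w\<close> from its translates, so under
  the integral \<open>w\<close> may be replaced by its averages; these tend to \<open>v\<close> in
  L1 and \<open>p\<close> is bounded.\<close>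

lemma integral_invariant_kernel:
  fixes p :: "'x \<Rightarrow> 'x \<Rightarrow> real"
  assumes F: "folner_sequence G F"
    and wm [measurable]: "(\<lambda>(x, y). w x y) \<in> borel_measurable (M \<Otimes>\<^sub>M M)"
    and w0: "\<And>x y. 0 \<le> w x y" and wB: "\<And>x y. w x y \<le> B"
    and v: "limit_kernel F w v"
    and pm [measurable]: "(\<lambda>(x, y). p x y) \<in> borel_measurable (M \<Otimes>\<^sub>M M)"
    and pC: "\<And>x y. \<bar>p x y\<bar> \<le> C"
    and pinv: "\<And>g. g \<in> carrier G \<Longrightarrow> AE (x, y) in M \<Otimes>\<^sub>M M. p (\<phi> g x) (\<phi> g y) = p x y"
  shows "(\<integral>(x, y). p x y * w x y \<partial>(M \<Otimes>\<^sub>M M)) = (\<integral>(x, y). p x y * v x y \<partial>(M \<Otimes>\<^sub>M M))"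
proof -
  interpret Q: measure_preserving_action G "M \<Otimes>\<^sub>M M" "\<lambda>g (x, y). (\<phi> g x, \<phi> g y)"
    by (rule pair_action)
  let ?Q = "M \<Otimes>\<^sub>M M"
  have Ffin: "finite (F n)" and Fne: "F n \<noteq> {}" and Fsub: "F n \<subseteq> carrier G" for n
    using F by (auto simp: folner_sequence_def)
  have C0: "0 \<le> C" using pC[of undefined undefined] by linarith
  have vm [measurable]: "(\<lambda>(x, y). v x y) \<in> borel_measurable ?Q" and v0: "\<And>x y. 0 \<le> v x y"
    and lim: "(\<lambda>n. \<integral>(x, y). \<bar>averaged \<phi> w (F n) x y - v x y\<bar> \<partial>?Q) \<longlonglongrightarrow> 0"
    using v by (auto simp: limit_kernel_def)
  obtain B' where vB: "\<And>x y. v x y \<le> B'" using v by (auto simp: limit_kernel_def)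
  have pv: "integrable ?Q (\<lambda>(x, y). p x y * v x y)"
  proof (rule pair_integrable_bounded)
    show "\<bar>p x y * v x y\<bar> \<le> C * B'" for x y
      using mult_mono[OF pC vB C0 v0, of x y x y] by (simp add: abs_mult v0)
  qed measurable
  have wi: "integrable ?Q (\<lambda>(x, y). w x y)" and vi: "integrable ?Q (\<lambda>(x, y). v x y)"
    by (rule pair_integrable_bounded[OF wm, of B], use w0 wB in simp,
        rule pair_integrable_bounded[OF vm, of B'], use v0 vB in simp)
  have pw: "integrable ?Q (\<lambda>(x, y). p x y * w x y)"
  proof (rule pair_integrable_bounded)
    show "\<bar>p x y * w x y\<bar> \<le> C * B" for x y
      using mult_mono[OF pC wB C0 w0, of x y x y] by (simp add: abs_mult w0)
  qed measurable
  have wg: "integrable ?Q (\<lambda>(x, y). p x y * w (\<phi> g x) (\<phi> g y))"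
    "(\<integral>(x, y). p x y * w (\<phi> g x) (\<phi> g y) \<partial>?Q) = (\<integral>(x, y). p x y * w x y \<partial>?Q)"
    if g: "g \<in> carrier G" for g
  proof -
    note [measurable] = action_measurable[OF g]
    have m [measurable]: "(\<lambda>(x, y). w (\<phi> g x) (\<phi> g y)) \<in> borel_measurable ?Q" by measurable
    show "integrable ?Q (\<lambda>(x, y). p x y * w (\<phi> g x) (\<phi> g y))"
    proof (rule pair_integrable_bounded)
      show "\<bar>p x y * w (\<phi> g x) (\<phi> g y)\<bar> \<le> C * B" for x y
        using mult_mono[OF pC wB C0 w0, of x y "\<phi> g x" "\<phi> g y"] by (simp add: abs_mult w0)
    qed measurable
    have "(\<integral>(x, y). p x y * w (\<phi> g x) (\<phi> g y) \<partial>?Q)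
        = (\<integral>(x, y). p (\<phi> g x) (\<phi> g y) * w (\<phi> g x) (\<phi> g y) \<partial>?Q)"
      by (rule integral_cong_AE) (use pinv[OF g] in auto)
    also have "\<dots> = (\<integral>(x, y). p x y * w x y \<partial>?Q)"
      using Q.integral_action[OF g, of "\<lambda>(x, y). p x y * w x y"] by (simp add: case_prod_beta')
    finally show "(\<integral>(x, y). p x y * w (\<phi> g x) (\<phi> g y) \<partial>?Q) = (\<integral>(x, y). p x y * w x y \<partial>?Q)" .
  qed
  have pavg_eq: "(case z of (x, y) \<Rightarrow> p x y * averaged \<phi> w (F n) x y)
      = (1 / real (card (F n))) * (\<Sum>g\<in>F n. case z of (x, y) \<Rightarrow> p x y * w (\<phi> g x) (\<phi> g y))" for n z
    by (cases z) (simp add: averaged_def sum_distrib_left sum_divide_distrib)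
  have pavg: "integrable ?Q (\<lambda>(x, y). p x y * averaged \<phi> w (F n) x y)"
    "(\<integral>(x, y). p x y * averaged \<phi> w (F n) x y \<partial>?Q) = (\<integral>(x, y). p x y * w x y \<partial>?Q)" for n
  proof -
    have i: "integrable ?Q (\<lambda>z. case z of (x, y) \<Rightarrow> p x y * w (\<phi> g x) (\<phi> g y))" if "g \<in> F n" for g
      using wg(1) that Fsub[of n] by auto
    show "integrable ?Q (\<lambda>(x, y). p x y * averaged \<phi> w (F n) x y)"
      unfolding pavg_eq using i by auto
    have "(\<integral>(x, y). p x y * averaged \<phi> w (F n) x y \<partial>?Q)
      = (1 / real (card (F n))) * (\<Sum>g\<in>F n. \<integral>(x, y). p x y * w (\<phi> g x) (\<phi> g y) \<partial>?Q)"
      unfolding pavg_eq using i by simp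
    also have "(\<Sum>g\<in>F n. \<integral>(x, y). p x y * w (\<phi> g x) (\<phi> g y) \<partial>?Q) = (\<Sum>g\<in>F n. \<integral>(x, y). p x y * w x y \<partial>?Q)"
      by (intro sum.cong refl wg(2)) (use Fsub[of n] in auto)
    finally show "(\<integral>(x, y). p x y * averaged \<phi> w (F n) x y \<partial>?Q) = (\<integral>(x, y). p x y * w x y \<partial>?Q)"
      using Ffin[of n] Fne[of n] by simp
  qed
  have avi: "integrable ?Q (\<lambda>(x, y). averaged \<phi> w (F n) x y)" for n
  proof -
    have "Q.avg (F n) (\<lambda>(x, y). w x y) = (\<lambda>(x, y). averaged \<phi> w (F n) x y)"
      by (auto simp: Q.avg_def averaged_def)
    with Q.integral_avg(1)[OF Ffin Fne Fsub wi, of n] show ?thesis by simp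
  qed
  have "\<bar>(\<integral>(x, y). p x y * w x y \<partial>?Q) - (\<integral>(x, y). p x y * v x y \<partial>?Q)\<bar>
      \<le> C * (\<integral>(x, y). \<bar>averaged \<phi> w (F n) x y - v x y\<bar> \<partial>?Q)" for n
  proof -
    have di: "integrable ?Q (\<lambda>(x, y). \<bar>averaged \<phi> w (F n) x y - v x y\<bar>)"
      using integrable_abs[OF Bochner_Integration.integrable_diff[OF avi[of n] vi]] by (simp add: case_prod_beta')
    have "(\<integral>(x, y). p x y * w x y \<partial>?Q) - (\<integral>(x, y). p x y * v x y \<partial>?Q)
        = (\<integral>(x, y). p x y * (averaged \<phi> w (F n) x y - v x y) \<partial>?Q)"
      using pavg[of n] pv by (simp add: case_prod_beta' right_diff_distrib)
    also have "\<bar>\<dots>\<bar> \<le> (\<integral>z. \<bar>case z of (x, y) \<Rightarrow> p x y * (averaged \<phi> w (F n) x y - v x y)\<bar> \<partial>?Q)"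
      by (rule integral_abs_bound)
    also have "\<dots> \<le> (\<integral>z. C * (case z of (x, y) \<Rightarrow> \<bar>averaged \<phi> w (F n) x y - v x y\<bar>) \<partial>?Q)"
    proof (rule integral_mono)
      show "integrable ?Q (\<lambda>z. \<bar>case z of (x, y) \<Rightarrow> p x y * (averaged \<phi> w (F n) x y - v x y)\<bar>)"
        using integrable_abs[OF Bochner_Integration.integrable_diff[OF pavg(1)[of n] pv]]
        by (simp add: case_prod_beta' right_diff_distrib)
      show "integrable ?Q (\<lambda>z. C * (case z of (x, y) \<Rightarrow> \<bar>averaged \<phi> w (F n) x y - v x y\<bar>))"
        using di by auto
    qed (auto simp: abs_mult intro!: mult_right_mono pC)
    finally show ?thesis by simp
  qed
  then have "\<bar>(\<integral>(x, y). p x y * w x y \<partial>?Q) - (\<integral>(x, y). p x y * v x y \<partial>?Q)\<bar> \<le> 0"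
    using tendsto_mult_left[OF lim, of C] by (intro LIMSEQ_le_const[of _ 0]) auto
  then show ?thesis by simp
qed

lemma AE_pair_fst:
  assumes "AE x in M. P x"
  shows "AE (x, y) in M \<Otimes>\<^sub>M M. P x"
proof -
  obtain N where N: "N \<in> null_sets M" "{x \<in> space M. \<not> P x} \<subseteq> N"
    using assms unfolding eventually_ae_filter by auto
  have "N \<times> space M \<in> null_sets (M \<Otimes>\<^sub>M M)"
    using N(1) by (intro times_in_null_sets1) auto
  moreover have "{z \<in> space (M \<Otimes>\<^sub>M M). \<not> (case z of (x, y) \<Rightarrow> P x)} \<subseteq> N \<times> space M"
    using N(2) by (auto simp: space_pair_measure)
  ultimately show ?thesis unfolding eventually_ae_filter by blast
qed

lemma AE_pair_snd:
  assumes "AE x in M. P x"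
  shows "AE (x, y) in M \<Otimes>\<^sub>M M. P y"
proof -
  obtain N where N: "N \<in> null_sets M" "{x \<in> space M. \<not> P x} \<subseteq> N"
    using assms unfolding eventually_ae_filter by auto
  have "space M \<times> N \<in> null_sets (M \<Otimes>\<^sub>M M)"
    using N(1) by (intro times_in_null_sets2) auto
  moreover have "{z \<in> space (M \<Otimes>\<^sub>M M). \<not> (case z of (x, y) \<Rightarrow> P y)} \<subseteq> space M \<times> N"
    using N(2) by (auto simp: space_pair_measure)
  ultimately show ?thesis unfolding eventually_ae_filter by blast
qed


text \<open>The approximant is \<open>g(x) = b(x) \<integral> k(x,y) 1\<^sub>Y(y) f(y) dy\<close> where \<open>k\<close> is a bump of the
  invariant kernel around the diagonal, \<open>s(x) = \<integral> k(x,y) dy\<close>, \<open>Y = {s > \<eta>}\<close> and \<open>b = 1\<^sub>Y / s\<close>.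
  It is the image of \<open>s f\<close> under the symmetric invariant kernel \<open>b(x) k(x,y) b(y)\<close>, because
  \<open>b s = 1\<^sub>Y\<close>. Invariance of \<open>b(x) k(x,y)\<close> turns \<open>w\<close> into its average, which is at most
  \<open>\<epsilon>\<close> on the support of \<open>k\<close>.\<close>

lemma orthogonal_approximation:
  fixes f :: "'x \<Rightarrow> real"
  assumes F: "folner_sequence G F"
    and wm [measurable]: "(\<lambda>(x, y). w x y) \<in> borel_measurable (M \<Otimes>\<^sub>M M)"
    and w0: "\<And>x y. 0 \<le> w x y" and wB: "\<And>x y. w x y \<le> B"
    and v: "limit_kernel F w v"
    and pos: "\<And>\<epsilon>. \<epsilon> > 0 \<Longrightarrow> AE x in M. 0 < (\<integral>y. max 0 (1 - v x y / \<epsilon>) \<partial>M)"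
    and fm [measurable]: "f \<in> borel_measurable M" and f1: "\<And>x. \<bar>f x\<bar> \<le> 1"
    and fL: "\<And>x y. \<bar>f x - f y\<bar> \<le> L * w x y" and L: "0 \<le> L" and \<delta>: "\<delta> > 0"
  shows "\<exists>g\<in>borel_measurable M. (\<forall>x. \<bar>g x\<bar> \<le> (1::real)) \<and> (\<integral>x. \<bar>f x - g x\<bar> \<partial>M) \<le> \<delta> \<and>
    (\<forall>h c. orthogonal_to_compact_part h \<longrightarrow> ip M (\<lambda>x. g x *\<^sub>R c) h = 0)"
proof -
  let ?Q = "M \<Otimes>\<^sub>M M"
  have vm [measurable]: "(\<lambda>(x, y). v x y) \<in> borel_measurable ?Q" and v0: "\<And>x y. 0 \<le> v x y"
    and vsym: "\<And>x y. v x y = v y x"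
    and vinv: "\<And>g. g \<in> carrier G \<Longrightarrow> AE (x, y) in ?Q. v (\<phi> g x) (\<phi> g y) = v x y"
    using v by (auto simp: limit_kernel_def)
  \<comment> \<open>The error budget: \<open>L * \<epsilon>\<close> takes half of \<delta>, and
    \<open>Yc\<close> is made smaller than \<open>\<delta> / 4\<close> because its measure enters
    twice. The summand 1 keeps the quotient meaningful for \<open>L = 0\<close>.\<close>
  define \<epsilon> where "\<epsilon> = \<delta> / (2 * (L + 1))"
  have \<epsilon>: "\<epsilon> > 0" using \<delta> L by (simp add: \<epsilon>_def)
  have L\<epsilon>: "L * \<epsilon> \<le> \<delta> / 2"
    using \<delta> L by (simp add: \<epsilon>_def field_simps)
  define k where "k x y = max 0 (1 - v x y / \<epsilon>)" for x y
  have km [measurable]: "(\<lambda>(x, y). k x y) \<in> borel_measurable ?Q" unfolding k_def by measurable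
  have k0: "0 \<le> k x y" and k1: "k x y \<le> 1" for x y using v0[of x y] \<epsilon> by (auto simp: k_def)
  have ksym: "k x y = k y x" for x y by (simp add: k_def vsym)
  have kinv: "AE (x, y) in ?Q. k (\<phi> g x) (\<phi> g y) = k x y" if "g \<in> carrier G" for g
    using vinv[OF that] by eventually_elim (auto simp: k_def)
  have kv: "k x y * v x y \<le> \<epsilon> * k x y" for x y
  proof (cases "v x y \<le> \<epsilon>")
    case True
    then show ?thesis using k0[of x y] by (metis mult.commute mult_left_mono)
  next
    case False
    then have "k x y = 0" using \<epsilon> by (simp add: k_def)
    then show ?thesis by simp
  qed
  interpret K: invariant_kernel_operator G M \<phi> k 1
    by unfold_locales (use k0 k1 ksym kinv in \<open>auto simp: space_UNIV\<close>)
  have kx [measurable]: "k x \<in> borel_measurable M" for x by (rule K.kernel_section_measurable)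
  have kxi: "integrable M (k x)" for x
    by (rule integrable_const_bound[where B=1]) (use k0 k1 in auto)
  define s where "s x = (\<integral>y. k x y \<partial>M)" for x
  have sT: "s = K.T (\<lambda>x. 1 :: real)" by (rule ext) (simp add: s_def K.T_def)
  have one: "(\<lambda>x. 1 :: real) \<in> square_integrable M" by (simp add: square_integrable_def)
  have sm [measurable]: "s \<in> borel_measurable M" unfolding sT by (rule K.T_measurable[OF one])
  have s0: "0 \<le> s x" for x unfolding s_def using k0 by simp
  have s1: "s x \<le> 1" for x
    using integral_mono[OF kxi, of "\<lambda>_. 1" x] k1 by (simp add: s_def prob_space)
  have sinv: "AE x in M. s (\<phi> g x) = s x" if "g \<in> carrier G" for g
    using K.T_action[OF that one] by (simp add: sT eq_commute)
  have "AE x in M. 0 < s x" using pos[OF \<epsilon>] by (simp add: s_def k_def)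
  from measure_le_threshold[OF sm this, of "\<delta> / 4"] \<delta> obtain \<eta> where
    \<eta>: "\<eta> > 0" "measure M {x \<in> space M. s x \<le> \<eta>} < \<delta> / 4" by auto
  define Y where "Y = {x. s x > \<eta>}"
  have Ym [measurable]: "Y \<in> sets M" unfolding Y_def using borel_measurable_less[OF borel_measurable_const sm, of \<eta>] by (simp add: space_UNIV)
  define Yc where "Yc = {x. s x \<le> \<eta>}"
  have Ycm [measurable]: "Yc \<in> sets M" unfolding Yc_def using borel_measurable_le[OF sm borel_measurable_const, of \<eta>] by (simp add: space_UNIV)
  have Yci: "integrable M (indicator Yc :: 'x \<Rightarrow> real)"
    by (rule integrable_const_bound[where B=1]) auto
  have YYc: "indicator Yc x = (1 - indicator Y x :: real)" for x
    by (auto simp: Y_def Yc_def indicator_def)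
  have mYc: "measure M Yc < \<delta> / 4" using \<eta>(2) by (simp add: Yc_def space_UNIV)
  \<comment> \<open>The reciprocal of the mass, cut off where the mass is small. It is bounded and
    invariant, and \<open>b x * k x y\<close> has integral one in \<open>y\<close> for
    \<open>x\<close> in \<open>Y\<close>.\<close>
  define b where "b x = (if s x > \<eta> then 1 / s x else 0)" for x
  have bm [measurable]: "b \<in> borel_measurable M" unfolding b_def by measurable
  have b0: "0 \<le> b x" for x using s0[of x] by (simp add: b_def)
  have bB: "b x \<le> 1 / \<eta>" for x using \<eta>(1) by (auto simp: b_def intro: divide_left_mono)
  have bs: "b x * s x = indicator Y x" for x using \<eta>(1) by (auto simp: b_def Y_def indicator_def)
  have binv: "AE x in M. b (\<phi> g x) = b x" if "g \<in> carrier G" for g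
    using sinv[OF that] by eventually_elim (simp add: b_def)
  define g where "g x = b x * (\<integral>y. k x y * (indicator Y y * f y) \<partial>M)" for x
  define u where "u c y = (s y * f y) *\<^sub>R c" for c :: complex and y
  have sf1: "\<bar>s y * f y\<bar> \<le> 1" for y
    using mult_mono[OF s1[of y] f1[of y]] s0[of y] by (simp add: abs_mult)
  have um: "u c \<in> square_integrable M" for c
  proof (rule square_integrable_bounded)
    show "u c \<in> borel_measurable M" unfolding u_def by measurable
    show "AE x in M. norm (u c x) \<le> 1 * norm c"
      unfolding u_def norm_scaleR real_norm_def using sf1 by (intro AE_I2 mult_right_mono) auto
  qed
  have kfi: "integrable M (\<lambda>y. k x y * (indicator Y y * f y))" for x
  proof (rule integrable_const_bound[where B=1])
    show "AE y in M. norm (k x y * (indicator Y y * f y)) \<le> 1"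
    proof (rule AE_I2)
      fix y
      have "\<bar>indicator Y y * f y\<bar> \<le> 1" using f1[of y] by (simp add: indicator_def)
      from mult_mono[OF k1[of x y] this] show "norm (k x y * (indicator Y y * f y)) \<le> 1"
        using k0[of x y] by (simp add: abs_mult)
    qed
  qed measurable
  define k' where "k' x y = b x * k x y * b y" for x y
  interpret K': invariant_kernel_operator G M \<phi> k' "(1 / \<eta>) * 1 * (1 / \<eta>)"
  proof unfold_locales
    show "space M = UNIV" by (rule space_UNIV)
    show "(\<lambda>(x, y). k' x y) \<in> borel_measurable ?Q" unfolding k'_def by measurable
    show "\<bar>k' x y\<bar> \<le> (1 / \<eta>) * 1 * (1 / \<eta>)" for x y
      unfolding k'_def abs_mult using b0 bB k0 k1 \<eta>(1) by (intro mult_mono) auto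
    show "k' x y = k' y x" for x y by (simp add: k'_def ksym mult_ac)
    show "AE (x, y) in ?Q. k' (\<phi> g x) (\<phi> g y) = k' x y" if g: "g \<in> carrier G" for g
      using kinv[OF g] AE_pair_fst[OF binv[OF g]] AE_pair_snd[OF binv[OF g]]
      by eventually_elim (auto simp: k'_def)
  qed
  have gT: "g x *\<^sub>R c = K'.T (u c) x" for x c
  proof -
    have "K'.T (u c) x = (\<integral>y. (b x * (k x y * (indicator Y y * f y))) *\<^sub>R c \<partial>M)"
      unfolding K'.T_def by (intro Bochner_Integration.integral_cong refl) (simp add: k'_def u_def mult_ac flip: bs)
    also have "\<dots> = (\<integral>y. b x * (k x y * (indicator Y y * f y)) \<partial>M) *\<^sub>R c"
      by (rule integral_scaleR_left) (use kfi in auto)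
    finally show ?thesis by (simp add: g_def)
  qed
  have gm [measurable]: "g \<in> borel_measurable M"
  proof -
    have "(\<lambda>x. Re (g x *\<^sub>R (1::complex))) \<in> borel_measurable M"
      unfolding gT using K'.T_measurable[OF um] by measurable
    then show ?thesis by simp
  qed
  have bk_int: "integrable M (\<lambda>y. b x * k x y)" for x using kxi by auto
  have bk: "(\<integral>y. b x * k x y \<partial>M) = indicator Y x" for x using bs[of x] by (simp add: s_def)
  have g1: "\<bar>g x\<bar> \<le> 1" for x
  proof -
    have "\<bar>g x\<bar> = b x * \<bar>\<integral>y. k x y * (indicator Y y * f y) \<partial>M\<bar>"
      using b0[of x] by (simp add: g_def abs_mult)
    also have "\<dots> \<le> b x * (\<integral>y. \<bar>k x y * (indicator Y y * f y)\<bar> \<partial>M)"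
      by (intro mult_left_mono integral_abs_bound b0)
    also have "\<dots> \<le> b x * (\<integral>y. k x y \<partial>M)"
    proof (intro mult_left_mono integral_mono integrable_abs kfi kxi b0)
      fix y
      have "\<bar>indicator Y y * f y\<bar> \<le> 1" using f1[of y] by (simp add: indicator_def)
      from mult_left_mono[OF this k0[of x y]]
      show "\<bar>k x y * (indicator Y y * f y)\<bar> \<le> k x y" using k0[of x y] by (simp add: abs_mult)
    qed
    also have "\<dots> \<le> 1" using bs[of x] by (simp add: s_def indicator_def)
    finally show ?thesis .
  qed
  define p where "p x y = b x * k x y" for x y
  have pm [measurable]: "(\<lambda>(x, y). p x y) \<in> borel_measurable ?Q" unfolding p_def by measurable
  have p0: "0 \<le> p x y" for x y using b0 k0 by (simp add: p_def)
  have pB: "p x y \<le> 1 / \<eta>" for x y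
    using mult_mono[OF bB[of x] k1[of x y]] k0[of x y] \<eta>(1) by (simp add: p_def)
  have pabs: "\<bar>p x y\<bar> \<le> 1 / \<eta>" for x y using p0[of x y] pB[of x y] by simp
  have pinv: "AE (x, y) in ?Q. p (\<phi> g x) (\<phi> g y) = p x y" if g: "g \<in> carrier G" for g
    using kinv[OF g] AE_pair_fst[OF binv[OF g]] by eventually_elim (auto simp: p_def)
  have B0: "0 \<le> B" using w0[of undefined undefined] wB[of undefined undefined] by linarith
  have pw_i: "integrable ?Q (\<lambda>(x, y). p x y * w x y)"
  proof (rule pair_integrable_bounded)
    show "\<bar>p x y * w x y\<bar> \<le> (1 / \<eta>) * B" for x y
      using mult_mono[OF pB wB _ w0, of x y x y] \<eta>(1) p0[of x y] w0[of x y] by (simp add: abs_mult)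
  qed measurable
  have pi_: "integrable ?Q (\<lambda>(x, y). p x y)"
    by (rule pair_integrable_bounded[OF pm pabs])
  have pv_i: "integrable ?Q (\<lambda>(x, y). p x y * v x y)"
  proof (rule pair_integrable_bounded)
    show "\<bar>p x y * v x y\<bar> \<le> (1 / \<eta>) * \<epsilon>" for x y
    proof -
      have "p x y * v x y = b x * (k x y * v x y)" by (simp add: p_def)
      also have "\<dots> \<le> (1 / \<eta>) * (\<epsilon> * 1)"
      proof (rule mult_mono[OF bB])
        show "k x y * v x y \<le> \<epsilon> * 1"
          using order_trans[OF kv[of x y] mult_left_mono[OF k1[of x y], of \<epsilon>]] \<epsilon> by simp
      qed (use \<eta>(1) k0 v0 in auto)
      finally show ?thesis using p0 v0 by simp
    qed
  qed measurable
  have int_p: "(\<integral>(x, y). p x y \<partial>?Q) \<le> 1"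
  proof -
    have "(\<integral>(x, y). p x y \<partial>?Q) = (\<integral>x. (\<integral>y. p x y \<partial>M) \<partial>M)"
      using PP.integral_fst'[OF pi_] by simp
    also have "\<dots> = (\<integral>x. indicator Y x \<partial>M)" unfolding p_def bk ..
    also have "\<dots> \<le> 1" by simp
    finally show ?thesis .
  qed
  have "(\<integral>(x, y). p x y * w x y \<partial>?Q) = (\<integral>(x, y). p x y * v x y \<partial>?Q)"
    by (rule integral_invariant_kernel[OF F wm w0 wB v pm pabs pinv])
  also have "\<dots> \<le> (\<integral>z. \<epsilon> * (case z of (x, y) \<Rightarrow> p x y) \<partial>?Q)"
  proof (intro integral_mono pv_i)
    show "integrable ?Q (\<lambda>z. \<epsilon> * (case z of (x, y) \<Rightarrow> p x y))" using pi_ by auto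
    show "(case z of (x, y) \<Rightarrow> p x y * v x y) \<le> \<epsilon> * (case z of (x, y) \<Rightarrow> p x y)" for z
    proof (cases z)
      case (Pair x y)
      then show ?thesis using mult_left_mono[OF kv[of x y] b0[of x]] by (simp add: p_def mult_ac)
    qed
  qed
  also have "\<dots> \<le> \<epsilon>" using int_p \<epsilon> by (simp add: mult_left_le)
  finally have pw: "(\<integral>(x, y). p x y * w x y \<partial>?Q) \<le> \<epsilon>" .
  have pYc_i: "integrable ?Q (\<lambda>(x, y). p x y * indicator Yc y)"
  proof (rule pair_integrable_bounded)
    show "\<bar>p x y * indicator Yc y\<bar> \<le> 1 / \<eta>" for x y
      using pabs[of x y] \<eta>(1) by (auto simp: indicator_def)
  qed measurable
  \<comment> \<open>\<open>p\<close> is normalised in \<open>y\<close>, so its integral in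
    \<open>x\<close> needs its own estimate: by symmetry of \<open>k\<close> it is at most
    \<open>s y / \<eta>\<close>, which is at most 1 for \<open>y\<close> in
    \<open>Yc\<close>.\<close>
  have pYc: "(\<integral>(x, y). p x y * indicator Yc y \<partial>?Q) \<le> measure M Yc"
  proof -
    have "(\<integral>(x, y). p x y * indicator Yc y \<partial>?Q) = (\<integral>y. (\<integral>x. p x y * indicator Yc y \<partial>M) \<partial>M)"
      using PP.integral_fst'[OF pYc_i] PP.Fubini_integral[OF pYc_i] by simp
    also have "\<dots> \<le> (\<integral>y. indicator Yc y \<partial>M)"
    proof (rule integral_mono)
      show "integrable M (\<lambda>y. \<integral>x. p x y * indicator Yc y \<partial>M)"
        using PP.integrable_snd[OF pYc_i] by simp
      fix y
      show "(\<integral>x. p x y * indicator Yc y \<partial>M) \<le> indicator Yc y"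
      proof (cases "y \<in> Yc")
        case True
        have "(\<integral>x. p x y \<partial>M) \<le> (\<integral>x. (1 / \<eta>) * k y x \<partial>M)"
        proof (rule integral_mono)
          show "integrable M (\<lambda>x. p x y)"
          proof (rule integrable_const_bound[where B="1 / \<eta>"])
            have [measurable]: "(\<lambda>x. k x y) \<in> borel_measurable M" using kx[of y] by (simp add: ksym[of _ y])
            show "(\<lambda>x. p x y) \<in> borel_measurable M" unfolding p_def by measurable
          qed (use pabs in auto)
          show "integrable M (\<lambda>x. (1 / \<eta>) * k y x)" using kxi[of y] by auto
          show "p x y \<le> (1 / \<eta>) * k y x" for x
            unfolding p_def ksym[of y x] by (intro mult_right_mono bB k0)
        qed
        also have "\<dots> = (1 / \<eta>) * s y" by (simp add: s_def)
        also have "\<dots> \<le> 1" using True \<eta>(1) by (simp add: Yc_def)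
        finally show ?thesis using True by simp
      qed simp
    qed (rule Yci)
    finally show ?thesis by simp
  qed
  \<comment> \<open>For \<open>x\<close> in \<open>Y\<close> the weights \<open>p x y\<close> have
    total mass one, so \<open>f x\<close> is itself a weighted integral. The integrands then differ
    by at most \<open>L * w x y\<close> for \<open>y\<close> in \<open>Y\<close>, and by at most 1
    for \<open>y\<close> in \<open>Yc\<close>, each times \<open>p x y\<close>.\<close>
  have pt: "\<bar>f x - g x\<bar> \<le> indicator Yc x + (\<integral>y. L * (p x y * w x y) + p x y * indicator Yc y \<partial>M)"
    if ix: "integrable M (\<lambda>y. p x y * w x y)" "integrable M (\<lambda>y. p x y * indicator Yc y)" for x
  proof (cases "x \<in> Y")
    case False
    then have "b x = 0" by (simp add: b_def Y_def)
    then have "g x = 0" and "p x = (\<lambda>_. 0)" by (auto simp: g_def p_def)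
    moreover have "x \<in> Yc" using False by (auto simp: Y_def Yc_def)
    ultimately show ?thesis using f1[of x] by simp
  next
    case True
    have kfi': "integrable M (\<lambda>y. b x * (k x y * (indicator Y y * f y)))"
      using kfi[of x] by auto
    have pfi: "integrable M (\<lambda>y. p x y * f x)" using bk_int[of x] by (auto simp: p_def)
    have "f x = (\<integral>y. p x y * f x \<partial>M)" using bk[of x] True by (simp add: p_def)
    then have "f x - g x = (\<integral>y. p x y * f x - b x * (k x y * (indicator Y y * f y)) \<partial>M)"
      using kfi' pfi by (simp add: g_def)
    also have "\<bar>\<dots>\<bar> \<le> (\<integral>y. \<bar>p x y * f x - b x * (k x y * (indicator Y y * f y))\<bar> \<partial>M)"
      by (rule integral_abs_bound)
    also have "\<dots> \<le> (\<integral>y. L * (p x y * w x y) + p x y * indicator Yc y \<partial>M)"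
    proof (rule integral_mono)
      show "integrable M (\<lambda>y. \<bar>p x y * f x - b x * (k x y * (indicator Y y * f y))\<bar>)"
        using kfi' pfi by auto
      show "integrable M (\<lambda>y. L * (p x y * w x y) + p x y * indicator Yc y)"
        using ix by auto
      fix y
      have "\<bar>f x - indicator Y y * f y\<bar> \<le> L * w x y + indicator Yc y"
      proof (cases "y \<in> Y")
        case True
        then show ?thesis using fL[of x y] by (simp add: YYc)
      next
        case False
        then show ?thesis using f1[of x] mult_nonneg_nonneg[OF L w0[of x y]] by (simp add: YYc)
      qed
      from mult_left_mono[OF this p0[of x y]]
      have "p x y * \<bar>f x - indicator Y y * f y\<bar> \<le> L * (p x y * w x y) + p x y * indicator Yc y"
        by (simp add: algebra_simps)
      moreover have "p x y * f x - b x * (k x y * (indicator Y y * f y)) = p x y * (f x - indicator Y y * f y)"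
        by (simp add: p_def algebra_simps)
      ultimately show "\<bar>p x y * f x - b x * (k x y * (indicator Y y * f y))\<bar> \<le> L * (p x y * w x y) + p x y * indicator Yc y"
        using p0[of x y] by (simp add: abs_mult)
    qed
    finally show ?thesis using True by (simp add: YYc)
  qed
  have "(\<integral>x. \<bar>f x - g x\<bar> \<partial>M) \<le> (\<integral>x. indicator Yc x + (\<integral>y. L * (p x y * w x y) + p x y * indicator Yc y \<partial>M) \<partial>M)"
  proof (rule integral_mono_AE)
    have "integrable M f" "integrable M g"
      by (rule integrable_const_bound[where B=1], use f1 g1 in auto)+
    then show "integrable M (\<lambda>x. \<bar>f x - g x\<bar>)" by auto
    have "integrable ?Q (\<lambda>z. L * (case z of (x, y) \<Rightarrow> p x y * w x y) + (case z of (x, y) \<Rightarrow> p x y * indicator Yc y))"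
      using pw_i pYc_i by auto
    from PP.integrable_fst'[OF this] Yci
    show "integrable M (\<lambda>x. indicator Yc x + (\<integral>y. L * (p x y * w x y) + p x y * indicator Yc y \<partial>M))"
      by auto
    show "AE x in M. \<bar>f x - g x\<bar> \<le> indicator Yc x + (\<integral>y. L * (p x y * w x y) + p x y * indicator Yc y \<partial>M)"
      using PP.AE_integrable_fst'[OF pw_i] PP.AE_integrable_fst'[OF pYc_i]
      by eventually_elim (rule pt, auto)
  qed
  also have "\<dots> = measure M Yc + (L * (\<integral>(x, y). p x y * w x y \<partial>?Q) + (\<integral>(x, y). p x y * indicator Yc y \<partial>?Q))"
  proof -
    have i: "integrable ?Q (\<lambda>z. L * (case z of (x, y) \<Rightarrow> p x y * w x y) + (case z of (x, y) \<Rightarrow> p x y * indicator Yc y))"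
      using pw_i pYc_i by auto
    have "(\<integral>x. (\<integral>y. L * (p x y * w x y) + p x y * indicator Yc y \<partial>M) \<partial>M)
        = (\<integral>z. L * (case z of (x, y) \<Rightarrow> p x y * w x y) + (case z of (x, y) \<Rightarrow> p x y * indicator Yc y) \<partial>?Q)"
      using PP.integral_fst'[OF i] by simp
    also have "\<dots> = L * (\<integral>(x, y). p x y * w x y \<partial>?Q) + (\<integral>(x, y). p x y * indicator Yc y \<partial>?Q)"
      using pw_i pYc_i by simp
    finally show ?thesis
      using PP.integrable_fst'[OF i] Yci by simp
  qed
  also have "\<dots> \<le> \<delta>"
    using mYc pYc mult_left_mono[OF pw L] L\<epsilon> by linarith
  finally have L1: "(\<integral>x. \<bar>f x - g x\<bar> \<partial>M) \<le> \<delta>" .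
  have "ip M (\<lambda>x. g x *\<^sub>R c) h = 0" if h: "orthogonal_to_compact_part h" for h c
  proof -
    have hL: "h \<in> square_integrable M" using h by (simp add: orthogonal_to_compact_part_def)
    have "AE x in M. K'.T h x = 0"
      by (rule K'.T_vanishes_on_complement[OF hL]) (use h in \<open>auto simp: orthogonal_to_compact_part_def\<close>)
    then have "ip M (u c) (K'.T h) = ip M (u c) (\<lambda>x. 0)"
      by (intro ip_AE_cong um K'.square_integrable_T hL) auto
    moreover have "ip M (\<lambda>x. g x *\<^sub>R c) h = ip M (u c) (K'.T h)"
      unfolding gT by (rule K'.T_self_adjoint[OF um hL])
    ultimately show ?thesis by simp
  qed
  with gm g1 L1 show ?thesis by blast
qed

text \<open>An L1 approximation suffices: \<open>f\<close> and \<open>g\<close> are bounded by 1, so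
  the square of their difference is at most twice its modulus, and the L2 distance is at most
  \<open>sqrt (2 * \<delta>)\<close>.\<close>

lemma orthogonal_to_oscillation_bounded:
  fixes f :: "'x \<Rightarrow> real"
  assumes F: "folner_sequence G F"
    and wm: "(\<lambda>(x, y). w x y) \<in> borel_measurable (M \<Otimes>\<^sub>M M)"
    and w0: "\<And>x y. 0 \<le> w x y" and wB: "\<And>x y. w x y \<le> B"
    and v: "limit_kernel F w v"
    and pos: "\<And>\<epsilon>. \<epsilon> > 0 \<Longrightarrow> AE x in M. 0 < (\<integral>y. max 0 (1 - v x y / \<epsilon>) \<partial>M)"
    and fm [measurable]: "f \<in> borel_measurable M" and f1: "\<And>x. \<bar>f x\<bar> \<le> 1"
    and fL: "\<And>x y. \<bar>f x - f y\<bar> \<le> L * w x y" and L: "0 \<le> L"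
    and h: "orthogonal_to_compact_part h"
  shows "ip M (\<lambda>x. f x *\<^sub>R c) h = 0"
proof -
  have hL: "h \<in> square_integrable M" using h by (simp add: orthogonal_to_compact_part_def)
  have si: "(\<lambda>x. q x *\<^sub>R c) \<in> square_integrable M" if [measurable]: "q \<in> borel_measurable M" and "\<And>x. \<bar>q x\<bar> \<le> 2" for q :: "'x \<Rightarrow> real"
    by (rule square_integrable_bounded[where B="2 * norm c"]) (use that(2) in \<open>auto intro!: mult_right_mono\<close>)
  have bound: "\<bar>ip M (\<lambda>x. f x *\<^sub>R c) h\<bar> \<le> sqrt (2 * \<delta>) * norm c * nrm M h" if \<delta>: "\<delta> > 0" for \<delta>
  proof -
    obtain g where gm [measurable]: "g \<in> borel_measurable M" and g1: "\<And>x. \<bar>g x\<bar> \<le> 1"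
      and L1: "(\<integral>x. \<bar>f x - g x\<bar> \<partial>M) \<le> \<delta>" and gh: "ip M (\<lambda>x. g x *\<^sub>R c) h = 0"
      using orthogonal_approximation[OF F wm w0 wB v pos fm f1 fL L \<delta>] h by blast
    have fg2: "\<bar>f x - g x\<bar> \<le> 2" for x using f1[of x] g1[of x] by linarith
    have f2: "\<bar>f x\<bar> \<le> 2" and g2: "\<bar>g x\<bar> \<le> 2" for x using f1[of x] g1[of x] by linarith+
    have fi: "integrable M f" and gi: "integrable M g"
      by (rule integrable_const_bound[where B=1], use f1 g1 in auto)+
    have "ip M (\<lambda>x. f x *\<^sub>R c) h = ip M (\<lambda>x. (f x - g x) *\<^sub>R c) h"
      using ip_diff_left[OF si[OF fm f2] si[OF gm g2] hL] gh by (simp add: scaleR_diff_left)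
    also have "\<bar>\<dots>\<bar> \<le> nrm M (\<lambda>x. (f x - g x) *\<^sub>R c) * nrm M h"
      by (intro ip_cauchy_schwarz si hL fg2) measurable
    also have "nrm M (\<lambda>x. (f x - g x) *\<^sub>R c) \<le> sqrt (2 * \<delta>) * norm c"
    proof -
      have "(\<integral>x. (norm ((f x - g x) *\<^sub>R c))\<^sup>2 \<partial>M) \<le> (\<integral>x. (2 * (norm c)\<^sup>2) * \<bar>f x - g x\<bar> \<partial>M)"
      proof (rule integral_mono)
        show "integrable M (\<lambda>x. (norm ((f x - g x) *\<^sub>R c))\<^sup>2)"
          by (rule integrable_norm_power2, rule si[OF _ fg2]) measurable
        show "integrable M (\<lambda>x. (2 * (norm c)\<^sup>2) * \<bar>f x - g x\<bar>)" using fi gi by auto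
        fix x
        have "\<bar>f x - g x\<bar> * \<bar>f x - g x\<bar> \<le> 2 * \<bar>f x - g x\<bar>" by (intro mult_right_mono fg2) simp
        from mult_right_mono[OF this, of "(norm c)\<^sup>2"]
        show "(norm ((f x - g x) *\<^sub>R c))\<^sup>2 \<le> (2 * (norm c)\<^sup>2) * \<bar>f x - g x\<bar>"
          by (simp add: power_mult_distrib power2_eq_square mult_ac)
      qed
      also have "\<dots> \<le> (2 * (norm c)\<^sup>2) * \<delta>" using L1 by (simp add: mult_left_mono)
      finally have "nrm M (\<lambda>x. (f x - g x) *\<^sub>R c) \<le> sqrt ((2 * \<delta>) * (norm c)\<^sup>2)"
        unfolding nrm_def ip_self by (intro real_sqrt_le_mono) (simp add: mult_ac)
      then show ?thesis by (simp add: real_sqrt_mult)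
    qed
    finally show ?thesis by (simp add: mult_right_mono)
  qed
  define K where "K = norm c * nrm M h"
  have K0: "K \<ge> 0" by (simp add: K_def)
  show ?thesis
  proof (rule ccontr)
    assume "ip M (\<lambda>x. f x *\<^sub>R c) h \<noteq> 0"
    then have pos: "\<bar>ip M (\<lambda>x. f x *\<^sub>R c) h\<bar> > 0" (is "?a > 0") by simp
    \<comment> \<open>Chosen so that \<open>sqrt (2 * \<delta>)\<close> equals
      \<open>?a / (K + 1)\<close>, which makes the bound strictly smaller than
      \<open>?a\<close>.\<close>
    define \<delta> where "\<delta> = (?a / (K + 1))\<^sup>2 / 2"
    have "\<delta> > 0" using pos K0 by (simp add: \<delta>_def)
    from bound[OF this] have "?a \<le> sqrt ((?a / (K + 1))\<^sup>2) * K" by (simp add: \<delta>_def K_def mult_ac)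
    also have "\<dots> = ?a * (K / (K + 1))" using pos K0 by (simp add: real_sqrt_abs)
    also have "\<dots> < ?a * 1" using pos K0 by (intro mult_strict_left_mono) auto
    finally show False by simp
  qed
qed

end

section \<open>Positive measure of the balls of the limit kernel\<close>

text \<open>The infimum of a nonempty set of extended naturals is attained, and a finite bound
  excludes the empty set, whose infimum is infinite.\<close>

lemma complexity_le_iff:
  "complexity M w \<epsilon> \<le> enat K \<longleftrightarrow>
     (\<exists>m\<le>K. \<exists>x :: nat \<Rightarrow> 'x. measure M (\<Union>i\<in>{1..m}. semimetric_ball w (x i) (\<epsilon> / 2)) > 1 - \<epsilon>)"
  (is "?l \<longleftrightarrow> ?r")
proof
  define S where "S = {enat m | m. \<exists>x :: nat \<Rightarrow> 'x.
            measure M (\<Union>i\<in>{1..m}. semimetric_ball w (x i) (\<epsilon> / 2)) > 1 - \<epsilon>}"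
  assume "?l"
  then have le: "Inf S \<le> enat K" by (simp add: complexity_def S_def)
  then have "S \<noteq> {}" by (auto simp: Inf_enat_def)
  then have "Inf S \<in> S" by (auto simp: Inf_enat_def intro: LeastI)
  with le show ?r by (auto simp: S_def)
next
  assume ?r
  then obtain m and x :: "nat \<Rightarrow> 'x" where m: "m \<le> K"
    "measure M (\<Union>i\<in>{1..m}. semimetric_ball w (x i) (\<epsilon> / 2)) > 1 - \<epsilon>" by blast
  have "complexity M w \<epsilon> \<le> enat m"
    unfolding complexity_def by (rule Inf_lower) (use m(2) in blast)
  also have "enat m \<le> enat K" using m(1) by simp
  finally show ?l .
qed

lemma semimetric_averaged:
  assumes "semimetric w"
  shows "semimetric (averaged \<phi> w F)"
proof -
  have "averaged \<phi> w F x z \<le> averaged \<phi> w F x y + averaged \<phi> w F y z" for x y z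
    unfolding averaged_def add_divide_distrib[symmetric] sum.distrib[symmetric]
    using assms by (intro divide_right_mono sum_mono) (auto simp: semimetric_def)
  moreover have "averaged \<phi> w F x y = averaged \<phi> w F y x" for x y
    using assms by (simp add: averaged_def semimetric_def)
  moreover have "0 \<le> averaged \<phi> w F x y" "averaged \<phi> w F x x = 0" for x y
    using assms by (auto simp: averaged_def semimetric_def intro!: divide_nonneg_nonneg sum_nonneg)
  ultimately show ?thesis unfolding semimetric_def by blast
qed

context measure_preserving_action
begin

lemma measure_square:
  assumes "P \<in> sets M"
  shows "measure (M \<Otimes>\<^sub>M M) (P \<times> P) = (measure M P)\<^sup>2"
  using emeasure_pair_measure_Times[OF assms assms]
  by (simp add: measure_def enn2real_mult power2_eq_square)

lemma averaged_measurable: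
  assumes "A \<subseteq> carrier G" and wm: "(\<lambda>(x, y). w x y) \<in> borel_measurable (M \<Otimes>\<^sub>M M)"
  shows "(\<lambda>(x, y). averaged \<phi> w A x y) \<in> borel_measurable (M \<Otimes>\<^sub>M M)"
proof -
  interpret Q: measure_preserving_action G "M \<Otimes>\<^sub>M M" "\<lambda>g (x, y). (\<phi> g x, \<phi> g y)"
    by (rule pair_action)
  have "Q.avg A (\<lambda>(x, y). w x y) = (\<lambda>(x, y). averaged \<phi> w A x y)"
    by (auto simp: Q.avg_def averaged_def)
  with Q.avg_measurable[OF assms] show ?thesis by simp
qed

lemma averaged_bounds:
  assumes "finite A" "A \<noteq> {}" "\<And>x y. 0 \<le> w x y" "\<And>x y. w x y \<le> B"
  shows "0 \<le> averaged \<phi> w A x y" "averaged \<phi> w A x y \<le> B"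
proof -
  show "0 \<le> averaged \<phi> w A x y" using assms(3) by (simp add: averaged_def sum_nonneg)
  have "(\<Sum>g\<in>A. w (\<phi> g x) (\<phi> g y)) \<le> real (card A) * B"
    using sum_bounded_above[of A "\<lambda>g. w (\<phi> g x) (\<phi> g y)" B] assms(4) by simp
  then show "averaged \<phi> w A x y \<le> B"
    using assms(1,2) by (simp add: averaged_def divide_le_eq mult.commute card_gt_0_iff)
qed

lemma section_measurable:
  assumes "(\<lambda>(x, y). u x y) \<in> measurable (M \<Otimes>\<^sub>M M) N"
  shows "u x \<in> measurable M N"
  using measurable_compose_Pair1[of x M "\<lambda>(x, y). u x y" M N] assms by (simp add: space_UNIV)

text \<open>The points whose \<open>v\<close>-ball of radius \<epsilon> is null, expressed through
  the bump that serves as kernel in \<open>orthogonal_approximation\<close>.\<close>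

definition degenerate :: "('x \<Rightarrow> 'x \<Rightarrow> real) \<Rightarrow> real \<Rightarrow> 'x set" where
  "degenerate v \<epsilon> = {x. (\<integral>y. max 0 (1 - v x y / \<epsilon>) \<partial>M) \<le> 0}"

lemma degenerate:
  assumes v: "limit_kernel F w v" and \<epsilon>: "\<epsilon> > 0"
  shows "degenerate v \<epsilon> \<in> sets M"
    and "AE (x, y) in M \<Otimes>\<^sub>M M. x \<in> degenerate v \<epsilon> \<longrightarrow> \<epsilon> \<le> v x y"
    and "measure M (degenerate v \<epsilon>) = 0 \<Longrightarrow> AE x in M. 0 < (\<integral>y. max 0 (1 - v x y / \<epsilon>) \<partial>M)"
proof -
  have vm [measurable]: "(\<lambda>(x, y). v x y) \<in> borel_measurable (M \<Otimes>\<^sub>M M)" and v0: "\<And>x y. 0 \<le> v x y"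
    using v by (auto simp: limit_kernel_def)
  define s where "s x = (\<integral>y. max 0 (1 - v x y / \<epsilon>) \<partial>M)" for x
  have sm [measurable]: "s \<in> borel_measurable M"
    unfolding s_def[abs_def] by (rule borel_measurable_lebesgue_integral) measurable
  have Z: "degenerate v \<epsilon> = {x \<in> space M. s x \<le> 0}" by (simp add: degenerate_def s_def space_UNIV)
  show Zm [measurable]: "degenerate v \<epsilon> \<in> sets M" unfolding Z by measurable
  show "AE (x, y) in M \<Otimes>\<^sub>M M. x \<in> degenerate v \<epsilon> \<longrightarrow> \<epsilon> \<le> v x y"
  proof (rule PP.AE_pair_measure)
    have "{z \<in> space (M \<Otimes>\<^sub>M M). fst z \<in> degenerate v \<epsilon> \<longrightarrow> \<epsilon> \<le> (\<lambda>(x, y). v x y) z} \<in> sets (M \<Otimes>\<^sub>M M)"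
      by measurable
    then show "{z \<in> space (M \<Otimes>\<^sub>M M). case z of (x, y) \<Rightarrow> x \<in> degenerate v \<epsilon> \<longrightarrow> \<epsilon> \<le> v x y} \<in> sets (M \<Otimes>\<^sub>M M)"
      by (simp add: case_prod_beta')
    have "AE y in M. x \<in> degenerate v \<epsilon> \<longrightarrow> \<epsilon> \<le> v x y" for x
    proof (cases "x \<in> degenerate v \<epsilon>")
      case True
      have [measurable]: "v x \<in> borel_measurable M" by (rule section_measurable[OF vm])
      have i: "integrable M (\<lambda>y. max 0 (1 - v x y / \<epsilon>))"
        by (rule integrable_const_bound[where B=1]) (use v0 \<epsilon> in auto)
      have "(\<integral>y. max 0 (1 - v x y / \<epsilon>) \<partial>M) = 0"
        using True by (intro antisym) (auto simp: degenerate_def)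
      then have "AE y in M. max 0 (1 - v x y / \<epsilon>) = 0"
        using integral_nonneg_eq_0_iff_AE[OF i] by auto
      then show ?thesis
      proof eventually_elim
        case (elim y)
        then have "1 - v x y / \<epsilon> \<le> 0" by (auto simp: max_def split: if_splits)
        then show ?case using \<epsilon> by (simp add: field_simps)
      qed
    qed simp
    then show "AE x in M. AE y in M. case (x, y) of (x, y) \<Rightarrow> x \<in> degenerate v \<epsilon> \<longrightarrow> \<epsilon> \<le> v x y" by simp
  qed
  assume "measure M (degenerate v \<epsilon>) = 0"
  then have "AE x in M. x \<notin> degenerate v \<epsilon>"
    using AE_iff_measurable[OF Zm, of "\<lambda>x. x \<notin> degenerate v \<epsilon>"] by (simp add: space_UNIV emeasure_eq_measure)
  then show "AE x in M. 0 < (\<integral>y. max 0 (1 - v x y / \<epsilon>) \<partial>M)"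
    by (auto simp: degenerate_def not_le)
qed

lemma limit_kernel_integrable_diff:
  assumes "limit_kernel F w v" "folner_sequence G F"
    and wm: "(\<lambda>(x, y). w x y) \<in> borel_measurable (M \<Otimes>\<^sub>M M)"
    and w0: "\<And>x y. 0 \<le> w x y" and wB: "\<And>x y. w x y \<le> B"
  shows "integrable (M \<Otimes>\<^sub>M M) (\<lambda>(x, y). averaged \<phi> w (F n) x y)"
    "integrable (M \<Otimes>\<^sub>M M) (\<lambda>(x, y). v x y)"
    "integrable (M \<Otimes>\<^sub>M M) (\<lambda>(x, y). \<bar>averaged \<phi> w (F n) x y - v x y\<bar>)"
proof -
  have F: "finite (F n)" "F n \<noteq> {}" "F n \<subseteq> carrier G" using assms(2) by (auto simp: folner_sequence_def)
  show 1: "integrable (M \<Otimes>\<^sub>M M) (\<lambda>(x, y). averaged \<phi> w (F n) x y)"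
    by (rule pair_integrable_bounded[OF averaged_measurable[OF F(3) wm], of B])
       (use averaged_bounds[OF F(1,2), of w B] w0 wB in auto)
  obtain B' where "\<And>x y. v x y \<le> B'" using assms(1) by (auto simp: limit_kernel_def)
  then show 2: "integrable (M \<Otimes>\<^sub>M M) (\<lambda>(x, y). v x y)"
    using assms(1) by (intro pair_integrable_bounded[of v B']) (auto simp: limit_kernel_def)
  show "integrable (M \<Otimes>\<^sub>M M) (\<lambda>(x, y). \<bar>averaged \<phi> w (F n) x y - v x y\<bar>)"
    using integrable_abs[OF Bochner_Integration.integrable_diff[OF 1 2]] by (simp add: case_prod_beta')
qed

text \<open>On a piece of diameter \<open>\<epsilon>/2\<close> inside the degenerate set the average and its limit differ by
  \<open>\<epsilon>/2\<close>; a bounded number of pieces occupies a fixed proportion of the square of that set.\<close>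

proposition bounded_complexity_nondegenerate:
  assumes F: "folner_sequence G F"
    and wm: "(\<lambda>(x, y). w x y) \<in> borel_measurable (M \<Otimes>\<^sub>M M)"
    and sw: "semimetric w" and wB: "\<And>x y. w x y \<le> B"
    and v: "limit_kernel F w v"
    and bc: "bounded_complexity M (\<lambda>n. averaged \<phi> w (F n))"
    and \<epsilon>: "\<epsilon> > 0"
  shows "AE x in M. 0 < (\<integral>y. max 0 (1 - v x y / \<epsilon>) \<partial>M)"
proof (rule degenerate(3)[OF v \<epsilon>], rule ccontr)
  let ?Q = "M \<Otimes>\<^sub>M M"
  define Z where "Z = degenerate v \<epsilon>"
  have Z [measurable]: "Z \<in> sets M" and ZAE: "AE (x, y) in ?Q. x \<in> Z \<longrightarrow> \<epsilon> \<le> v x y"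
    unfolding Z_def using degenerate(1,2)[OF v \<epsilon>] by auto
  assume "measure M (degenerate v \<epsilon>) \<noteq> 0"
  then have pos: "measure M Z > 0" using measure_nonneg[of M Z] unfolding Z_def by linarith
  have w0: "\<And>x y. 0 \<le> w x y" using sw by (simp add: semimetric_def)
  \<comment> \<open>Two points of one ball of radius \<open>\<epsilon>' / 2\<close> have averaged
    distance below \<open>\<epsilon> / 2\<close>, and the uncovered part takes at most half of
    \<open>Z\<close>.\<close>
  define \<epsilon>' where "\<epsilon>' = min (\<epsilon> / 2) (measure M Z / 2)"
  have \<epsilon>': "\<epsilon>' > 0" "\<epsilon>' \<le> \<epsilon> / 2" "\<epsilon>' \<le> measure M Z / 2" using \<epsilon> pos by (auto simp: \<epsilon>'_def)
  define c where "c = measure M Z / 2"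
  have c: "c > 0" using pos by (simp add: c_def)
  obtain K where K: "\<And>n. complexity M (averaged \<phi> w (F n)) \<epsilon>' \<le> enat K"
    using bc \<epsilon>'(1) unfolding bounded_complexity_def by blast
  have lower: "\<epsilon> / 2 * c\<^sup>2 \<le> real K * (\<integral>(x, y). \<bar>averaged \<phi> w (F n) x y - v x y\<bar> \<partial>?Q)" for n
  proof -
    let ?a = "averaged \<phi> w (F n)"
    have Fsub: "F n \<subseteq> carrier G" using F by (auto simp: folner_sequence_def)
    have sa: "semimetric ?a" by (rule semimetric_averaged[OF sw])
    have am: "(\<lambda>(x, y). ?a x y) \<in> borel_measurable ?Q" by (rule averaged_measurable[OF Fsub wm])
    obtain m x where m: "m \<le> K" and x: "measure M (\<Union>i\<in>{1..m}. semimetric_ball ?a (x i) (\<epsilon>' / 2)) > 1 - \<epsilon>'"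
      using K[of n] unfolding complexity_le_iff by blast
    define Ba where "Ba i = semimetric_ball ?a (x i) (\<epsilon>' / 2)" for i
    have Bam [measurable]: "Ba i \<in> sets M" for i
      using borel_measurable_less[OF section_measurable[OF am, of "x i"] borel_measurable_const, of "\<epsilon>' / 2"]
      by (simp add: Ba_def semimetric_ball_def space_UNIV)
    define P where "P i = (Ba i - (\<Union>j\<in>{1..<i}. Ba j)) \<inter> Z" for i
    have Pm [measurable]: "P i \<in> sets M" for i unfolding P_def by measurable
    have disj: "disjoint_family_on P {1..m}"
      unfolding disjoint_family_on_def
    proof (intro ballI impI)
      fix i j assume ij: "i \<in> {1..m}" "j \<in> {1..m}" "i \<noteq> j"
      then show "P i \<inter> P j = {}"
        by (cases "i < j") (force simp: P_def)+
    qed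
    have UP: "(\<Union>i\<in>{1..m}. P i) = (\<Union>i\<in>{1..m}. Ba i) \<inter> Z"
    proof (intro equalityI subsetI)
      fix y assume y: "y \<in> (\<Union>i\<in>{1..m}. Ba i) \<inter> Z"
      define i where "i = (LEAST i. 1 \<le> i \<and> y \<in> Ba i)"
      obtain i0 where i0: "1 \<le> i0" "i0 \<le> m" "y \<in> Ba i0" using y by auto
      have i: "1 \<le> i \<and> y \<in> Ba i" unfolding i_def by (rule LeastI[of _ i0]) (use i0 in simp)
      have le: "i \<le> i0" unfolding i_def by (rule Least_le) (use i0 in simp)
      have "y \<notin> Ba j" if "1 \<le> j" "j < i" for j
        using not_less_Least[of j "\<lambda>i. 1 \<le> i \<and> y \<in> Ba i"] that by (auto simp: i_def)
      then have "y \<in> P i" using i y by (auto simp: P_def)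
      then show "y \<in> (\<Union>i\<in>{1..m}. P i)" using i le i0 by auto
    qed (auto simp: P_def)
    have "(\<Sum>i\<in>{1..m}. measure M (P i)) = measure M (\<Union>i\<in>{1..m}. P i)"
      by (intro finite_measure_finite_Union[symmetric] disj) auto
    also have "\<dots> = measure M ((\<Union>i\<in>{1..m}. Ba i) \<inter> Z)" unfolding UP ..
    also have "\<dots> \<ge> measure M Z - \<epsilon>'"
    proof -
      have [measurable]: "(\<Union>i\<in>{1..m}. Ba i) \<in> sets M" by measurable
      have "measure M Z \<le> measure M (((\<Union>i\<in>{1..m}. Ba i) \<inter> Z) \<union> (space M - (\<Union>i\<in>{1..m}. Ba i)))"
        using space_UNIV by (intro finite_measure_mono sets.Un sets.Int sets.Diff sets.top Z) (blast, measurable)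
      also have "\<dots> \<le> measure M ((\<Union>i\<in>{1..m}. Ba i) \<inter> Z) + measure M (space M - (\<Union>i\<in>{1..m}. Ba i))"
        by (rule measure_Un_le) measurable
      also have "measure M (space M - (\<Union>i\<in>{1..m}. Ba i)) = 1 - measure M (\<Union>i\<in>{1..m}. Ba i)"
        by (rule prob_compl) measurable
      finally show ?thesis using x by (simp add: Ba_def)
    qed
    finally have "c \<le> (\<Sum>i\<in>{1..m}. measure M (P i))" using \<epsilon>'(3) by (simp add: c_def)
    then have "c\<^sup>2 \<le> (\<Sum>i\<in>{1..m}. measure M (P i))\<^sup>2" using c by (intro power_mono) auto
    \<comment> \<open>Cauchy-Schwarz over at most \<open>K\<close> pieces: the squares
      \<open>P i \<times> P i\<close> together have product measure at least
      \<open>c\<^sup>2 / K\<close>, a bound independent of \<open>n\<close>.\<close>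
    also have "\<dots> \<le> (\<Sum>i\<in>{1..m}. (measure M (P i))\<^sup>2) * real m"
      using Cauchy_Schwarz_ineq_sum[of "\<lambda>i. measure M (P i)" "\<lambda>i. 1" "{1..m}"] by simp
    also have "\<dots> \<le> (\<Sum>i\<in>{1..m}. (measure M (P i))\<^sup>2) * real K"
      using m by (intro mult_left_mono sum_nonneg) auto
    finally have cK: "c\<^sup>2 \<le> (\<Sum>i\<in>{1..m}. (measure M (P i))\<^sup>2) * real K" .
    have PPm [measurable]: "P i \<times> P i \<in> sets ?Q" for i by measurable
    have Pi_: "integrable ?Q (indicator (P i \<times> P i) :: _ \<Rightarrow> real)" for i
      by (rule PP.integrable_const_bound[where B=1]) auto
    have "\<epsilon> / 2 * (\<Sum>i\<in>{1..m}. (measure M (P i))\<^sup>2) = (\<integral>z. (\<Sum>i\<in>{1..m}. \<epsilon> / 2 * indicator (P i \<times> P i) z) \<partial>?Q)"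
      using Pi_ by (simp add: measure_square sum_distrib_left)
    also have "\<dots> \<le> (\<integral>(x, y). \<bar>?a x y - v x y\<bar> \<partial>?Q)"
    proof (rule integral_mono_AE)
      show "integrable ?Q (\<lambda>z. \<Sum>i\<in>{1..m}. \<epsilon> / 2 * indicator (P i \<times> P i) z)" using Pi_ by auto
      show "integrable ?Q (\<lambda>(x, y). \<bar>?a x y - v x y\<bar>)"
        by (rule limit_kernel_integrable_diff[OF v F wm w0 wB])
      show "AE z in ?Q. (\<Sum>i\<in>{1..m}. \<epsilon> / 2 * indicator (P i \<times> P i) z) \<le> (case z of (x, y) \<Rightarrow> \<bar>?a x y - v x y\<bar>)"
        using ZAE
      proof eventually_elim
        fix z :: "'x \<times> 'x" assume z: "case z of (x, y) \<Rightarrow> x \<in> Z \<longrightarrow> \<epsilon> \<le> v x y"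
        obtain y1 y2 where zy: "z = (y1, y2)" by force
        show "(\<Sum>i\<in>{1..m}. \<epsilon> / 2 * indicator (P i \<times> P i) z) \<le> (case z of (x, y) \<Rightarrow> \<bar>?a x y - v x y\<bar>)"
        proof (cases "\<exists>i\<in>{1..m}. z \<in> P i \<times> P i")
          case False
          then have "(\<Sum>i\<in>{1..m}. \<epsilon> / 2 * indicator (P i \<times> P i) z) = (\<Sum>i\<in>{1..m}. 0 :: real)"
            by (intro sum.cong refl) auto
          then show ?thesis by (simp add: zy)
        next
          case True
          then obtain i where i: "i \<in> {1..m}" "y1 \<in> P i" "y2 \<in> P i" by (auto simp: zy)
          have "(\<Sum>j\<in>{1..m}. \<epsilon> / 2 * indicator (P j \<times> P j) z) = (\<Sum>j\<in>{1..m}. if j = i then \<epsilon> / 2 else 0)"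
          proof (intro sum.cong refl)
            fix j assume j: "j \<in> {1..m}"
            show "\<epsilon> / 2 * indicator (P j \<times> P j) z = (if j = i then \<epsilon> / 2 else 0)"
            proof (cases "j = i")
              case False
              then have "P j \<inter> P i = {}" using disjoint_family_onD[OF disj j i(1)] by simp
              then have "y1 \<notin> P j" using i(2) by blast
              then show ?thesis using False by (simp add: zy)
            qed (use i in \<open>simp add: zy\<close>)
          qed
          also have "\<dots> = \<epsilon> / 2" using i by simp
          also have "\<dots> \<le> v y1 y2 - ?a y1 y2"
          proof -
            have "\<epsilon> \<le> v y1 y2" using z i by (auto simp: zy P_def)
            moreover have "?a y1 y2 \<le> ?a (x i) y1 + ?a (x i) y2"
              using sa unfolding semimetric_def by metis
            moreover have "?a (x i) y1 < \<epsilon>' / 2" "?a (x i) y2 < \<epsilon>' / 2"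
              using i by (auto simp: P_def Ba_def semimetric_ball_def)
            ultimately show ?thesis using \<epsilon>'(2) by linarith
          qed
          finally show ?thesis by (simp add: zy)
        qed
      qed
    qed
    finally have "\<epsilon> / 2 * (\<Sum>i\<in>{1..m}. (measure M (P i))\<^sup>2) * real K \<le> (\<integral>(x, y). \<bar>?a x y - v x y\<bar> \<partial>?Q) * real K"
      by (rule mult_right_mono) simp
    moreover have "\<epsilon> / 2 * c\<^sup>2 \<le> \<epsilon> / 2 * ((\<Sum>i\<in>{1..m}. (measure M (P i))\<^sup>2) * real K)"
      using cK \<epsilon> by (intro mult_left_mono) auto
    ultimately show ?thesis by (simp add: mult_ac)
  qed
  have "\<epsilon> / 2 * c\<^sup>2 \<le> 0"
  proof (rule LIMSEQ_le_const)
    show "(\<lambda>n. real K * (\<integral>(x, y). \<bar>averaged \<phi> w (F n) x y - v x y\<bar> \<partial>?Q)) \<longlonglongrightarrow> 0"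
      using v tendsto_mult_left[of _ 0 sequentially "real K"] by (auto simp: limit_kernel_def)
  qed (use lower in blast)
  moreover have "0 < \<epsilon> / 2 * c\<^sup>2" using c \<epsilon> by simp
  ultimately show False by linarith
qed

text \<open>On the part of a piece inside the degenerate set, \<open>v\<close> is at least
  \<epsilon> for almost all pairs although the averages are eventually below
  \<open>\<epsilon> / 2\<close>. Comparing the integrals over the square of this part shows that it
  is null.\<close>

proposition asymptotically_close_nondegenerate:
  assumes F: "folner_sequence G F"
    and wm: "(\<lambda>(x, y). w x y) \<in> borel_measurable (M \<Otimes>\<^sub>M M)"
    and w0: "\<And>x y. 0 \<le> w x y" and wB: "\<And>x y. w x y \<le> B"
    and v: "limit_kernel F w v" and \<epsilon>: "\<epsilon> > 0"
    and close: "\<And>\<tau>. \<tau> > 0 \<Longrightarrow> \<exists>\<P>. finite \<P> \<and> \<P> \<subseteq> sets M \<and> measure M (\<Union>\<P>) > 1 - \<tau> \<and>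
      (\<forall>P\<in>\<P>. \<forall>x\<in>P. \<forall>y\<in>P. limsup (\<lambda>n. ereal (averaged \<phi> w (F n) x y)) < ereal (\<epsilon> / 2))"
  shows "AE x in M. 0 < (\<integral>y. max 0 (1 - v x y / \<epsilon>) \<partial>M)"
proof (rule degenerate(3)[OF v \<epsilon>])
  let ?Q = "M \<Otimes>\<^sub>M M"
  define Z where "Z = degenerate v \<epsilon>"
  have Z [measurable]: "Z \<in> sets M" and ZAE: "AE (x, y) in ?Q. x \<in> Z \<longrightarrow> \<epsilon> \<le> v x y"
    unfolding Z_def using degenerate(1,2)[OF v \<epsilon>] by auto
  have Fn: "finite (F n)" "F n \<noteq> {}" "F n \<subseteq> carrier G" for n using F by (auto simp: folner_sequence_def)
  note ints = limit_kernel_integrable_diff[OF v F wm w0 wB]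
  have B0: "0 \<le> B" using w0[of undefined undefined] wB[of undefined undefined] by linarith
  have null: "measure M (P \<inter> Z) = 0"
    if P: "P \<in> sets M" and cl: "\<forall>x\<in>P. \<forall>y\<in>P. limsup (\<lambda>n. ereal (averaged \<phi> w (F n) x y)) < ereal (\<epsilon> / 2)" for P
  proof -
    define R where "R = P \<inter> Z"
    have R [measurable]: "R \<in> sets M" using P by (simp add: R_def)
    have RR [measurable]: "R \<times> R \<in> sets ?Q" by measurable
    have am [measurable]: "(\<lambda>(x, y). averaged \<phi> w (F n) x y) \<in> borel_measurable ?Q" for n
      by (rule averaged_measurable[OF Fn(3) wm])
    \<comment> \<open>The averages are not known to converge at a point, but on
      \<open>R \<times> R\<close> their maximum with \<open>\<epsilon> / 2\<close> is eventually
      constant, so dominated convergence applies.\<close>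
    define q where "q n z = indicator (R \<times> R) z * max (\<epsilon> / 2) (case z of (x, y) \<Rightarrow> averaged \<phi> w (F n) x y)" for n z
    have qm [measurable]: "q n \<in> borel_measurable ?Q" for n unfolding q_def by measurable
    have qB: "\<bar>q n z\<bar> \<le> max (\<epsilon> / 2) B" for n z
    proof -
      obtain x y where z: "z = (x, y)" by force
      have "averaged \<phi> w (F n) x y \<le> B"
        by (rule averaged_bounds(2)[OF Fn(1,2) w0 wB])
      then have "max (\<epsilon> / 2) (averaged \<phi> w (F n) x y) \<le> max (\<epsilon> / 2) B" by (intro max.mono) auto
      then show ?thesis using \<epsilon> by (auto simp: q_def z indicator_def)
    qed
    have qi: "integrable ?Q (q n)" for n
      by (rule PP.integrable_const_bound[where B="max (\<epsilon> / 2) B"]) (use qB in auto)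
    have Ri: "integrable ?Q (\<lambda>z. indicator (R \<times> R) z * c)" for c :: real
      by (rule PP.integrable_const_bound[where B="\<bar>c\<bar>"]) (auto simp: indicator_def)
    have "(\<lambda>n. \<integral>z. q n z \<partial>?Q) \<longlonglongrightarrow> (\<integral>z. indicator (R \<times> R) z * (\<epsilon> / 2) \<partial>?Q)"
    proof (rule integral_dominated_convergence[where w="\<lambda>_. max (\<epsilon> / 2) B"])
      show "AE z in ?Q. (\<lambda>n. q n z) \<longlonglongrightarrow> indicator (R \<times> R) z * (\<epsilon> / 2)"
      proof (rule AE_I2)
        fix z :: "'x \<times> 'x"
        obtain x y where z: "z = (x, y)" by force
        show "(\<lambda>n. q n z) \<longlonglongrightarrow> indicator (R \<times> R) z * (\<epsilon> / 2)"
        proof (cases "z \<in> R \<times> R")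
          case True
          then have "limsup (\<lambda>n. ereal (averaged \<phi> w (F n) x y)) < ereal (\<epsilon> / 2)"
            using cl by (auto simp: z R_def)
          then have "\<forall>\<^sub>F n in sequentially. ereal (averaged \<phi> w (F n) x y) < ereal (\<epsilon> / 2)"
            by (rule Limsup_lessD)
          then have "\<forall>\<^sub>F n in sequentially. q n z = indicator (R \<times> R) z * (\<epsilon> / 2)"
            by eventually_elim (auto simp: q_def z max_def)
          then show ?thesis by (rule tendsto_eventually)
        qed (simp add: q_def)
      qed
    qed (use qB in \<open>auto simp: q_def\<close>)
    then have lim: "(\<lambda>n. (\<integral>z. q n z \<partial>?Q) + (\<integral>(x, y). \<bar>averaged \<phi> w (F n) x y - v x y\<bar> \<partial>?Q))
        \<longlonglongrightarrow> (measure M R)\<^sup>2 * (\<epsilon> / 2) + 0"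
      using v by (intro tendsto_add) (auto simp: limit_kernel_def measure_square)
    have "(measure M R)\<^sup>2 * \<epsilon> \<le> (measure M R)\<^sup>2 * (\<epsilon> / 2) + 0"
    proof (rule LIMSEQ_le_const[OF lim], intro exI allI impI)
      fix n
      have "(measure M R)\<^sup>2 * \<epsilon> = (\<integral>z. indicator (R \<times> R) z * \<epsilon> \<partial>?Q)" by (simp add: measure_square)
      also have "\<dots> \<le> (\<integral>z. q n z + (case z of (x, y) \<Rightarrow> \<bar>averaged \<phi> w (F n) x y - v x y\<bar>) \<partial>?Q)"
      proof (rule integral_mono_AE[OF Ri])
        show "integrable ?Q (\<lambda>z. q n z + (case z of (x, y) \<Rightarrow> \<bar>averaged \<phi> w (F n) x y - v x y\<bar>))"
          using qi ints(3) by auto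
        show "AE z in ?Q. indicator (R \<times> R) z * \<epsilon> \<le> q n z + (case z of (x, y) \<Rightarrow> \<bar>averaged \<phi> w (F n) x y - v x y\<bar>)"
          using ZAE
        proof eventually_elim
          fix z :: "'x \<times> 'x" assume z: "case z of (x, y) \<Rightarrow> x \<in> Z \<longrightarrow> \<epsilon> \<le> v x y"
          obtain x y where zy: "z = (x, y)" by force
          show "indicator (R \<times> R) z * \<epsilon> \<le> q n z + (case z of (x, y) \<Rightarrow> \<bar>averaged \<phi> w (F n) x y - v x y\<bar>)"
          proof (cases "z \<in> R \<times> R")
            case True
            then have "\<epsilon> \<le> v x y" using z by (auto simp: zy R_def)
            moreover have "averaged \<phi> w (F n) x y \<le> q n z" using True by (simp add: q_def zy)
            ultimately show ?thesis using True by (simp add: zy)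
          qed (auto simp: zy q_def)
        qed
      qed
      also have "\<dots> = (\<integral>z. q n z \<partial>?Q) + (\<integral>(x, y). \<bar>averaged \<phi> w (F n) x y - v x y\<bar> \<partial>?Q)"
        using qi ints(3) by simp
      finally show "(measure M R)\<^sup>2 * \<epsilon> \<le> (\<integral>z. q n z \<partial>?Q) + (\<integral>(x, y). \<bar>averaged \<phi> w (F n) x y - v x y\<bar> \<partial>?Q)" .
    qed
    then have "(measure M R)\<^sup>2 * \<epsilon> \<le> 0" by (simp add: mult.commute)
    then have "(measure M R)\<^sup>2 \<le> 0" using \<epsilon> by (simp add: mult_le_0_iff)
    then show ?thesis by (simp add: R_def)
  qed
  have "measure M Z \<le> \<tau>" if \<tau>: "\<tau> > 0" for \<tau>
  proof -
    obtain \<P> where \<P>: "finite \<P>" "\<P> \<subseteq> sets M" "measure M (\<Union>\<P>) > 1 - \<tau>"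
      "\<forall>P\<in>\<P>. \<forall>x\<in>P. \<forall>y\<in>P. limsup (\<lambda>n. ereal (averaged \<phi> w (F n) x y)) < ereal (\<epsilon> / 2)"
      using close[OF \<tau>] by blast
    have Um [measurable]: "\<Union>\<P> \<in> sets M" using \<P> by (intro sets.finite_Union) auto
    have "measure M Z \<le> measure M ((\<Union>P\<in>\<P>. P \<inter> Z) \<union> (space M - \<Union>\<P>))"
      using \<P>(2) by (intro finite_measure_mono sets.Un sets.finite_UN \<P>(1) sets.compl_sets Um) (auto simp: space_UNIV)
    also have "\<dots> \<le> measure M (\<Union>P\<in>\<P>. P \<inter> Z) + measure M (space M - \<Union>\<P>)"
      using \<P>(2) by (intro measure_Un_le sets.finite_UN \<P>(1) sets.compl_sets Um) auto
    also have "measure M (\<Union>P\<in>\<P>. P \<inter> Z) \<le> (\<Sum>P\<in>\<P>. measure M (P \<inter> Z))"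
      using \<P>(2) by (intro finite_measure_subadditive_finite \<P>(1)) auto
    also have "\<dots> = 0" using null \<P>(2,4) by (intro sum.neutral) auto
    also have "measure M (space M - \<Union>\<P>) = 1 - measure M (\<Union>\<P>)" by (rule prob_compl) measurable
    finally show ?thesis using \<P>(3) by linarith
  qed
  then have "measure M Z \<le> 0" by (rule field_le_epsilon[where y=0, simplified])
  then show "measure M (degenerate v \<epsilon>) = 0" by (simp add: Z_def measure_le_0_iff)
qed

text \<open>Simple functions dominated by \<open>2 * norm (h x)\<close> converge to
  \<open>h\<close>. They are combinations of indicators, so passing to the limit gives
  \<open>ip M h h = 0\<close>.\<close>

lemma orthogonal_to_indicators_zero:
  fixes h :: "'x \<Rightarrow> complex"
  assumes h: "h \<in> square_integrable M"
    and orth: "\<And>A c. A \<in> sets M \<Longrightarrow> ip M (\<lambda>x. indicator A x *\<^sub>R c) h = 0"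
  shows "AE x in M. h x = 0"
proof -
  have hm [measurable]: "h \<in> borel_measurable M" using h by auto
  obtain u where u': "\<forall>i. simple_function M (u i)" "\<forall>x\<in>space M. (\<lambda>i. u i x) \<longlonglongrightarrow> h x"
    "\<forall>i. \<forall>x\<in>space M. dist (u i x) 0 \<le> 2 * dist (h x) 0"
    using borel_measurable_implies_sequence_metric[OF hm, of 0] by blast
  have u: "simple_function M (u i)" "(\<lambda>i. u i x) \<longlonglongrightarrow> h x" "norm (u i x) \<le> 2 * norm (h x)" for i x
    using u' by (simp_all add: space_UNIV)
  have um [measurable]: "u i \<in> borel_measurable M" for i using u(1) by (rule borel_measurable_simple_function)
  have ui0: "ip M (u i) h = 0" for i
  proof -
    have fin: "finite (range (u i))" using simple_functionD(1)[OF u(1), of i] by (simp add: space_UNIV)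
    have A: "u i -` {c} \<in> sets M" for c using simple_functionD(2)[OF u(1), of i "{c}"] by (simp add: space_UNIV)
    have "u i = (\<lambda>x. \<Sum>c\<in>range (u i). indicator (u i -` {c}) x *\<^sub>R c)"
      by (rule ext, rule simple_function_indicator_representation_banach[OF u(1), unfolded space_UNIV Int_UNIV_right, OF UNIV_I])
    then have "ip M (u i) h = ip M (\<lambda>x. \<Sum>c\<in>range (u i). indicator (u i -` {c}) x *\<^sub>R c) h"
      by (rule arg_cong)
    also have "\<dots> = (\<Sum>c\<in>range (u i). ip M (\<lambda>x. indicator (u i -` {c}) x *\<^sub>R c) h)"
    proof (rule ip_sum_left[OF _ h])
      fix c
      show "(\<lambda>x. indicator (u i -` {c}) x *\<^sub>R c) \<in> square_integrable M"
        by (rule square_integrable_bounded[where B="norm c"]) (use A in \<open>auto simp: indicator_def\<close>)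
    qed
    also have "\<dots> = 0" using orth[OF A] by (intro sum.neutral) auto
    finally show ?thesis .
  qed
  have "(\<lambda>i. \<integral>x. u i x \<bullet> h x \<partial>M) \<longlonglongrightarrow> (\<integral>x. h x \<bullet> h x \<partial>M)"
  proof (rule integral_dominated_convergence[where w="\<lambda>x. 2 * (norm (h x))\<^sup>2"])
    show "integrable M (\<lambda>x. 2 * (norm (h x))\<^sup>2)" using integrable_norm_power2[OF h] by auto
    show "AE x in M. (\<lambda>i. u i x \<bullet> h x) \<longlonglongrightarrow> h x \<bullet> h x"
      by (intro AE_I2 tendsto_intros u(2))
    show "AE x in M. norm (u i x \<bullet> h x) \<le> 2 * (norm (h x))\<^sup>2" for i
    proof (rule AE_I2)
      fix x
      show "norm (u i x \<bullet> h x) \<le> 2 * (norm (h x))\<^sup>2"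
        using Cauchy_Schwarz_ineq2[of "u i x" "h x"] mult_right_mono[OF u(3)[of i x], of "norm (h x)"]
        by (simp add: power2_eq_square)
    qed
  qed measurable
  then have "ip M h h = 0" using ui0 by (simp add: ip_def LIMSEQ_const_iff)
  then have "nrm M h = 0" by (simp add: nrm_def)
  then show ?thesis by (rule nrm_eq_0_AE[OF h])
qed

end

section \<open>The maximal inequality for tempered Folner sequences\<close>

text \<open>A fractional version of the selection of disjoint translates in Lindenstrauss' covering
  lemma: levels are processed downwards, and \<open>a\<close> receives the weight
  \<open>max 0 (1 - W) / K (lev a)\<close>, where \<open>W\<close> is the weight of the sets of higher level meeting \<open>S a\<close>.\<close>

lemma fractional_packing:
  fixes lev :: "'a \<Rightarrow> nat" and S :: "'a \<Rightarrow> 'u set" and K :: "nat \<Rightarrow> real"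
  assumes fin: "finite B" and K: "\<And>n. K n > 0"
    and card: "\<And>u n. real (card {a \<in> B. lev a = n \<and> u \<in> S a}) \<le> K n"
  shows "\<exists>w :: 'a \<Rightarrow> real. (\<forall>a. 0 \<le> w a) \<and> (\<forall>u. (\<Sum>a\<in>{a \<in> B. u \<in> S a}. w a) \<le> 1) \<and>
    (\<forall>a\<in>B. 1 \<le> K (lev a) * w a + (\<Sum>b\<in>{b \<in> B. lev a < lev b \<and> S a \<inter> S b \<noteq> {}}. w b))"
proof -
  \<comment> \<open>The claim restricted to levels at least \<open>n\<close>, for a downward
    induction that starts above all levels of \<open>B\<close>.\<close>
  define Q where "Q n \<longleftrightarrow> (\<exists>w :: 'a \<Rightarrow> real. (\<forall>a. 0 \<le> w a) \<and>
    (\<forall>u. (\<Sum>a\<in>{a \<in> B. n \<le> lev a \<and> u \<in> S a}. w a) \<le> 1) \<and>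
    (\<forall>a\<in>B. n \<le> lev a \<longrightarrow> 1 \<le> K (lev a) * w a + (\<Sum>b\<in>{b \<in> B. lev a < lev b \<and> S a \<inter> S b \<noteq> {}}. w b)))" for n
  define N where "N = Suc (Max (lev ` B \<union> {0}))"
  have N: "lev a < N" if "a \<in> B" for a
    using fin that by (auto simp: N_def less_Suc_eq_le intro: Max_ge)
  have "Q 0"
  proof (rule inc_induct[of 0 N Q])
    show "Q N"
      unfolding Q_def
    proof (intro exI conjI allI ballI impI)
      fix u
      have "{a \<in> B. N \<le> lev a \<and> u \<in> S a} = {}" using N by fastforce
      then show "(\<Sum>a\<in>{a \<in> B. N \<le> lev a \<and> u \<in> S a}. 0 :: real) \<le> 1" by simp
    next
      fix a assume "a \<in> B" "N \<le> lev a"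
      then have False using N[of a] by simp
      then show "1 \<le> K (lev a) * 0 + (\<Sum>b\<in>{b \<in> B. lev a < lev b \<and> S a \<inter> S b \<noteq> {}}. 0 :: real)" ..
    qed simp
  next
    fix n assume "Q (Suc n)"
    then obtain w :: "'a \<Rightarrow> real" where w0: "\<And>a. 0 \<le> w a"
      and w1: "\<And>u. (\<Sum>a\<in>{a \<in> B. Suc n \<le> lev a \<and> u \<in> S a}. w a) \<le> 1"
      and w2: "\<And>a. a \<in> B \<Longrightarrow> Suc n \<le> lev a \<Longrightarrow>
        1 \<le> K (lev a) * w a + (\<Sum>b\<in>{b \<in> B. lev a < lev b \<and> S a \<inter> S b \<noteq> {}}. w b)"
      by (auto simp: Q_def)
    define W where "W a = (\<Sum>b\<in>{b \<in> B. lev a < lev b \<and> S a \<inter> S b \<noteq> {}}. w b)" for a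
    define w' where "w' a = (if lev a = n then max 0 (1 - W a) / K n else w a)" for a
    have w'W: "(\<Sum>b\<in>{b \<in> B. lev a < lev b \<and> S a \<inter> S b \<noteq> {}}. w' b) = W a" if "n \<le> lev a" for a
      unfolding W_def by (intro sum.cong refl) (use that in \<open>auto simp: w'_def\<close>)
    show "Q n"
      unfolding Q_def
    proof (intro exI conjI allI ballI impI)
      show "0 \<le> w' a" for a using K[of n] w0 by (simp add: w'_def)
      show "1 \<le> K (lev a) * w' a + (\<Sum>b\<in>{b \<in> B. lev a < lev b \<and> S a \<inter> S b \<noteq> {}}. w' b)"
        if a: "a \<in> B" "n \<le> lev a" for a
      proof (cases "lev a = n")
        case True
        then show ?thesis using K[of n] w'W[OF a(2)] by (simp add: w'_def)
      next
        case False
        then show ?thesis using w2[OF a(1)] a(2) w'W[OF a(2)] by (simp add: w'_def W_def)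
      qed
      fix u
      define \<Lambda> where "\<Lambda> = (\<Sum>a\<in>{a \<in> B. Suc n \<le> lev a \<and> u \<in> S a}. w a)"
      have \<Lambda>1: "\<Lambda> \<le> 1" using w1 by (simp add: \<Lambda>_def)
      have split: "{a \<in> B. n \<le> lev a \<and> u \<in> S a} = {a \<in> B. lev a = n \<and> u \<in> S a} \<union> {a \<in> B. Suc n \<le> lev a \<and> u \<in> S a}"
        by auto
      have "(\<Sum>a\<in>{a \<in> B. n \<le> lev a \<and> u \<in> S a}. w' a)
          = (\<Sum>a\<in>{a \<in> B. lev a = n \<and> u \<in> S a}. w' a) + (\<Sum>a\<in>{a \<in> B. Suc n \<le> lev a \<and> u \<in> S a}. w' a)"
        unfolding split by (rule sum.union_disjoint) (use fin in auto)
      also have "(\<Sum>a\<in>{a \<in> B. Suc n \<le> lev a \<and> u \<in> S a}. w' a) = \<Lambda>"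
        unfolding \<Lambda>_def by (intro sum.cong refl) (auto simp: w'_def)
      also have "(\<Sum>a\<in>{a \<in> B. lev a = n \<and> u \<in> S a}. w' a) \<le> real (card {a \<in> B. lev a = n \<and> u \<in> S a}) * ((1 - \<Lambda>) / K n)"
      proof (rule sum_bounded_above)
        fix a assume a: "a \<in> {a \<in> B. lev a = n \<and> u \<in> S a}"
        \<comment> \<open>Every higher set containing \<open>u\<close> meets \<open>S a\<close>,
          because \<open>u\<close> lies in \<open>S a\<close>. Thus at most \<open>K n\<close> sets
          of level \<open>n\<close> share the room \<open>1 - \<Lambda>\<close> left at
          \<open>u\<close>.\<close>
        have "\<Lambda> \<le> W a"
          unfolding \<Lambda>_def W_def by (rule sum_mono2) (use fin a w0 in auto)
        then show "w' a \<le> (1 - \<Lambda>) / K n"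
          using a \<Lambda>1 K[of n] by (auto simp: w'_def intro!: divide_right_mono)
      qed
      also have "\<dots> \<le> K n * ((1 - \<Lambda>) / K n)"
        using \<Lambda>1 K[of n] by (intro mult_right_mono card) auto
      also have "\<dots> = 1 - \<Lambda>" using K[of n] by simp
      finally show "(\<Sum>a\<in>{a \<in> B. n \<le> lev a \<and> u \<in> S a}. w' a) \<le> 1" by simp
    qed
  qed simp
  then show ?thesis by (simp add: Q_def)
qed

section \<open>From packing on the group to the maximal inequality\<close>

context measure_preserving_action
begin

text \<open>The inequality on the group, along the orbit of \<open>x\<close> and for times in the
  window \<Omega>. Each bad time \<open>a\<close> selects a scale \<open>lev a\<close> and the right
  translate \<open>S a\<close> of \<open>F (lev a)\<close>. When the packing inequalities are summed
  over bad times, temperedness bounds the part coming from intersecting translates by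
  \<open>C\<close> times the main term, whence \<open>1 + C\<close>.\<close>

lemma transferred_maximal_inequality:
  fixes f :: "'x \<Rightarrow> real" and F :: "nat \<Rightarrow> 'g set"
  assumes F: "\<And>n. finite (F n)" "\<And>n. F n \<noteq> {}" "\<And>n. F n \<subseteq> carrier G"
    and C: "\<And>n. real (card (\<Union>k<n. set_inv (F k) <#> F n)) \<le> C * real (card (F n))"
    and f0: "\<And>x. 0 \<le> f x" and lam: "\<theta> > 0" and \<Omega>: "finite \<Omega>" "\<Omega> \<subseteq> carrier G"
  shows "\<theta> * real (card {a \<in> \<Omega>. \<exists>n<N. \<theta> < avg (F n) f (\<phi> a x)})
    \<le> (1 + C) * (\<Sum>u\<in>((\<Union>n<N. F n) <#> \<Omega>). f (\<phi> u x))"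
proof -
  define B where "B = {a \<in> \<Omega>. \<exists>n<N. \<theta> < avg (F n) f (\<phi> a x)}"
  define D where "D = (\<Union>n<N. F n) <#> \<Omega>"
  have finB: "finite B" using \<Omega> by (simp add: B_def)
  have Bc: "a \<in> carrier G" if "a \<in> B" for a using \<Omega>(2) that by (auto simp: B_def)
  have finD: "finite D" unfolding D_def set_mult_def by (intro finite_UN_I F(1) \<Omega>(1) finite_lessThan) auto
  define lev where "lev a = (SOME n. n < N \<and> \<theta> < avg (F n) f (\<phi> a x))" for a
  have lev: "lev a < N" "\<theta> < avg (F (lev a)) f (\<phi> a x)" if "a \<in> B" for a
  proof -
    have "\<exists>n. n < N \<and> \<theta> < avg (F n) f (\<phi> a x)" using that by (auto simp: B_def)
    from someI_ex[OF this] show "lev a < N" "\<theta> < avg (F (lev a)) f (\<phi> a x)" by (auto simp: lev_def)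
  qed
  define S where "S a = (\<lambda>g. g \<otimes> a) ` F (lev a)" for a
  define K where "K n = real (card (F n))" for n
  have K: "K n > 0" for n using F(1,2)[of n] by (simp add: K_def card_gt_0_iff)
  have SD: "S a \<subseteq> D" if "a \<in> B" for a
    using lev(1)[OF that] that by (auto simp: S_def D_def set_mult_def B_def)
  \<comment> \<open>If \<open>u = g \<otimes> a\<close>, then \<open>u \<otimes> inv a\<close> is
    the element \<open>g\<close> of \<open>F n\<close>, and it determines \<open>a\<close>.\<close>
  have cardK: "real (card {a \<in> B. lev a = n \<and> u \<in> S a}) \<le> K n" for u n
  proof -
    have "card {a \<in> B. lev a = n \<and> u \<in> S a} \<le> card (F n)"
    proof (rule card_inj_on_le[where f="\<lambda>a. u \<otimes> inv a"])
      show "inj_on (\<lambda>a. u \<otimes> inv a) {a \<in> B. lev a = n \<and> u \<in> S a}"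
      proof (rule inj_onI)
        fix a a' assume a: "a \<in> {a \<in> B. lev a = n \<and> u \<in> S a}" "a' \<in> {a \<in> B. lev a = n \<and> u \<in> S a}"
          and eq: "u \<otimes> inv a = u \<otimes> inv a'"
        have ac: "a \<in> carrier G" "a' \<in> carrier G" using a Bc by auto
        have "u \<in> carrier G" using a ac F(3)[of n] by (auto simp: S_def)
        then have "inv a = inv a'" using eq ac by simp
        then show "a = a'" using ac by (metis inv_inv)
      qed
      show "(\<lambda>a. u \<otimes> inv a) ` {a \<in> B. lev a = n \<and> u \<in> S a} \<subseteq> F n"
      proof
        fix y assume "y \<in> (\<lambda>a. u \<otimes> inv a) ` {a \<in> B. lev a = n \<and> u \<in> S a}"
        then obtain a g where a: "a \<in> B" "g \<in> F n" "y = (g \<otimes> a) \<otimes> inv a" by (auto simp: S_def)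
        have "g \<in> carrier G" using a F(3)[of n] by auto
        then have "y = g" using a Bc[OF a(1)] by (simp add: m_assoc)
        then show "y \<in> F n" using a by simp
      qed
    qed (rule F)
    then show ?thesis by (simp add: K_def)
  qed
  \<comment> \<open>If \<open>g \<otimes> a = g' \<otimes> b\<close>, then
    \<open>a \<otimes> inv b = inv g \<otimes> g'\<close> lies in the set whose size temperedness
    controls; the strict order of levels matches \<open>k < n\<close> there.\<close>
  have meet: "real (card {a \<in> B. lev a < lev b \<and> S a \<inter> S b \<noteq> {}}) \<le> C * K (lev b)" if b: "b \<in> B" for b
  proof -
    let ?U = "\<Union>k<lev b. set_inv (F k) <#> F (lev b)"
    have "card {a \<in> B. lev a < lev b \<and> S a \<inter> S b \<noteq> {}} \<le> card ?U"
    proof (rule card_inj_on_le[where f="\<lambda>a. a \<otimes> inv b"])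
      show "inj_on (\<lambda>a. a \<otimes> inv b) {a \<in> B. lev a < lev b \<and> S a \<inter> S b \<noteq> {}}"
        using Bc b by (auto intro!: inj_onI)
      show "(\<lambda>a. a \<otimes> inv b) ` {a \<in> B. lev a < lev b \<and> S a \<inter> S b \<noteq> {}} \<subseteq> ?U"
      proof
        fix y assume "y \<in> (\<lambda>a. a \<otimes> inv b) ` {a \<in> B. lev a < lev b \<and> S a \<inter> S b \<noteq> {}}"
        then obtain a g g' where a: "a \<in> B" "lev a < lev b" "g \<in> F (lev a)" "g' \<in> F (lev b)"
          "g \<otimes> a = g' \<otimes> b" "y = a \<otimes> inv b" by (auto simp: S_def)
        have c: "g \<in> carrier G" "g' \<in> carrier G" "a \<in> carrier G" "b \<in> carrier G"
          using a F(3) Bc b by auto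
        have "a = inv g \<otimes> (g \<otimes> a)" using c by (simp add: m_assoc[symmetric])
        also have "\<dots> = inv g \<otimes> (g' \<otimes> b)" using a by simp
        finally have "y = inv g \<otimes> g'" using a(6) c by (simp add: m_assoc)
        then show "y \<in> ?U" using a by (auto simp: set_mult_def SET_INV_def)
      qed
      show "finite ?U" using F(1) by (auto simp: set_mult_def SET_INV_def)
    qed
    then show ?thesis using C[of "lev b"] by (simp add: K_def)
  qed
  obtain w :: "'g \<Rightarrow> real" where w0: "\<And>a. 0 \<le> w a" and w1: "\<And>u. (\<Sum>a\<in>{a \<in> B. u \<in> S a}. w a) \<le> 1"
    and w2: "\<And>a. a \<in> B \<Longrightarrow> 1 \<le> K (lev a) * w a + (\<Sum>b\<in>{b \<in> B. lev a < lev b \<and> S a \<inter> S b \<noteq> {}}. w b)"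
    using fractional_packing[OF finB K cardK] by blast
  have C0: "0 \<le> 1 + C"
  proof -
    have "0 \<le> C * real (card (F 0))" using C[of 0] by simp
    then have "0 \<le> C" using K[of 0] by (simp add: K_def zero_le_mult_iff)
    then show ?thesis by simp
  qed
  have "real (card B) = (\<Sum>a\<in>B. 1)" by simp
  also have "\<dots> \<le> (\<Sum>a\<in>B. K (lev a) * w a + (\<Sum>b\<in>{b \<in> B. lev a < lev b \<and> S a \<inter> S b \<noteq> {}}. w b))"
    by (intro sum_mono w2)
  \<comment> \<open>The double sum is regrouped by the set \<open>b\<close> of higher level, for
    which \<open>meet\<close> counts the lower translates meeting it.\<close>
  also have "\<dots> = (\<Sum>a\<in>B. K (lev a) * w a) + (\<Sum>b\<in>B. \<Sum>a\<in>{a \<in> B. lev a < lev b \<and> S a \<inter> S b \<noteq> {}}. w b)"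
    unfolding sum.distrib by (simp add: sum.swap_restrict[OF finB finB])
  also have "(\<Sum>b\<in>B. \<Sum>a\<in>{a \<in> B. lev a < lev b \<and> S a \<inter> S b \<noteq> {}}. w b)
      = (\<Sum>b\<in>B. real (card {a \<in> B. lev a < lev b \<and> S a \<inter> S b \<noteq> {}}) * w b)" by simp
  also have "\<dots> \<le> (\<Sum>b\<in>B. (C * K (lev b)) * w b)"
    by (intro sum_mono mult_right_mono meet w0)
  finally have cB: "real (card B) \<le> (1 + C) * (\<Sum>b\<in>B. K (lev b) * w b)"
    by (simp add: sum_distrib_left algebra_simps sum.distrib)
  have "\<theta> * (\<Sum>b\<in>B. K (lev b) * w b) = (\<Sum>b\<in>B. w b * (\<theta> * K (lev b)))"
    by (simp add: sum_distrib_left mult_ac)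
  also have "\<dots> \<le> (\<Sum>b\<in>B. w b * (\<Sum>u\<in>S b. f (\<phi> u x)))"
  proof (intro sum_mono mult_left_mono w0)
    fix b assume b: "b \<in> B"
    have "inj_on (\<lambda>g. g \<otimes> b) (F (lev b))"
      using Bc[OF b] F(3)[of "lev b"] by (auto intro!: inj_onI simp: subset_iff)
    then have "(\<Sum>u\<in>S b. f (\<phi> u x)) = (\<Sum>g\<in>F (lev b). f (\<phi> (g \<otimes> b) x))"
      by (simp add: S_def sum.reindex)
    also have "\<dots> = (\<Sum>g\<in>F (lev b). f (\<phi> g (\<phi> b x)))"
      using Bc[OF b] F(3)[of "lev b"] by (intro sum.cong refl) (auto simp: action_mult)
    finally have "(\<Sum>u\<in>S b. f (\<phi> u x)) = K (lev b) * avg (F (lev b)) f (\<phi> b x)"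
      using K[of "lev b"] by (simp add: avg_def K_def)
    then show "\<theta> * K (lev b) \<le> (\<Sum>u\<in>S b. f (\<phi> u x))"
      using lev(2)[OF b] K[of "lev b"] by (simp add: mult.commute)
  qed
  also have "\<dots> = (\<Sum>b\<in>B. \<Sum>u\<in>{u \<in> D. u \<in> S b}. w b * f (\<phi> u x))"
  proof (intro sum.cong refl)
    fix b assume "b \<in> B"
    then have "{u \<in> D. u \<in> S b} = S b" using SD by auto
    then show "w b * (\<Sum>u\<in>S b. f (\<phi> u x)) = (\<Sum>u\<in>{u \<in> D. u \<in> S b}. w b * f (\<phi> u x))"
      by (simp add: sum_distrib_left)
  qed
  \<comment> \<open>After this exchange each point \<open>u\<close> of \<open>D\<close> carries
    total weight at most 1.\<close>
  also have "\<dots> = (\<Sum>u\<in>D. \<Sum>b\<in>{b \<in> B. u \<in> S b}. w b * f (\<phi> u x))"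
    by (rule sum.swap_restrict[OF finB finD])
  also have "\<dots> = (\<Sum>u\<in>D. (\<Sum>b\<in>{b \<in> B. u \<in> S b}. w b) * f (\<phi> u x))"
    by (simp add: sum_distrib_right)
  also have "\<dots> \<le> (\<Sum>u\<in>D. 1 * f (\<phi> u x))"
    by (intro sum_mono mult_right_mono w1 f0)
  finally have wf: "\<theta> * (\<Sum>b\<in>B. K (lev b) * w b) \<le> (\<Sum>u\<in>D. f (\<phi> u x))" by simp
  have "\<theta> * real (card B) \<le> (1 + C) * (\<theta> * (\<Sum>b\<in>B. K (lev b) * w b))"
    using mult_left_mono[OF cB, of \<theta>] lam by (simp add: mult_ac)
  also have "\<dots> \<le> (1 + C) * (\<Sum>u\<in>D. f (\<phi> u x))"
    by (intro mult_left_mono wf C0)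
  finally show ?thesis by (simp add: B_def D_def)
qed

text \<open>Transference: the inequality on the group is integrated over the space with window
  \<open>F m\<close>. By invariance the left side becomes \<open>\<theta>\<close> times
  \<open>card (F m) * measure M (E N)\<close> and the right side a multiple of
  \<open>card D\<close>; the ratio of \<open>card D\<close> to \<open>card (F m)\<close> is at most
  \<open>q m\<close>, which tends to 1 by the Folner condition.\<close>

proposition maximal_inequality:
  fixes f :: "'x \<Rightarrow> real"
  assumes F: "folner_sequence G F"
    and C: "\<And>n. real (card (\<Union>k<n. set_inv (F k) <#> F n)) \<le> C * real (card (F n))"
    and fi: "integrable M f" and f0: "\<And>x. 0 \<le> f x" and lam: "\<theta> > 0"
  shows "\<theta> * measure M {x. \<exists>n. \<theta> < avg (F n) f x} \<le> (1 + C) * (\<integral>x. f x \<partial>M)"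
proof -
  have Fn: "finite (F n)" "F n \<noteq> {}" "F n \<subseteq> carrier G" for n using F by (auto simp: folner_sequence_def)
  have [measurable]: "f \<in> borel_measurable M" using fi by auto
  have am [measurable]: "avg (F n) f \<in> borel_measurable M" for n by (rule avg_measurable[OF Fn(3)]) measurable
  \<comment> \<open>Only finitely many scales at a time, so that \<open>H\<close> is a finite set,
    under which \<open>F m\<close> is asymptotically invariant.\<close>
  define E where "E N = {x. \<exists>n<N. \<theta> < avg (F n) f x}" for N
  have Em [measurable]: "E N \<in> sets M" for N
  proof -
    have "{x \<in> space M. \<exists>n\<in>{..<N}. \<theta> < avg (F n) f x} \<in> sets M" by measurable
    then show ?thesis by (simp add: E_def space_UNIV Bex_def)
  qed
  have EN: "\<theta> * measure M (E N) \<le> (1 + C) * (\<integral>x. f x \<partial>M)" for N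
  proof -
    define H where "H = (\<Union>n<N. F n)"
    have H: "finite H" "H \<subseteq> carrier G" using Fn by (auto simp: H_def)
    define q where "q m = 1 + (\<Sum>g\<in>H. real (card (sym_diff (g <# F m) (F m))) / real (card (F m)))" for m
    have qlim: "q \<longlonglongrightarrow> 1 + (\<Sum>g\<in>H. 0)"
      unfolding q_def[abs_def] by (intro tendsto_intros) (use F H(2) in \<open>auto simp: folner_sequence_def\<close>)
    have le: "\<theta> * measure M (E N) \<le> (1 + C) * (\<integral>x. f x \<partial>M) * q m" for m
    proof -
      let ?\<Omega> = "F m"
      define D where "D = H <#> ?\<Omega>"
      have finD: "finite D" using H Fn(1) by (auto simp: D_def set_mult_def)
      have Dc: "D \<subseteq> carrier G" using H(2) Fn(3)[of m] by (auto simp: D_def set_mult_def)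
      have cpos: "real (card ?\<Omega>) > 0" using Fn(1,2)[of m] by (simp add: card_gt_0_iff)
      have ii: "integrable M (\<lambda>x. indicator (E N) (\<phi> a x) :: real)" if "a \<in> ?\<Omega>" for a
        by (rule integrable_action) (use that Fn(3)[of m] in \<open>auto intro!: integrable_const_bound[where B=1]\<close>)
      have fiu: "integrable M (\<lambda>x. f (\<phi> u x))" if "u \<in> D" for u
        by (rule integrable_action[OF _ fi]) (use that Dc in auto)
      have "\<theta> * (real (card ?\<Omega>) * measure M (E N)) = (\<integral>x. \<theta> * (\<Sum>a\<in>?\<Omega>. indicator (E N) (\<phi> a x)) \<partial>M)"
      proof -
        have "(\<integral>x. indicator (E N) (\<phi> a x) \<partial>M) = measure M (E N)" if "a \<in> ?\<Omega>" for a
          using integral_action[of a "indicator (E N) :: 'x \<Rightarrow> real"] that Fn(3)[of m] by (auto simp: space_UNIV)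
        then show ?thesis using ii by simp
      qed
      also have "\<dots> \<le> (\<integral>x. (1 + C) * (\<Sum>u\<in>D. f (\<phi> u x)) \<partial>M)"
      proof (rule integral_mono)
        show "integrable M (\<lambda>x. \<theta> * (\<Sum>a\<in>?\<Omega>. indicator (E N) (\<phi> a x) :: real))" using ii by auto
        show "integrable M (\<lambda>x. (1 + C) * (\<Sum>u\<in>D. f (\<phi> u x)))" using fiu by auto
        fix x
        have "(\<Sum>a\<in>?\<Omega>. indicator (E N) (\<phi> a x) :: real) = real (card {a \<in> ?\<Omega>. \<exists>n<N. \<theta> < avg (F n) f (\<phi> a x)})"
          using Fn(1)[of m] by (simp add: indicator_def E_def sum.If_cases Collect_conj_eq)
        then show "\<theta> * (\<Sum>a\<in>?\<Omega>. indicator (E N) (\<phi> a x)) \<le> (1 + C) * (\<Sum>u\<in>D. f (\<phi> u x))"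
          using transferred_maximal_inequality[OF Fn C f0 lam Fn(1,3), where x=x and N=N]
          by (simp add: D_def H_def)
      qed
      also have "\<dots> = (1 + C) * (\<Sum>u\<in>D. (\<integral>x. f (\<phi> u x) \<partial>M))" using fiu by simp
      also have "(\<Sum>u\<in>D. (\<integral>x. f (\<phi> u x) \<partial>M)) = (\<Sum>u\<in>D. (\<integral>x. f x \<partial>M))"
        by (intro sum.cong refl integral_action) (use Dc in auto)
      also have "(1 + C) * \<dots> = (1 + C) * (\<integral>x. f x \<partial>M) * real (card D)" by simp
      also have "\<dots> \<le> (1 + C) * (\<integral>x. f x \<partial>M) * (real (card ?\<Omega>) * q m)"
      proof (intro mult_left_mono mult_nonneg_nonneg)
        have "D \<subseteq> ?\<Omega> \<union> (\<Union>g\<in>H. sym_diff (g <# ?\<Omega>) ?\<Omega>)"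
          by (auto simp: D_def set_mult_def l_coset_def)
        then have "card D \<le> card (?\<Omega> \<union> (\<Union>g\<in>H. sym_diff (g <# ?\<Omega>) ?\<Omega>))"
          using H(1) Fn(1)[of m] by (intro card_mono) (auto simp: l_coset_def)
        also have "\<dots> \<le> card ?\<Omega> + card (\<Union>g\<in>H. sym_diff (g <# ?\<Omega>) ?\<Omega>)" by (rule card_Un_le)
        also have "\<dots> \<le> card ?\<Omega> + (\<Sum>g\<in>H. card (sym_diff (g <# ?\<Omega>) ?\<Omega>))"
          using card_UN_le[OF H(1), of "\<lambda>g. sym_diff (g <# ?\<Omega>) ?\<Omega>"] by simp
        finally have "real (card D) \<le> real (card ?\<Omega>) + (\<Sum>g\<in>H. real (card (sym_diff (g <# ?\<Omega>) ?\<Omega>)))"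
          by (metis (mono_tags) of_nat_add of_nat_le_iff of_nat_sum)
        also have "\<dots> = real (card ?\<Omega>) * q m"
          using cpos by (simp add: q_def sum_distrib_left distrib_left)
        finally show "real (card D) \<le> real (card ?\<Omega>) * q m" .
        have "0 \<le> C * real (card (F 0))" using C[of 0] by simp
        then show "0 \<le> 1 + C" using Fn(1,2)[of 0] by (simp add: zero_le_mult_iff card_gt_0_iff)
        show "0 \<le> (\<integral>x. f x \<partial>M)" using f0 by simp
      qed
      finally have "real (card ?\<Omega>) * (\<theta> * measure M (E N)) \<le> real (card ?\<Omega>) * ((1 + C) * (\<integral>x. f x \<partial>M) * q m)"
        by (simp add: mult_ac)
      then show ?thesis using cpos by simp
    qed
    have "(\<lambda>m. (1 + C) * (\<integral>x. f x \<partial>M) * q m) \<longlonglongrightarrow> (1 + C) * (\<integral>x. f x \<partial>M) * 1"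
      using qlim by (intro tendsto_mult tendsto_const) simp
    from LIMSEQ_le_const[OF this] le show ?thesis by (metis mult.right_neutral)
  qed
  have "(\<lambda>N. measure M (E N)) \<longlonglongrightarrow> measure M (\<Union>N. E N)"
  proof (rule finite_Lim_measure_incseq)
    show "range E \<subseteq> sets M" using Em by auto
    show "incseq E" by (auto simp: incseq_def E_def intro: less_le_trans)
  qed
  from LIMSEQ_le_const2[OF tendsto_mult_left[OF this, of \<theta>]] EN
  have "\<theta> * measure M (\<Union>N. E N) \<le> (1 + C) * (\<integral>x. f x \<partial>M)" by blast
  moreover have "(\<Union>N. E N) = {x. \<exists>n. \<theta> < avg (F n) f x}" by (auto simp: E_def)
  ultimately show ?thesis by simp
qed

end

section \<open>Consequences of discrete spectrum\<close>

lemma spanned_AE_real_subspace: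
  assumes E: "orthonormal M E"
  shows "real_subspace M {f \<in> square_integrable M. spanned_AE M E f}"
proof -
  have EL: "\<And>e. e \<in> E \<Longrightarrow> e \<in> square_integrable M" using E by (auto simp: orthonormal_def)
  have "spanned_AE M E (\<lambda>x. f x + g x)"
    if "f \<in> square_integrable M" "g \<in> square_integrable M" "spanned_AE M E f" "spanned_AE M E g" for f g
  proof -
    have eq: "(\<Sum>e\<in>E. ip M (\<lambda>x. f x + g x) e *\<^sub>R e x) = (\<Sum>e\<in>E. ip M f e *\<^sub>R e x) + (\<Sum>e\<in>E. ip M g e *\<^sub>R e x)" for x
      using that(1,2) EL by (simp add: ip_add_left scaleR_add_left sum.distrib)
    from that(3,4) show ?thesis unfolding spanned_AE_def eq by eventually_elim simp
  qed
  moreover have "spanned_AE M E (\<lambda>x. c *\<^sub>R f x)" if "spanned_AE M E f" for c f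
  proof -
    have eq: "(\<Sum>e\<in>E. ip M (\<lambda>x. c *\<^sub>R f x) e *\<^sub>R e x) = c *\<^sub>R (\<Sum>e\<in>E. ip M f e *\<^sub>R e x)" for x
      by (simp add: ip_scaleR_left scaleR_sum_right)
    from that show ?thesis unfolding spanned_AE_def eq by eventually_elim simp
  qed
  moreover have "spanned_AE M E (\<lambda>x. 0)" by (simp add: spanned_AE_def)
  ultimately show ?thesis
    by (auto simp: real_subspace_def square_integrable_add square_integrable_scaleR)
qed

lemma spanned_AE_cong:
  assumes "f \<in> square_integrable M" "g \<in> square_integrable M" "orthonormal M E"
    "AE x in M. f x = g x" "spanned_AE M E f"
  shows "spanned_AE M E g"
proof -
  have "ip M f e = ip M g e" if "e \<in> E" for e
    by (intro ip_AE_cong assms) (use assms(3,4) that in \<open>auto simp: orthonormal_def\<close>)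
  then have "(\<Sum>e\<in>E. ip M g e *\<^sub>R e x) = (\<Sum>e\<in>E. ip M f e *\<^sub>R e x)" for x by simp
  then show ?thesis
    using assms(4,5) unfolding spanned_AE_def by (auto elim!: eventually_elim2)
qed

text \<open>A complex spanning set \<open>B\<close> and its multiples by \<open>\<i>\<close>
  together span over the reals, where Gram-Schmidt is available.\<close>

lemma l2_finite_dimensional_orthonormal:
  assumes V: "l2_subspace M V" and fd: "l2_finite_dimensional M V"
  shows "\<exists>E. orthonormal M E \<and> E \<subseteq> V \<and> (\<forall>f\<in>V. spanned_AE M E f)"
proof -
  have rs: "real_subspace M V" by (rule l2_subspace_imp_real_subspace[OF V])
  obtain B where B: "finite B" "B \<subseteq> V" "\<And>f. f \<in> V \<Longrightarrow> \<exists>c. AE x in M. f x = (\<Sum>b\<in>B. c b * b x)"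
    using fd by (auto simp: l2_finite_dimensional_def)
  define B' where "B' = B \<union> (\<lambda>b x. \<i> * b x) ` B"
  have "finite B'" "B' \<subseteq> V" using B(1,2) V by (auto simp: B'_def l2_subspace_def)
  from gram_schmidt[OF rs this] obtain E where E: "orthonormal M E" "E \<subseteq> V" "\<forall>b\<in>B'. spanned_AE M E b" by blast
  define SP where "SP = {f \<in> square_integrable M. spanned_AE M E f}"
  have SPs: "real_subspace M SP" unfolding SP_def by (rule spanned_AE_real_subspace[OF E(1)])
  have BL: "b \<in> square_integrable M" if "b \<in> B'" for b
    using that \<open>B' \<subseteq> V\<close> rs by (auto simp: real_subspace_def)
  have "spanned_AE M E f" if f: "f \<in> V" for f
  proof -
    obtain c where c: "AE x in M. f x = (\<Sum>b\<in>B. c b * b x)" using B(3)[OF f] by blast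
    define p where "p = (\<lambda>x. (\<Sum>b\<in>B. Re (c b) *\<^sub>R b x) + (\<Sum>b\<in>B. Im (c b) *\<^sub>R (\<i> * b x)))"
    have "(\<lambda>x. \<Sum>b\<in>B. Re (c b) *\<^sub>R b x) \<in> SP"
      by (rule real_subspace_sum[OF SPs]) (use BL E(3) in \<open>auto simp: SP_def B'_def\<close>)
    moreover have "(\<lambda>x. \<Sum>b\<in>B. Im (c b) *\<^sub>R (\<lambda>x. \<i> * b x) x) \<in> SP"
      by (rule real_subspace_sum[OF SPs]) (use BL E(3) in \<open>auto simp: SP_def B'_def\<close>)
    ultimately have "p \<in> SP" using SPs unfolding real_subspace_def p_def by simp
    moreover have "p x = (\<Sum>b\<in>B. c b * b x)" for x
      unfolding p_def sum.distrib[symmetric]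
    proof (intro sum.cong refl)
      fix b
      have "Re (c b) *\<^sub>R b x + Im (c b) *\<^sub>R (\<i> * b x) = (of_real (Re (c b)) + \<i> * of_real (Im (c b))) * b x"
        by (simp add: scaleR_conv_of_real algebra_simps)
      then show "Re (c b) *\<^sub>R b x + Im (c b) *\<^sub>R (\<i> * b x) = c b * b x" by (simp add: complex_eq[symmetric])
    qed
    ultimately show ?thesis
      using c f rs by (intro spanned_AE_cong[of p M f E] E(1)) (auto simp: SP_def real_subspace_def)
  qed
  with E show ?thesis by blast
qed

text \<open>By induction, the pieces for \<open>E\<close> are cut by the preimages under
  \<open>e\<close> of small discs around a countable dense set, made disjoint. The functions may be
  unbounded, so only finitely many discs are kept and a set of small measure is given up.\<close>

lemma (in prob_space) small_oscillation_partition: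
  fixes E :: "('a \<Rightarrow> complex) set"
  assumes "finite E" "E \<subseteq> borel_measurable M" "\<epsilon> > 0" "\<eta> > 0"
  shows "\<exists>\<P>. finite \<P> \<and> \<P> \<subseteq> sets M \<and> disjoint \<P> \<and> measure M (\<Union>\<P>) > 1 - \<eta> \<and>
    (\<forall>P\<in>\<P>. \<forall>x\<in>P. \<forall>y\<in>P. (\<Sum>e\<in>E. norm (e x - e y)) < \<epsilon>)"
  using assms
proof (induction E arbitrary: \<epsilon> \<eta> rule: finite_induct)
  case empty
  then show ?case
    by (intro exI[of _ "{space M}"]) (simp add: prob_space)
next
  case (insert e E)
  have em [measurable]: "e \<in> borel_measurable M" using insert.prems by auto
  obtain \<P> where P: "finite \<P>" "\<P> \<subseteq> sets M" "disjoint \<P>" "measure M (\<Union>\<P>) > 1 - \<eta> / 2"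
    "\<forall>P\<in>\<P>. \<forall>x\<in>P. \<forall>y\<in>P. (\<Sum>e\<in>E. norm (e x - e y)) < \<epsilon> / 2"
    using insert.IH[of "\<epsilon> / 2" "\<eta> / 2"] insert.prems by auto
  obtain D :: "complex set" where D: "countable D" "\<And>X. open X \<Longrightarrow> X \<noteq> {} \<Longrightarrow> \<exists>d\<in>D. d \<in> X"
    by (erule countable_dense_setE)
  have Dne: "D \<noteq> {}" using D(2)[of UNIV] by auto
  define A where "A n = {x \<in> space M. dist (from_nat_into D n) (e x) < \<epsilon> / 4}" for n
  have Am [measurable]: "A n \<in> sets M" for n unfolding A_def by measurable
  have cover: "(\<Union>n. A n) = space M"
  proof
    show "space M \<subseteq> (\<Union>n. A n)"
    proof
      fix x assume x: "x \<in> space M"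
      obtain d where d: "d \<in> D" "d \<in> ball (e x) (\<epsilon> / 4)" using D(2)[of "ball (e x) (\<epsilon> / 4)"] insert.prems by auto
      then obtain n where "from_nat_into D n = d" using from_nat_into_surj[OF D(1)] by blast
      with d x show "x \<in> (\<Union>n. A n)" by (auto simp: A_def dist_commute)
    qed
  qed (auto simp: A_def)
  define Dj where "Dj = disjointed A"
  have Djm [measurable]: "Dj n \<in> sets M" for n
    unfolding Dj_def disjointed_def by measurable
  have U: "(\<Union>n. \<Union>i<n. Dj i) = space M"
  proof -
    have "(\<Union>n. \<Union>i<n. Dj i) = (\<Union>n. Dj n)" by auto
    then show ?thesis using UN_disjointed_eq[of A] cover by (simp add: Dj_def)
  qed
  have "(\<lambda>n. measure M (\<Union>i<n. Dj i)) \<longlonglongrightarrow> measure M (\<Union>n. \<Union>i<n. Dj i)"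
    by (rule finite_Lim_measure_incseq) (auto simp: incseq_def intro: less_le_trans)
  then have "\<forall>\<^sub>F n in sequentially. measure M (\<Union>i<n. Dj i) > 1 - \<eta> / 2"
    using insert.prems unfolding U prob_space by (intro order_tendstoD(1)) auto
  then obtain n where n: "measure M (\<Union>i<n. Dj i) > 1 - \<eta> / 2" using eventually_happens by fastforce
  define R where "R = Dj ` {..<n}"
  have R: "finite R" "R \<subseteq> sets M" "measure M (\<Union>R) > 1 - \<eta> / 2" using n by (auto simp: R_def)
  have Rd: "disjoint R"
    unfolding R_def Dj_def
    by (rule disjoint_family_on_disjoint_image) (use disjoint_family_disjointed[of A] in \<open>auto simp: disjoint_family_on_def\<close>)
  have Ro: "norm (e x - e y) < \<epsilon> / 2" if Q: "Q \<in> R" "x \<in> Q" "y \<in> Q" for Q x y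
  proof -
    obtain i where i: "Q = Dj i" using Q by (auto simp: R_def)
    have "x \<in> A i" "y \<in> A i" using Q i disjointed_subset[of A i] by (auto simp: Dj_def)
    then have "dist (from_nat_into D i) (e x) < \<epsilon> / 4" "dist (from_nat_into D i) (e y) < \<epsilon> / 4" by (auto simp: A_def)
    then have "dist (e x) (e y) < \<epsilon> / 2" using dist_triangle3[of "e x" "e y" "from_nat_into D i"] by linarith
    then show ?thesis by (simp add: dist_norm)
  qed
  define \<R> where "\<R> = (\<lambda>(P, Q). P \<inter> Q) ` (\<P> \<times> R)"
  have fin: "finite \<R>" using P(1) R(1) by (simp add: \<R>_def)
  have sub: "\<R> \<subseteq> sets M" using P(2) R(2) by (auto simp: \<R>_def)
  have "disjoint \<R>"
    unfolding disjoint_def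
  proof (intro ballI impI)
    fix S S' assume S: "S \<in> \<R>" "S' \<in> \<R>" "S \<noteq> S'"
    then obtain P1 Q1 P2 Q2 where *: "S = P1 \<inter> Q1" "S' = P2 \<inter> Q2" "P1 \<in> \<P>" "P2 \<in> \<P>" "Q1 \<in> R" "Q2 \<in> R"
      by (auto simp: \<R>_def)
    with S(3) have "P1 \<noteq> P2 \<or> Q1 \<noteq> Q2" by auto
    then have "P1 \<inter> P2 = {} \<or> Q1 \<inter> Q2 = {}" using P(3) Rd *(3-6) unfolding disjoint_def by meson
    then show "S \<inter> S' = {}" using * by auto
  qed
  moreover have "measure M (\<Union>\<R>) > 1 - \<eta>"
  proof -
    have UP: "\<Union>\<P> \<in> sets M" and UR: "\<Union>R \<in> sets M" using P R by (auto intro: sets.finite_Union)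
    have "\<Union>\<R> = \<Union>\<P> \<inter> \<Union>R" by (auto simp: \<R>_def)
    moreover have "measure M (\<Union>\<P>) + measure M (\<Union>R) \<le> measure M (\<Union>\<P> \<inter> \<Union>R) + 1"
    proof -
      have "measure M (\<Union>\<P> \<union> \<Union>R) + measure M (\<Union>\<P> \<inter> \<Union>R) = measure M (\<Union>\<P>) + measure M (\<Union>R)"
        using finite_measure_Union'[OF UP UR] finite_measure_Diff'[OF UR UP] by (simp add: Int_commute)
      then show ?thesis using prob_le_1[of "\<Union>\<P> \<union> \<Union>R"] by linarith
    qed
    ultimately show ?thesis using P(4) R(3) by simp
  qed
  moreover have "\<forall>S\<in>\<R>. \<forall>x\<in>S. \<forall>y\<in>S. (\<Sum>e\<in>insert e E. norm (e x - e y)) < \<epsilon>"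
  proof (intro ballI)
    fix S x y assume "S \<in> \<R>" "x \<in> S" "y \<in> S"
    then obtain P1 Q1 where "P1 \<in> \<P>" "Q1 \<in> R" "x \<in> P1" "y \<in> P1" "x \<in> Q1" "y \<in> Q1" by (auto simp: \<R>_def)
    then have "(\<Sum>e\<in>E. norm (e x - e y)) < \<epsilon> / 2" "norm (e x - e y) < \<epsilon> / 2" using P(5) Ro by auto
    then show "(\<Sum>e\<in>insert e E. norm (e x - e y)) < \<epsilon>" using insert.hyps by simp
  qed
  ultimately show ?case using fin sub by blast
qed

section \<open>Almost periodic functions\<close>

context measure_preserving_action
begin

text \<open>Coefficient bounds replace orthonormality because, unlike orthonormal families, families
  of this kind are closed under union.\<close>

definition bounded_invariant :: "('x \<Rightarrow> complex) set \<Rightarrow> bool" where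
  "bounded_invariant E \<longleftrightarrow> finite E \<and> E \<subseteq> square_integrable M \<and>
     (\<forall>g\<in>carrier G. \<forall>e\<in>E. \<exists>a. (\<forall>e'\<in>E. \<bar>a e'\<bar> \<le> 1) \<and> (AE x in M. e (\<phi> g x) = (\<Sum>e'\<in>E. a e' *\<^sub>R e' x)))"

definition almost_periodic :: "('x \<Rightarrow> complex) set" where
  "almost_periodic = {f \<in> square_integrable M. \<exists>E c. bounded_invariant E \<and> (AE x in M. f x = (\<Sum>e\<in>E. c e * e x))}"

lemma bounded_invariant_Un:
  assumes A: "bounded_invariant A" and B: "bounded_invariant B"
  shows "bounded_invariant (A \<union> B)"
proof -
  have "\<exists>a. (\<forall>e'\<in>A \<union> B. \<bar>a e'\<bar> \<le> 1) \<and> (AE x in M. e (\<phi> g x) = (\<Sum>e'\<in>A \<union> B. a e' *\<^sub>R e' x))"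
    if g: "g \<in> carrier G" and e: "e \<in> E" and E: "E = A \<or> E = B" for g e E
  proof -
    have "bounded_invariant E" using A B E by auto
    then obtain a where a: "\<forall>e'\<in>E. \<bar>a e'\<bar> \<le> 1" "AE x in M. e (\<phi> g x) = (\<Sum>e'\<in>E. a e' *\<^sub>R e' x)"
      using g e unfolding bounded_invariant_def by blast
    define a' where "a' e' = (if e' \<in> E then a e' else 0)" for e'
    have "(\<Sum>e'\<in>A \<union> B. a' e' *\<^sub>R e' x) = (\<Sum>e'\<in>E. a e' *\<^sub>R e' x)" for x
    proof -
      have "(\<Sum>e'\<in>E. a' e' *\<^sub>R e' x) = (\<Sum>e'\<in>A \<union> B. a' e' *\<^sub>R e' x)"
        by (rule sum.mono_neutral_left) (use A B E in \<open>auto simp: bounded_invariant_def a'_def\<close>)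
      moreover have "(\<Sum>e'\<in>E. a' e' *\<^sub>R e' x) = (\<Sum>e'\<in>E. a e' *\<^sub>R e' x)"
        by (intro sum.cong refl) (simp add: a'_def)
      ultimately show ?thesis by simp
    qed
    with a show ?thesis by (intro exI[of _ a']) (auto simp: a'_def)
  qed
  then show ?thesis using A B by (auto simp: bounded_invariant_def)
qed

lemma almost_periodic_subspace: "l2_subspace M almost_periodic"
  unfolding l2_subspace_def l2_functions_eq
proof (intro conjI ballI allI impI)
  show "almost_periodic \<subseteq> square_integrable M" by (auto simp: almost_periodic_def)
  have "bounded_invariant {}" by (simp add: bounded_invariant_def)
  then show "(\<lambda>x. 0) \<in> almost_periodic"
    by (auto simp: almost_periodic_def intro!: exI[of _ "{}"])
  show "(\<lambda>x. c * f x) \<in> almost_periodic" if f: "f \<in> almost_periodic" for c f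
  proof -
    obtain E d where E: "bounded_invariant E" "AE x in M. f x = (\<Sum>e\<in>E. d e * e x)" using f unfolding almost_periodic_def by blast
    from E(2) have "AE x in M. c * f x = (\<Sum>e\<in>E. (c * d e) * e x)"
      by eventually_elim (simp add: sum_distrib_left mult.assoc)
    then show ?thesis using E(1) f unfolding almost_periodic_def
      by (auto intro!: square_integrable_cmult exI[of _ E] exI[of _ "\<lambda>e. c * d e"])
  qed
  show "h \<in> almost_periodic" if fh: "f \<in> almost_periodic" "h \<in> square_integrable M" "AE x in M. f x = h x" for f h
  proof -
    obtain E d where E: "bounded_invariant E" "AE x in M. f x = (\<Sum>e\<in>E. d e * e x)" using fh(1) unfolding almost_periodic_def by blast
    from E(2) fh(3) have "AE x in M. h x = (\<Sum>e\<in>E. d e * e x)" by eventually_elim simp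
    then show ?thesis using E(1) fh(2) by (auto simp: almost_periodic_def)
  qed
  show "(\<lambda>x. f x + h x) \<in> almost_periodic" if fh: "f \<in> almost_periodic" "h \<in> almost_periodic" for f h
  proof -
    obtain A c where A: "bounded_invariant A" "AE x in M. f x = (\<Sum>e\<in>A. c e * e x)" using fh(1) unfolding almost_periodic_def by blast
    obtain B d where B: "bounded_invariant B" "AE x in M. h x = (\<Sum>e\<in>B. d e * e x)" using fh(2) unfolding almost_periodic_def by blast
    have fin: "finite A" "finite B" using A(1) B(1) by (auto simp: bounded_invariant_def)
    define k where "k e = (if e \<in> A then c e else 0) + (if e \<in> B then d e else 0)" for e
    have s: "(\<Sum>e\<in>A \<union> B. (if e \<in> E then q e else 0) * e x) = (\<Sum>e\<in>E. q e * e x)"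
      if "E \<subseteq> A \<union> B" for E q and x
    proof -
      have "(\<Sum>e\<in>E. (if e \<in> E then q e else 0) * e x) = (\<Sum>e\<in>A \<union> B. (if e \<in> E then q e else 0) * e x)"
        by (rule sum.mono_neutral_left) (use fin that in auto)
      moreover have "(\<Sum>e\<in>E. (if e \<in> E then q e else 0) * e x) = (\<Sum>e\<in>E. q e * e x)"
        by (intro sum.cong refl) simp
      ultimately show ?thesis by simp
    qed
    have "AE x in M. f x + h x = (\<Sum>e\<in>A \<union> B. k e * e x)"
      using A(2) B(2)
    proof eventually_elim
      case (elim x)
      have "(\<Sum>e\<in>A \<union> B. k e * e x) = (\<Sum>e\<in>A. c e * e x) + (\<Sum>e\<in>B. d e * e x)"
        unfolding k_def distrib_right sum.distrib using s[of A c x] s[of B d x] by simp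
      with elim show ?case by simp
    qed
    then show ?thesis using bounded_invariant_Un[OF A(1) B(1)] fh
      by (auto simp: almost_periodic_def intro: square_integrable_add)
  qed
qed

text \<open>For an orthonormal basis the coefficients of a translate are inner products of unit
  vectors, because the action is isometric; hence the bound 1.\<close>

lemma finite_dimensional_almost_periodic:
  assumes V: "l2_subspace M V" and fd: "l2_finite_dimensional M V" and inv: "l2_invariant G \<phi> V"
  shows "V \<subseteq> almost_periodic"
proof -
  obtain E where E: "orthonormal M E" "E \<subseteq> V" "\<forall>f\<in>V. spanned_AE M E f"
    using l2_finite_dimensional_orthonormal[OF V fd] by blast
  have EL: "e \<in> square_integrable M" "nrm M e = 1" if "e \<in> E" for e
    using E(1) that by (auto simp: orthonormal_def nrm_def)
  have "bounded_invariant E"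
    unfolding bounded_invariant_def
  proof (intro conjI ballI)
    show "finite E" "E \<subseteq> square_integrable M" using E(1) by (auto simp: orthonormal_def)
    fix g e assume g: "g \<in> carrier G" and e: "e \<in> E"
    have eg: "(\<lambda>x. e (\<phi> g x)) \<in> square_integrable M" by (rule square_integrable_action[OF g EL(1)[OF e]])
    have "e \<circ> \<phi> g \<in> V" using inv g e E(2) by (auto simp: l2_invariant_def)
    then have "spanned_AE M E (\<lambda>x. e (\<phi> g x))" using E(3) by (auto simp: o_def)
    moreover have "\<bar>ip M (\<lambda>x. e (\<phi> g x)) e'\<bar> \<le> 1" if "e' \<in> E" for e'
      using ip_cauchy_schwarz[OF eg EL(1)[OF that]] nrm_action[OF g EL(1)[OF e]] EL(2)[OF e] EL(2)[OF that] by simp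
    ultimately show "\<exists>a. (\<forall>e'\<in>E. \<bar>a e'\<bar> \<le> 1) \<and> (AE x in M. e (\<phi> g x) = (\<Sum>e'\<in>E. a e' *\<^sub>R e' x))"
      unfolding spanned_AE_def by blast
  qed
  moreover have "AE x in M. f x = (\<Sum>e\<in>E. complex_of_real (ip M f e) * e x)" if "f \<in> V" for f
    using E(3) that by (simp add: spanned_AE_def scaleR_conv_of_real)
  moreover have "V \<subseteq> square_integrable M" using V by (auto simp: l2_subspace_def l2_functions_eq)
  ultimately show ?thesis by (force simp: almost_periodic_def)
qed

text \<open>The closure \<open>W\<close> of the almost periodic functions is a closed subspace
  containing all generators, so it contains the compact part.\<close>

lemma discrete_spectrum_approximation:
  assumes ds: "discrete_spectrum G \<phi> M" and f: "f \<in> square_integrable M" and e: "e > 0"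
  shows "\<exists>h\<in>almost_periodic. nrm M (\<lambda>x. f x - h x) < e"
proof -
  define W where "W = {f \<in> square_integrable M. \<forall>e>0. \<exists>h\<in>almost_periodic. nrm M (\<lambda>x. f x - h x) < e}"
  note ap = almost_periodic_subspace[unfolded l2_subspace_def l2_functions_eq]
  have apL: "h \<in> square_integrable M" if "h \<in> almost_periodic" for h using ap that by blast
  have sub: "almost_periodic \<subseteq> W"
    unfolding W_def using apL by (auto intro!: bexI[where x="_ :: 'x \<Rightarrow> complex"])
  have "l2_subspace M W"
    unfolding l2_subspace_def l2_functions_eq
  proof (intro conjI ballI allI impI)
    show "W \<subseteq> square_integrable M" by (auto simp: W_def)
    show "(\<lambda>x. 0) \<in> W" using sub ap by blast
    show "(\<lambda>x. f x + h x) \<in> W" if fh: "f \<in> W" "h \<in> W" for f h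
      unfolding W_def
    proof (intro CollectI conjI allI impI)
      have L: "f \<in> square_integrable M" "h \<in> square_integrable M" using fh by (auto simp: W_def)
      then show "(\<lambda>x. f x + h x) \<in> square_integrable M" by (rule square_integrable_add)
      fix e :: real assume "e > 0"
      then have e2: "e / 2 > 0" by simp
      obtain f' where f': "f' \<in> almost_periodic" "nrm M (\<lambda>x. f x - f' x) < e / 2" using fh(1) e2 unfolding W_def by blast
      obtain h' where h': "h' \<in> almost_periodic" "nrm M (\<lambda>x. h x - h' x) < e / 2" using fh(2) e2 unfolding W_def by blast
      have "nrm M (\<lambda>x. (f x - f' x) + (h x - h' x)) < e"
        using nrm_triangle[OF square_integrable_diff[OF L(1) apL[OF f'(1)]] square_integrable_diff[OF L(2) apL[OF h'(1)]]] f'(2) h'(2)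
        by linarith
      moreover have "(\<lambda>x. (f x - f' x) + (h x - h' x)) = (\<lambda>x. (f x + h x) - (f' x + h' x))" by auto
      ultimately show "\<exists>k\<in>almost_periodic. nrm M (\<lambda>x. (f x + h x) - k x) < e"
        using ap f'(1) h'(1) by (intro bexI[of _ "\<lambda>x. f' x + h' x"]) auto
    qed
    show "(\<lambda>x. c * f x) \<in> W" if f: "f \<in> W" for c f
      unfolding W_def
    proof (intro CollectI conjI allI impI)
      show "(\<lambda>x. c * f x) \<in> square_integrable M" using f by (auto simp: W_def intro: square_integrable_cmult)
      fix e :: real assume "e > 0"
      then have e2: "e / (norm c + 1) > 0" by (simp add: add_nonneg_pos)
      obtain f' where f': "f' \<in> almost_periodic" "nrm M (\<lambda>x. f x - f' x) < e / (norm c + 1)" using f e2 unfolding W_def by blast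
      have eq: "nrm M (\<lambda>x. c * f x - c * f' x) = norm c * nrm M (\<lambda>x. f x - f' x)"
        by (simp add: nrm_def ip_self norm_mult power_mult_distrib real_sqrt_mult flip: right_diff_distrib)
      have "norm c * nrm M (\<lambda>x. f x - f' x) \<le> (norm c + 1) * nrm M (\<lambda>x. f x - f' x)" by (intro mult_right_mono) auto
      also have "\<dots> < e" using f'(2) by (simp add: pos_less_divide_eq add_nonneg_pos mult.commute)
      finally show "\<exists>k\<in>almost_periodic. nrm M (\<lambda>x. c * f x - k x) < e"
        using ap f'(1) eq by (intro bexI[of _ "\<lambda>x. c * f' x"]) auto
    qed
    show "h \<in> W" if fh: "f \<in> W" "h \<in> square_integrable M" "AE x in M. f x = h x" for f h
      unfolding W_def
    proof (intro CollectI conjI allI impI fh(2))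
      fix e :: real assume "e > 0"
      then obtain f' where f': "f' \<in> almost_periodic" "nrm M (\<lambda>x. f x - f' x) < e" using fh(1) unfolding W_def by blast
      have "nrm M (\<lambda>x. f x - f' x) = nrm M (\<lambda>x. h x - f' x)"
        by (intro nrm_AE_cong square_integrable_diff fh(2) apL[OF f'(1)]) (use fh in \<open>auto simp: W_def elim: eventually_mono\<close>)
      with f' show "\<exists>k\<in>almost_periodic. nrm M (\<lambda>x. h x - k x) < e" by auto
    qed
  qed
  moreover have "l2_closed M W"
    unfolding l2_closed_def l2_functions_eq l2_norm_eq
  proof (intro ballI impI)
    fix f assume f: "f \<in> square_integrable M" and ap': "\<forall>e>0. \<exists>h\<in>W. nrm M (\<lambda>x. f x - h x) < e"
    have "\<exists>k\<in>almost_periodic. nrm M (\<lambda>x. f x - k x) < e" if "e > 0" for e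
    proof -
      have e2: "e / 2 > 0" using that by simp
      obtain h where h: "h \<in> W" "nrm M (\<lambda>x. f x - h x) < e / 2" using ap' e2 by blast
      obtain k where k: "k \<in> almost_periodic" "nrm M (\<lambda>x. h x - k x) < e / 2" using h(1) e2 unfolding W_def by blast
      have "h \<in> square_integrable M" using h(1) by (simp add: W_def)
      from nrm_diff_triangle[OF f this apL[OF k(1)]] h(2) k(2) have "nrm M (\<lambda>x. f x - k x) < e" by linarith
      with k(1) show ?thesis by blast
    qed
    then show "f \<in> W" using f by (simp add: W_def)
  qed
  ultimately have "compact_part G \<phi> M \<subseteq> W"
    unfolding compact_part_def
    by (intro Inter_lower) (use finite_dimensional_almost_periodic sub in blast)
  then have "f \<in> W" using ds f by (auto simp: discrete_spectrum_def l2_functions_eq)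
  then show ?thesis using e by (simp add: W_def)
qed


section \<open>Oscillation along orbits\<close>

text \<open>The error \<open>q\<close> is evaluated along the orbits and will be averaged; the
  oscillation of \<open>E\<close> is evaluated at the starting points and so does not depend on
  \<open>g\<close>. The condition \<open>P\<close> of full measure is likewise common to all
  \<open>g\<close>.\<close>

definition orbit_oscillation_bound ::
  "('x \<Rightarrow> 'x \<Rightarrow> real) \<Rightarrow> ('x \<Rightarrow> real) \<Rightarrow> ('x \<Rightarrow> complex) set \<Rightarrow> real \<Rightarrow> bool" where
  "orbit_oscillation_bound u q E C \<longleftrightarrow>
     (\<forall>x. 0 \<le> q x) \<and> integrable M q \<and> finite E \<and> E \<subseteq> borel_measurable M \<and> 0 \<le> C \<and>
     (\<exists>P. (AE x in M. P x) \<and> (\<forall>x y. \<forall>g\<in>carrier G. P x \<longrightarrow> P y \<longrightarrow>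
        u (\<phi> g x) (\<phi> g y) \<le> q (\<phi> g x) + q (\<phi> g y) + C * (\<Sum>e\<in>E. norm (e x - e y))))"

lemma orbit_oscillation_bound_add:
  assumes 1: "orbit_oscillation_bound u1 q1 E1 C1" and 2: "orbit_oscillation_bound u2 q2 E2 C2"
  shows "orbit_oscillation_bound (\<lambda>x y. u1 x y + u2 x y) (\<lambda>x. q1 x + q2 x) (E1 \<union> E2) (C1 + C2)"
proof -
  obtain P1 where P1: "AE x in M. P1 x" "\<And>x y g. g \<in> carrier G \<Longrightarrow> P1 x \<Longrightarrow> P1 y \<Longrightarrow>
        u1 (\<phi> g x) (\<phi> g y) \<le> q1 (\<phi> g x) + q1 (\<phi> g y) + C1 * (\<Sum>e\<in>E1. norm (e x - e y))"
    using 1 unfolding orbit_oscillation_bound_def by blast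
  obtain P2 where P2: "AE x in M. P2 x" "\<And>x y g. g \<in> carrier G \<Longrightarrow> P2 x \<Longrightarrow> P2 y \<Longrightarrow>
        u2 (\<phi> g x) (\<phi> g y) \<le> q2 (\<phi> g x) + q2 (\<phi> g y) + C2 * (\<Sum>e\<in>E2. norm (e x - e y))"
    using 2 unfolding orbit_oscillation_bound_def by blast
  have fin: "finite E1" "finite E2" and C: "0 \<le> C1" "0 \<le> C2"
    using 1 2 by (auto simp: orbit_oscillation_bound_def)
  have "u1 (\<phi> g x) (\<phi> g y) + u2 (\<phi> g x) (\<phi> g y) \<le> (q1 (\<phi> g x) + q2 (\<phi> g x)) + (q1 (\<phi> g y) + q2 (\<phi> g y))
      + (C1 + C2) * (\<Sum>e\<in>E1 \<union> E2. norm (e x - e y))"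
    if g: "g \<in> carrier G" and P: "P1 x \<and> P2 x" "P1 y \<and> P2 y" for x y g
  proof -
    have "(\<Sum>e\<in>E1. norm (e x - e y)) \<le> (\<Sum>e\<in>E1 \<union> E2. norm (e x - e y))"
      "(\<Sum>e\<in>E2. norm (e x - e y)) \<le> (\<Sum>e\<in>E1 \<union> E2. norm (e x - e y))"
      by (rule sum_mono2, use fin in auto)+
    from mult_left_mono[OF this(1) C(1)] mult_left_mono[OF this(2) C(2)]
    show ?thesis using P1(2)[OF g, of x y] P2(2)[OF g, of x y] P unfolding distrib_right by linarith
  qed
  moreover have "AE x in M. P1 x \<and> P2 x" using P1(1) P2(1) by auto
  ultimately have "\<exists>P. (AE x in M. P x) \<and> (\<forall>x y. \<forall>g\<in>carrier G. P x \<longrightarrow> P y \<longrightarrow>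
      u1 (\<phi> g x) (\<phi> g y) + u2 (\<phi> g x) (\<phi> g y) \<le> (q1 (\<phi> g x) + q2 (\<phi> g x)) + (q1 (\<phi> g y) + q2 (\<phi> g y))
      + (C1 + C2) * (\<Sum>e\<in>E1 \<union> E2. norm (e x - e y)))"
    by (intro exI[of _ "\<lambda>x. P1 x \<and> P2 x"]) blast
  with 1 2 show ?thesis unfolding orbit_oscillation_bound_def by auto
qed

text \<open>\<open>f\<close> is replaced by a combination \<open>h\<close> of a bounded invariant
  family \<open>E\<close>, at the cost of \<open>q\<close>. Each translate of a member of
  \<open>E\<close> is a combination of the members themselves with coefficients at most 1 in
  modulus, so its oscillation never exceeds the total oscillation at the starting points.\<close>

lemma orbit_oscillation_single:
  fixes f :: "'x \<Rightarrow> real"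
  assumes ds: "discrete_spectrum G \<phi> M"
    and fm [measurable]: "f \<in> borel_measurable M" and fB: "\<And>x. \<bar>f x\<bar> \<le> B" and \<eta>: "\<eta> > 0"
  shows "\<exists>q E C. orbit_oscillation_bound (\<lambda>x y. \<bar>f x - f y\<bar>) q E C \<and> (\<integral>x. q x \<partial>M) < \<eta>"
proof -
  have fL: "(\<lambda>x. complex_of_real (f x)) \<in> square_integrable M"
    by (rule square_integrable_bounded[where B=B]) (use fB in auto)
  obtain h0 where h0: "h0 \<in> almost_periodic" "nrm M (\<lambda>x. complex_of_real (f x) - h0 x) < \<eta>"
    using discrete_spectrum_approximation[OF ds fL \<eta>] by blast
  obtain E c where E: "bounded_invariant E" "AE x in M. h0 x = (\<Sum>e\<in>E. c e * e x)"
    using h0(1) unfolding almost_periodic_def by blast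
  have fin: "finite E" and EL: "\<And>e. e \<in> E \<Longrightarrow> e \<in> square_integrable M"
    using E(1) by (auto simp: bounded_invariant_def)
  \<comment> \<open>A representative of \<open>h0\<close> given by the formula at every point, so
    that differences can be computed without exceptions.\<close>
  define h where "h = (\<lambda>x. \<Sum>e\<in>E. c e * e x)"
  have hL: "h \<in> square_integrable M"
    unfolding h_def by (intro square_integrable_sum square_integrable_cmult EL)
  define q where "q x = norm (complex_of_real (f x) - h x)" for x
  have dL: "(\<lambda>x. complex_of_real (f x) - h x) \<in> square_integrable M"
    by (rule square_integrable_diff[OF fL hL])
  have qi: "integrable M q" unfolding q_def[abs_def]
    by (rule integrable_norm[OF square_integrable_imp_integrable_norm[OF dL]])
  have "(\<integral>x. q x \<partial>M) \<le> nrm M (\<lambda>x. complex_of_real (f x) - h x)"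
    unfolding q_def by (rule integral_norm_le_nrm[OF dL])
  also have "\<dots> = nrm M (\<lambda>x. complex_of_real (f x) - h0 x)"
    using h0(1) E(2) by (intro nrm_AE_cong dL square_integrable_diff fL) (auto simp: almost_periodic_def h_def elim: eventually_mono)
  also have "\<dots> < \<eta>" by (rule h0(2))
  finally have q\<eta>: "(\<integral>x. q x \<partial>M) < \<eta>" .
  have aex: "\<exists>a. (\<forall>e'\<in>E. \<bar>a e'\<bar> \<le> 1) \<and> (AE x in M. e (\<phi> g x) = (\<Sum>e'\<in>E. a e' *\<^sub>R e' x))"
    if "g \<in> carrier G" "e \<in> E" for g e
    using E(1) that unfolding bounded_invariant_def by blast
  define a where "a g e = (SOME a. (\<forall>e'\<in>E. \<bar>a e'\<bar> \<le> 1) \<and> (AE x in M. e (\<phi> g x) = (\<Sum>e'\<in>E. a e' *\<^sub>R e' x)))" for g e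
  have a1: "\<bar>a g e e'\<bar> \<le> 1" if "g \<in> carrier G" "e \<in> E" "e' \<in> E" for g e e'
    using someI_ex[OF aex[OF that(1,2)]] that(3) unfolding a_def by blast
  have a2: "AE x in M. e (\<phi> g x) = (\<Sum>e'\<in>E. a g e e' *\<^sub>R e' x)" if "g \<in> carrier G" "e \<in> E" for g e
    using someI_ex[OF aex[OF that]] unfolding a_def by blast
  define P where "P x \<longleftrightarrow> (\<forall>g\<in>carrier G. \<forall>e\<in>E. e (\<phi> g x) = (\<Sum>e'\<in>E. a g e e' *\<^sub>R e' x))" for x
  have P: "AE x in M. P x"
    unfolding P_def
  proof (rule AE_carrier)
    fix g assume g: "g \<in> carrier G"
    show "AE x in M. \<forall>e\<in>E. e (\<phi> g x) = (\<Sum>e'\<in>E. a g e e' *\<^sub>R e' x)"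
      using a2[OF g] fin by (simp add: AE_finite_all)
  qed
  define C where "C = (\<Sum>e\<in>E. norm (c e))"
  have C0: "0 \<le> C" by (simp add: C_def sum_nonneg)
  have osc: "\<bar>f (\<phi> g x) - f (\<phi> g y)\<bar> \<le> q (\<phi> g x) + q (\<phi> g y) + C * (\<Sum>e\<in>E. norm (e x - e y))"
    if g: "g \<in> carrier G" and Px: "P x" and Py: "P y" for x y g
  proof -
    have e: "norm (e (\<phi> g x) - e (\<phi> g y)) \<le> (\<Sum>e\<in>E. norm (e x - e y))" if e: "e \<in> E" for e
    proof -
      have "e (\<phi> g x) - e (\<phi> g y) = (\<Sum>e'\<in>E. a g e e' *\<^sub>R (e' x - e' y))"
        using Px Py g e by (simp add: P_def scaleR_diff_right sum_subtractf)
      also have "norm \<dots> \<le> (\<Sum>e'\<in>E. norm (a g e e' *\<^sub>R (e' x - e' y)))" by (rule norm_sum)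
      also have "\<dots> \<le> (\<Sum>e'\<in>E. norm (e' x - e' y))"
        using a1[OF g e] by (intro sum_mono) (auto simp: mult_left_le_one_le)
      finally show ?thesis .
    qed
    have "h (\<phi> g x) - h (\<phi> g y) = (\<Sum>e\<in>E. c e * (e (\<phi> g x) - e (\<phi> g y)))"
      by (simp add: h_def right_diff_distrib sum_subtractf)
    also have "norm \<dots> \<le> (\<Sum>e\<in>E. norm (c e) * norm (e (\<phi> g x) - e (\<phi> g y)))"
      unfolding norm_mult[symmetric] by (rule norm_sum)
    also have "\<dots> \<le> (\<Sum>e\<in>E. norm (c e) * (\<Sum>e\<in>E. norm (e x - e y)))"
      by (intro sum_mono mult_left_mono e) auto
    also have "\<dots> = C * (\<Sum>e\<in>E. norm (e x - e y))" by (simp add: C_def sum_distrib_right)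
    finally have hh: "norm (h (\<phi> g x) - h (\<phi> g y)) \<le> C * (\<Sum>e\<in>E. norm (e x - e y))" .
    have "\<bar>f (\<phi> g x) - f (\<phi> g y)\<bar> = norm (complex_of_real (f (\<phi> g x)) - complex_of_real (f (\<phi> g y)))"
      by (simp flip: of_real_diff)
    also have "\<dots> = norm ((complex_of_real (f (\<phi> g x)) - h (\<phi> g x)) + (h (\<phi> g x) - h (\<phi> g y)) - (complex_of_real (f (\<phi> g y)) - h (\<phi> g y)))"
      by (simp add: algebra_simps)
    also have "\<dots> \<le> norm ((complex_of_real (f (\<phi> g x)) - h (\<phi> g x)) + (h (\<phi> g x) - h (\<phi> g y))) + q (\<phi> g y)"
      unfolding q_def by (rule norm_triangle_ineq4)
    also have "\<dots> \<le> q (\<phi> g x) + norm (h (\<phi> g x) - h (\<phi> g y)) + q (\<phi> g y)"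
      unfolding q_def by (intro add_right_mono norm_triangle_ineq)
    finally show ?thesis using hh by linarith
  qed
  have "orbit_oscillation_bound (\<lambda>x y. \<bar>f x - f y\<bar>) q E C"
    unfolding orbit_oscillation_bound_def
  proof (intro conjI)
    show "\<exists>P. (AE x in M. P x) \<and> (\<forall>x y. \<forall>g\<in>carrier G. P x \<longrightarrow> P y \<longrightarrow>
        \<bar>f (\<phi> g x) - f (\<phi> g y)\<bar> \<le> q (\<phi> g x) + q (\<phi> g y) + C * (\<Sum>e\<in>E. norm (e x - e y)))"
      using P osc by blast
  qed (use qi fin C0 EL in \<open>auto simp: q_def square_integrable_measurable\<close>)
  with q\<eta> show ?thesis by blast
qed

text \<open>The common feature of the metric and of the partition semimetrics through which
  approximating functions controls the semimetric.\<close>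

definition tame :: "('x \<Rightarrow> 'x \<Rightarrow> real) \<Rightarrow> bool" where
  "tame w \<longleftrightarrow> (\<forall>\<epsilon>>0. \<exists>fs. finite fs \<and> (\<forall>f\<in>fs. f \<in> borel_measurable M \<and> (\<exists>B. \<forall>x. \<bar>f x\<bar> \<le> (B::real))) \<and>
     (\<forall>x y. w x y \<le> \<epsilon> + (\<Sum>f\<in>fs. \<bar>f x - f y\<bar>)))"

text \<open>Averaging the orbit bound over \<open>A\<close> turns \<open>q\<close> into
  \<open>avg A q\<close> and leaves the oscillation at the starting points unchanged. One null set
  serves all \<open>A\<close>.\<close>

lemma tame_averaged_bound:
  assumes ds: "discrete_spectrum G \<phi> M" and w: "tame w" and \<epsilon>: "\<epsilon> > 0" and \<eta>: "\<eta> > 0"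
  shows "\<exists>q (E :: ('x \<Rightarrow> complex) set) C N. (\<forall>x. 0 \<le> q x) \<and> integrable M q \<and> (\<integral>x. q x \<partial>M) < \<eta> \<and> finite E \<and> E \<subseteq> borel_measurable M \<and>
    0 \<le> C \<and> N \<in> null_sets M \<and>
    (\<forall>x y A. x \<notin> N \<longrightarrow> y \<notin> N \<longrightarrow> finite A \<longrightarrow> A \<noteq> {} \<longrightarrow> A \<subseteq> carrier G \<longrightarrow>
      averaged \<phi> w A x y \<le> \<epsilon> + avg A q x + avg A q y + C * (\<Sum>e\<in>E. norm (e x - e y)))"
proof -
  obtain fs where fs': "finite fs" "\<forall>f\<in>fs. f \<in> borel_measurable M \<and> (\<exists>B. \<forall>x. \<bar>f x\<bar> \<le> (B::real))"
    "\<forall>x y. w x y \<le> \<epsilon> + (\<Sum>f\<in>fs. \<bar>f x - f y\<bar>)"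
    using w[unfolded tame_def, rule_format, OF \<epsilon>] by (elim exE conjE) (rule that)
  have fs: "finite fs" "\<And>f. f \<in> fs \<Longrightarrow> f \<in> borel_measurable M"
    "\<And>f. f \<in> fs \<Longrightarrow> \<exists>B. \<forall>x. \<bar>f x\<bar> \<le> B" "\<And>x y. w x y \<le> \<epsilon> + (\<Sum>f\<in>fs. \<bar>f x - f y\<bar>)"
    using fs' by simp_all
  have "\<exists>q E C. orbit_oscillation_bound (\<lambda>x y. \<Sum>f\<in>fs. \<bar>f x - f y\<bar>) q E C \<and> (\<integral>x. q x \<partial>M) < \<eta>"
    using fs(1-3) \<eta>
  proof (induction fs arbitrary: \<eta> rule: finite_induct)
    case empty
    have "orbit_oscillation_bound (\<lambda>x y. 0) (\<lambda>x. 0) {} 0" by (auto simp: orbit_oscillation_bound_def)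
    then show ?case using empty by (intro exI[of _ "\<lambda>x. 0"] exI[of _ "{}"] exI[of _ 0]) auto
  next
    case (insert f fs)
    obtain B where B: "\<And>x. \<bar>f x\<bar> \<le> B" using insert.prems by blast
    obtain q1 E1 C1 where 1: "orbit_oscillation_bound (\<lambda>x y. \<bar>f x - f y\<bar>) q1 E1 C1" "(\<integral>x. q1 x \<partial>M) < \<eta> / 2"
    proof -
      have "\<exists>q E C. orbit_oscillation_bound (\<lambda>x y. \<bar>f x - f y\<bar>) q E C \<and> (\<integral>x. q x \<partial>M) < \<eta> / 2"
        by (rule orbit_oscillation_single[OF ds _ B]) (use insert.prems in auto)
      then show thesis by (elim exE conjE) (rule that)
    qed
    obtain q2 E2 C2 where 2: "orbit_oscillation_bound (\<lambda>x y. \<Sum>f\<in>fs. \<bar>f x - f y\<bar>) q2 E2 C2" "(\<integral>x. q2 x \<partial>M) < \<eta> / 2"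
    proof -
      have "\<exists>q E C. orbit_oscillation_bound (\<lambda>x y. \<Sum>f\<in>fs. \<bar>f x - f y\<bar>) q E C \<and> (\<integral>x. q x \<partial>M) < \<eta> / 2"
        by (rule insert.IH) (use insert.prems in auto)
      then show thesis by (elim exE conjE) (rule that)
    qed
    have i: "integrable M q1" "integrable M q2" using 1(1) 2(1) by (auto simp: orbit_oscillation_bound_def)
    have lt: "(\<integral>x. q1 x + q2 x \<partial>M) < \<eta>" using 1(2) 2(2) i by simp
    have "(\<lambda>x y. \<Sum>f\<in>insert f fs. \<bar>f x - f y\<bar>) = (\<lambda>x y. \<bar>f x - f y\<bar> + (\<Sum>f\<in>fs. \<bar>f x - f y\<bar>))"
      using insert.hyps by simp
    then have "orbit_oscillation_bound (\<lambda>x y. \<Sum>f\<in>insert f fs. \<bar>f x - f y\<bar>) (\<lambda>x. q1 x + q2 x) (E1 \<union> E2) (C1 + C2)"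
      using orbit_oscillation_bound_add[OF 1(1) 2(1)] by (simp only:)
    with lt show ?case by (intro exI conjI)
  qed
  then obtain q E C where qEC: "orbit_oscillation_bound (\<lambda>x y. \<Sum>f\<in>fs. \<bar>f x - f y\<bar>) q E C"
    and q\<eta>: "(\<integral>x. q x \<partial>M) < \<eta>" by blast
  then obtain P where P: "AE x in M. P x" and osc: "\<And>x y g. g \<in> carrier G \<Longrightarrow> P x \<Longrightarrow> P y \<Longrightarrow>
      (\<Sum>f\<in>fs. \<bar>f (\<phi> g x) - f (\<phi> g y)\<bar>) \<le> q (\<phi> g x) + q (\<phi> g y) + C * (\<Sum>e\<in>E. norm (e x - e y))"
    unfolding orbit_oscillation_bound_def by blast
  obtain N where N: "N \<in> null_sets M" "{x \<in> space M. \<not> P x} \<subseteq> N"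
    using P unfolding eventually_ae_filter by auto
  have "averaged \<phi> w A x y \<le> \<epsilon> + avg A q x + avg A q y + C * (\<Sum>e\<in>E. norm (e x - e y))"
    if xy: "x \<notin> N" "y \<notin> N" and A: "finite A" "A \<noteq> {}" "A \<subseteq> carrier G" for x y A
  proof -
    have Pxy: "P x" "P y" using N(2) xy by (auto simp: space_UNIV)
    have c: "real (card A) > 0" using A by (simp add: card_gt_0_iff)
    have "(\<Sum>g\<in>A. w (\<phi> g x) (\<phi> g y)) \<le> (\<Sum>g\<in>A. (\<epsilon> + C * (\<Sum>e\<in>E. norm (e x - e y))) + q (\<phi> g x) + q (\<phi> g y))"
    proof (rule sum_mono)
      fix g assume "g \<in> A"
      then have "g \<in> carrier G" using A by auto
      from osc[OF this Pxy] fs(4)[of "\<phi> g x" "\<phi> g y"]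
      show "w (\<phi> g x) (\<phi> g y) \<le> (\<epsilon> + C * (\<Sum>e\<in>E. norm (e x - e y))) + q (\<phi> g x) + q (\<phi> g y)" by linarith
    qed
    also have "\<dots> = real (card A) * (\<epsilon> + C * (\<Sum>e\<in>E. norm (e x - e y))) + (\<Sum>g\<in>A. q (\<phi> g x)) + (\<Sum>g\<in>A. q (\<phi> g y))"
      by (simp add: sum.distrib)
    also have "\<dots> = real (card A) * (\<epsilon> + avg A q x + avg A q y + C * (\<Sum>e\<in>E. norm (e x - e y)))"
      using c by (simp add: avg_def distrib_left)
    finally show ?thesis using c by (simp add: averaged_def pos_divide_le_eq mult.commute)
  qed
  then have all: "\<forall>x y A. x \<notin> N \<longrightarrow> y \<notin> N \<longrightarrow> finite A \<longrightarrow> A \<noteq> {} \<longrightarrow> A \<subseteq> carrier G \<longrightarrow>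
      averaged \<phi> w A x y \<le> \<epsilon> + avg A q x + avg A q y + C * (\<Sum>e\<in>E. norm (e x - e y))"
    by simp
  have "\<forall>x. 0 \<le> q x" "integrable M q" "finite E" "E \<subseteq> borel_measurable M" "0 \<le> C"
    using qEC by (simp_all add: orbit_oscillation_bound_def)
  with all q\<eta> N(1) show ?thesis by (intro exI conjI)
qed

lemma measure_Int_gt:
  assumes "A \<in> sets M" "B \<in> sets M" "measure M A > 1 - a" "measure M B > 1 - b"
  shows "measure M (A \<inter> B) > 1 - (a + b)"
proof -
  have "measure M (A \<union> B) + measure M (A \<inter> B) = measure M A + measure M B"
    using finite_measure_Union'[OF assms(1,2)] finite_measure_Diff'[OF assms(2,1)] by (simp add: Int_commute)
  then show ?thesis using prob_le_1[of "A \<union> B"] assms(3,4) by linarith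
qed

text \<open>The partition comes before the averaging sets; only the good set depends on the family
  taken from \<open>S\<close>. If \<open>S\<close> consists of singletons, every \<open>n\<close>
  receives its own good set; if \<open>S\<close> has the whole sequence as its only member, one good
  set serves all \<open>n\<close>. The factor 4 collects \<epsilon> from tameness, two averages of
  \<open>q\<close>, and the oscillation of \<open>E\<close>.\<close>

lemma small_averaged_partition:
  assumes ds: "discrete_spectrum G \<phi> M" and w: "tame w" and \<epsilon>: "\<epsilon> > 0" and \<tau>: "\<tau> > 0"
    and \<F>: "\<And>A. A \<in> \<F> \<Longrightarrow> finite A \<and> A \<noteq> {} \<and> A \<subseteq> carrier G"
    and S: "\<And>q. integrable M q \<Longrightarrow> \<forall>x. 0 \<le> q x \<Longrightarrow> (\<integral>x. q x \<partial>M) < \<eta> \<Longrightarrow>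
      \<forall>\<G>\<in>S. \<G> \<subseteq> \<F> \<and> {x. \<forall>A\<in>\<G>. avg A q x \<le> \<epsilon>} \<in> sets M \<and> measure M {x. \<forall>A\<in>\<G>. avg A q x \<le> \<epsilon>} > 1 - \<tau>"
    and \<eta>: "\<eta> > 0"
  shows "\<exists>\<P>. finite \<P> \<and> \<P> \<subseteq> sets M \<and> disjoint \<P> \<and>
    (\<forall>\<G>\<in>S. \<exists>Good\<in>sets M. measure M (\<Union>\<P> \<inter> Good) > 1 - 2 * \<tau> \<and>
      (\<forall>P\<in>\<P>. \<forall>x\<in>P \<inter> Good. \<forall>y\<in>P \<inter> Good. \<forall>A\<in>\<G>. averaged \<phi> w A x y < 4 * \<epsilon>))"
proof -
  obtain q and E :: "('x \<Rightarrow> complex) set" and C N where q: "\<forall>x. 0 \<le> q x" "integrable M q" "(\<integral>x. q x \<partial>M) < \<eta>"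
    and E: "finite E" "E \<subseteq> borel_measurable M" and C: "0 \<le> C" and N: "N \<in> null_sets M"
    and bound: "\<forall>x y A. x \<notin> N \<longrightarrow> y \<notin> N \<longrightarrow> finite A \<longrightarrow> A \<noteq> {} \<longrightarrow> A \<subseteq> carrier G \<longrightarrow>
      averaged \<phi> w A x y \<le> \<epsilon> + avg A q x + avg A q y + C * (\<Sum>e\<in>E. norm (e x - e y))"
    using tame_averaged_bound[OF ds w \<epsilon> \<eta>] by (elim exE conjE) (rule that)
  have "\<epsilon> / (C + 1) > 0" using \<epsilon> C by simp
  from small_oscillation_partition[OF E this \<tau>] obtain \<P> where \<P>: "finite \<P>" "\<P> \<subseteq> sets M" "disjoint \<P>"
    "measure M (\<Union>\<P>) > 1 - \<tau>" and osc: "\<forall>P\<in>\<P>. \<forall>x\<in>P. \<forall>y\<in>P. (\<Sum>e\<in>E. norm (e x - e y)) < \<epsilon> / (C + 1)"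
    by blast
  have Um: "\<Union>\<P> \<in> sets M" using \<P> by (intro sets.finite_Union) auto
  have "\<exists>Good\<in>sets M. measure M (\<Union>\<P> \<inter> Good) > 1 - 2 * \<tau> \<and>
      (\<forall>P\<in>\<P>. \<forall>x\<in>P \<inter> Good. \<forall>y\<in>P \<inter> Good. \<forall>A\<in>\<G>. averaged \<phi> w A x y < 4 * \<epsilon>)" if \<G>: "\<G> \<in> S" for \<G>
  proof -
    define G0 where "G0 = {x. \<forall>A\<in>\<G>. avg A q x \<le> \<epsilon>}"
    have G0: "\<G> \<subseteq> \<F>" "G0 \<in> sets M" "measure M G0 > 1 - \<tau>" using S[OF q(2,1,3)] \<G> by (auto simp: G0_def)
    have Nm: "N \<in> sets M" using N by auto
    have Good: "G0 - N \<in> sets M" using G0 Nm by auto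
    have "measure M (G0 - N) > 1 - \<tau>" using measure_Diff_null_set[OF G0(2) N] G0(3) by simp
    from measure_Int_gt[OF Um Good \<P>(4) this] have "measure M (\<Union>\<P> \<inter> (G0 - N)) > 1 - 2 * \<tau>" by simp
    moreover have "averaged \<phi> w A x y < 4 * \<epsilon>"
      if P: "P \<in> \<P>" and x: "x \<in> P \<inter> (G0 - N)" and y: "y \<in> P \<inter> (G0 - N)" and A: "A \<in> \<G>" for P x y A
    proof -
      have "finite A \<and> A \<noteq> {} \<and> A \<subseteq> carrier G" using A G0(1) \<F> by blast
      then have "averaged \<phi> w A x y \<le> \<epsilon> + avg A q x + avg A q y + C * (\<Sum>e\<in>E. norm (e x - e y))"
        using bound x y by blast
      moreover have "avg A q x \<le> \<epsilon>" "avg A q y \<le> \<epsilon>" using x y A by (auto simp: G0_def)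
      moreover have "C * (\<Sum>e\<in>E. norm (e x - e y)) < \<epsilon>"
      proof -
        have s: "(\<Sum>e\<in>E. norm (e x - e y)) < \<epsilon> / (C + 1)" using osc P x y by blast
        have "C * (\<Sum>e\<in>E. norm (e x - e y)) \<le> (C + 1) * (\<Sum>e\<in>E. norm (e x - e y))"
          by (intro mult_right_mono sum_nonneg) auto
        also have "\<dots> < \<epsilon>" using s C by (simp add: pos_less_divide_eq mult.commute)
        finally show ?thesis .
      qed
      ultimately show ?thesis by linarith
    qed
    ultimately show ?thesis using Good by blast
  qed
  with \<P> show ?thesis by blast
qed

text \<open>A single partition serves all \<open>n\<close>, so \<open>card \<P>\<close> balls always
  suffice; only the good sets and the centres vary with \<open>n\<close>.\<close>

proposition bounded_complexity_if_discrete_spectrum: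
  assumes ds: "discrete_spectrum G \<phi> M" and w: "tame w"
    and wm: "(\<lambda>(x, y). w x y) \<in> borel_measurable (M \<Otimes>\<^sub>M M)"
    and F: "folner_sequence G F"
  shows "bounded_complexity M (\<lambda>n. averaged \<phi> w (F n))"
  unfolding bounded_complexity_def
proof (intro allI impI)
  fix \<epsilon>0 :: real assume \<epsilon>0: "\<epsilon>0 > 0"
  have Fn: "finite (F n)" "F n \<noteq> {}" "F n \<subseteq> carrier G" for n using F by (auto simp: folner_sequence_def)
  \<comment> \<open>Thus \<open>4 * \<epsilon>\<close> is the ball radius
    \<open>\<epsilon>0 / 2\<close>, \<open>2 * \<tau>\<close> is the permitted exceptional mass, and
    \<eta> is what Markov's inequality at level \<epsilon> needs for a bad set smaller than
    \<tau>.\<close>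
  define \<epsilon> where "\<epsilon> = \<epsilon>0 / 8"
  define \<tau> where "\<tau> = \<epsilon>0 / 2"
  define \<eta> where "\<eta> = \<epsilon> * \<tau>"
  have pos: "\<epsilon> > 0" "\<tau> > 0" "\<eta> > 0" using \<epsilon>0 by (auto simp: \<epsilon>_def \<tau>_def \<eta>_def)
  have good: "{x. avg (F n) q x \<le> \<epsilon>} \<in> sets M \<and> measure M {x. avg (F n) q x \<le> \<epsilon>} > 1 - \<tau>"
    if qi: "integrable M q" and q0: "\<forall>x. 0 \<le> q x" and q\<eta>: "(\<integral>x. q x \<partial>M) < \<eta>" for q n
  proof -
    note i = integral_avg[OF Fn qi, of n]
    have a0: "0 \<le> avg (F n) q x" for x using q0 by (simp add: avg_def sum_nonneg)
    have [measurable]: "avg (F n) q \<in> borel_measurable M" using i(1) by auto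
    have "measure M {x \<in> space M. \<epsilon> \<le> avg (F n) q x} \<le> (\<integral>x. avg (F n) q x \<partial>M) / \<epsilon>"
      by (rule integral_Markov_inequality_measure[where A="space M"]) (use i(1) pos a0 in auto)
    also have "\<dots> < \<tau>" using q\<eta> pos by (simp add: i(2) \<eta>_def pos_divide_less_eq mult.commute)
    finally have lt: "measure M {x \<in> space M. \<epsilon> \<le> avg (F n) q x} < \<tau>" .
    have m: "{x \<in> space M. \<epsilon> \<le> avg (F n) q x} \<in> sets M" by measurable
    have m2: "{x \<in> space M. avg (F n) q x \<le> \<epsilon>} \<in> sets M" by measurable
    have "1 - \<tau> < measure M (space M - {x \<in> space M. \<epsilon> \<le> avg (F n) q x})"
      using prob_compl[OF m] lt by simp
    also have "\<dots> \<le> measure M {x \<in> space M. avg (F n) q x \<le> \<epsilon>}"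
      by (rule finite_measure_mono[OF _ m2]) auto
    finally show ?thesis using m2 by (simp add: space_UNIV)
  qed
  have "\<exists>\<P>. finite \<P> \<and> \<P> \<subseteq> sets M \<and> disjoint \<P> \<and>
    (\<forall>\<G>\<in>range (\<lambda>n. {F n}). \<exists>Good\<in>sets M. measure M (\<Union>\<P> \<inter> Good) > 1 - 2 * \<tau> \<and>
      (\<forall>P\<in>\<P>. \<forall>x\<in>P \<inter> Good. \<forall>y\<in>P \<inter> Good. \<forall>A\<in>\<G>. averaged \<phi> w A x y < 4 * \<epsilon>))"
    by (rule small_averaged_partition[OF ds w pos(1,2), where \<F>="range F" and \<eta>=\<eta>])
       (use Fn good pos in auto)
  then obtain \<P> where \<P>: "finite \<P>" "\<P> \<subseteq> sets M"
    and Good: "\<And>n. \<exists>Good\<in>sets M. measure M (\<Union>\<P> \<inter> Good) > 1 - 2 * \<tau> \<and>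
      (\<forall>P\<in>\<P>. \<forall>x\<in>P \<inter> Good. \<forall>y\<in>P \<inter> Good. averaged \<phi> w (F n) x y < 4 * \<epsilon>)"
    by auto
  obtain e where e: "bij_betw e {1..card \<P>} \<P>" using ex_bij_betw_nat_finite_1[OF \<P>(1)] by blast
  show "\<exists>K. \<forall>n. complexity M (averaged \<phi> w (F n)) \<epsilon>0 \<le> enat K"
  proof (intro exI allI)
    fix n
    obtain Go where Go: "Go \<in> sets M" "measure M (\<Union>\<P> \<inter> Go) > 1 - 2 * \<tau>"
      "\<And>P x y. P \<in> \<P> \<Longrightarrow> x \<in> P \<inter> Go \<Longrightarrow> y \<in> P \<inter> Go \<Longrightarrow> averaged \<phi> w (F n) x y < 4 * \<epsilon>"
      using Good[of n] by blast
    \<comment> \<open>The choice is arbitrary for a piece without good points, but such a piece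
      contributes nothing to the set to be covered.\<close>
    define x where "x i = (SOME z. z \<in> e i \<inter> Go)" for i
    let ?ball = "\<lambda>i. semimetric_ball (averaged \<phi> w (F n)) (x i) (\<epsilon>0 / 2)"
    have "?ball i \<in> sets M" for i
      using borel_measurable_less[OF section_measurable[OF averaged_measurable[OF Fn(3)[of n] wm], of "x i"] borel_measurable_const, of "\<epsilon>0 / 2"]
      by (simp add: semimetric_ball_def space_UNIV)
    then have Um: "(\<Union>i\<in>{1..card \<P>}. ?ball i) \<in> sets M" by (intro sets.finite_UN) auto
    have "\<Union>\<P> \<inter> Go \<subseteq> (\<Union>i\<in>{1..card \<P>}. ?ball i)"
    proof
      fix z assume "z \<in> \<Union>\<P> \<inter> Go"
      then obtain P where P: "P \<in> \<P>" "z \<in> P \<inter> Go" by auto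
      then obtain i where i: "i \<in> {1..card \<P>}" "P = e i" using bij_betw_imp_surj_on[OF e] by blast
      have "x i \<in> e i \<inter> Go" unfolding x_def by (rule someI[of _ z]) (use P i in auto)
      then have "averaged \<phi> w (F n) (x i) z < 4 * \<epsilon>" using Go(3)[OF P(1), of "x i" z] P i by auto
      then have "z \<in> ?ball i" by (simp add: semimetric_ball_def \<epsilon>_def)
      then show "z \<in> (\<Union>i\<in>{1..card \<P>}. ?ball i)" using i by blast
    qed
    from finite_measure_mono[OF this Um] have "1 - \<epsilon>0 < measure M (\<Union>i\<in>{1..card \<P>}. ?ball i)"
      using Go(2) by (simp add: \<tau>_def)
    then show "complexity M (averaged \<phi> w (F n)) \<epsilon>0 \<le> enat (card \<P>)"
      unfolding complexity_le_iff by blast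
  qed
qed

text \<open>The good set requires all averages of \<open>q\<close> to be small at once. Being the
  same for every \<open>n\<close>, it can be absorbed into the pieces by intersection.\<close>

proposition uniformly_small_partition:
  assumes ds: "discrete_spectrum G \<phi> M" and w: "tame w"
    and F: "folner_sequence G F" and temp: "tempered G F" and \<epsilon>: "\<epsilon> > 0" and \<tau>: "\<tau> > 0"
  shows "\<exists>\<P>. finite \<P> \<and> \<P> \<subseteq> sets M \<and> disjoint \<P> \<and> measure M (\<Union>\<P>) > 1 - \<tau> \<and>
    (\<forall>P\<in>\<P>. \<forall>x\<in>P. \<forall>y\<in>P. \<forall>n. averaged \<phi> w (F n) x y < \<epsilon>)"
proof -
  have Fn: "finite (F n)" "F n \<noteq> {}" "F n \<subseteq> carrier G" for n using F by (auto simp: folner_sequence_def)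
  obtain C where C: "C > 0" "\<And>n. real (card (\<Union>k<n. set_inv (F k) <#> F n)) \<le> C * real (card (F n))"
    using temp by (auto simp: tempered_def)
  define \<epsilon>' where "\<epsilon>' = \<epsilon> / 4"
  define \<tau>' where "\<tau>' = \<tau> / 2"
  \<comment> \<open>Chosen to absorb the constant \<open>1 + C\<close> of the maximal
    inequality.\<close>
  define \<eta> where "\<eta> = \<epsilon>' * \<tau>' / (1 + C)"
  have pos: "\<epsilon>' > 0" "\<tau>' > 0" "\<eta> > 0" using \<epsilon> \<tau> C(1) by (auto simp: \<epsilon>'_def \<tau>'_def \<eta>_def)
  have good: "{x. \<forall>n. avg (F n) q x \<le> \<epsilon>'} \<in> sets M \<and> measure M {x. \<forall>n. avg (F n) q x \<le> \<epsilon>'} > 1 - \<tau>'"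
    if qi: "integrable M q" and q0: "\<forall>x. 0 \<le> q x" and q\<eta>: "(\<integral>x. q x \<partial>M) < \<eta>" for q
  proof -
    have [measurable]: "avg (F n) q \<in> borel_measurable M" for n using integral_avg(1)[OF Fn qi, of n] by auto
    define Bad where "Bad = {x. \<exists>n. \<epsilon>' < avg (F n) q x}"
    have "{x \<in> space M. \<exists>n. \<epsilon>' < avg (F n) q x} \<in> sets M" by measurable
    then have Bm: "Bad \<in> sets M" by (simp add: Bad_def space_UNIV)
    have "\<epsilon>' * measure M Bad \<le> (1 + C) * (\<integral>x. q x \<partial>M)"
      unfolding Bad_def by (rule maximal_inequality[OF F C(2) qi _ pos(1)]) (use q0 in auto)
    also have "\<dots> < (1 + C) * \<eta>" using q\<eta> C(1) by simp
    also have "\<dots> = \<epsilon>' * \<tau>'" using C(1) by (simp add: \<eta>_def)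
    finally have "measure M Bad < \<tau>'" using pos(1) by simp
    moreover have "space M - Bad = {x. \<forall>n. avg (F n) q x \<le> \<epsilon>'}" by (auto simp: Bad_def space_UNIV simp flip: not_le)
    ultimately show ?thesis using prob_compl[OF Bm] sets.compl_sets[OF Bm] by auto
  qed
  have "\<exists>\<P>. finite \<P> \<and> \<P> \<subseteq> sets M \<and> disjoint \<P> \<and>
    (\<forall>\<G>\<in>{range F}. \<exists>Good\<in>sets M. measure M (\<Union>\<P> \<inter> Good) > 1 - 2 * \<tau>' \<and>
      (\<forall>P\<in>\<P>. \<forall>x\<in>P \<inter> Good. \<forall>y\<in>P \<inter> Good. \<forall>A\<in>\<G>. averaged \<phi> w A x y < 4 * \<epsilon>'))"
    by (rule small_averaged_partition[OF ds w pos(1,2), where \<F>="range F" and \<eta>=\<eta>])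
       (use Fn good pos in auto)
  then obtain \<P> Good where \<P>: "finite \<P>" "\<P> \<subseteq> sets M" "disjoint \<P>" and Good: "Good \<in> sets M"
    "measure M (\<Union>\<P> \<inter> Good) > 1 - 2 * \<tau>'"
    "\<forall>P\<in>\<P>. \<forall>x\<in>P \<inter> Good. \<forall>y\<in>P \<inter> Good. \<forall>A\<in>range F. averaged \<phi> w A x y < 4 * \<epsilon>'"
    by blast
  define \<Q> where "\<Q> = (\<lambda>P. P \<inter> Good) ` \<P>"
  have "\<Union>\<Q> = \<Union>\<P> \<inter> Good" by (auto simp: \<Q>_def)
  moreover have "disjoint \<Q>"
    unfolding disjoint_def
  proof (intro ballI impI)
    fix A B assume "A \<in> \<Q>" "B \<in> \<Q>" "A \<noteq> B"
    then obtain P Q where "A = P \<inter> Good" "B = Q \<inter> Good" "P \<in> \<P>" "Q \<in> \<P>" "P \<noteq> Q" by (auto simp: \<Q>_def)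
    then show "A \<inter> B = {}" using \<P>(3) unfolding disjoint_def by blast
  qed
  moreover have "finite \<Q>" "\<Q> \<subseteq> sets M" using \<P> Good(1) by (auto simp: \<Q>_def)
  moreover have "\<forall>P\<in>\<Q>. \<forall>x\<in>P. \<forall>y\<in>P. \<forall>n. averaged \<phi> w (F n) x y < \<epsilon>"
    using Good(3) by (auto simp: \<Q>_def \<epsilon>'_def)
  ultimately show ?thesis using Good(2) by (intro exI[of _ \<Q>]) (simp add: \<tau>'_def)
qed

end

section \<open>Borel measures on a compact metric space\<close>

text \<open>Inner and outer approximation are proved together because complementation exchanges
  them.\<close>

lemma closed_open_regular:
  fixes A :: "'a::metric_space set"
  assumes fm: "finite_measure M" and sb: "sets M = sets borel" and A: "A \<in> sets M" and e: "e > 0"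
  shows "\<exists>C U. closed C \<and> open U \<and> C \<subseteq> A \<and> A \<subseteq> U \<and> measure M (U - C) < e"
proof -
  interpret finite_measure M by (rule fm)
  have sp: "space M = UNIV" using sets_eq_imp_space_eq[OF sb] by simp
  have om: "open U \<Longrightarrow> U \<in> sets M" and cm: "closed U \<Longrightarrow> U \<in> sets M" for U using sb by auto
  have "A \<in> sigma_sets UNIV {S. open S}" using A sb by (simp add: borel_def)
  then show ?thesis using e
  proof (induction A arbitrary: e rule: sigma_sets.induct)
    case (Basic U)
    then have U: "open U" by simp
    \<comment> \<open>\<open>infdist\<close> to the empty set is 0 by convention, so the distance to
      \<open>- U\<close> says nothing when \<open>U\<close> is the whole space.\<close>
    show ?case
    proof (cases "U = UNIV")
      case True
      then show ?thesis using Basic by (intro exI[of _ UNIV]) auto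
    next
      case False
      then have ne: "- U \<noteq> {}" by auto
      define C where "C n = {x. 1 / real (Suc n) \<le> infdist x (- U)}" for n
      have Cc: "closed (C n)" for n
        unfolding C_def by (intro closed_Collect_le continuous_intros)
      have CU: "C n \<subseteq> U" for n
      proof (rule subsetI, rule ccontr)
        fix x assume x: "x \<in> C n" "x \<notin> U"
        then have "infdist x (- U) = 0" by simp
        moreover have "0 < 1 / real (Suc n)" by simp
        ultimately show False using x(1) unfolding C_def by simp
      qed
      have "incseq (\<lambda>n. C n)"
      proof (rule incseq_SucI)
        have "1 / real (Suc (Suc n)) \<le> 1 / real (Suc n)" for n by (simp add: field_simps)
        then show "C n \<subseteq> C (Suc n)" for n unfolding C_def by (auto intro: order_trans)
      qed
      then have lim: "(\<lambda>n. measure M (C n)) \<longlonglongrightarrow> measure M (\<Union>n. C n)"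
        by (intro finite_Lim_measure_incseq) (use cm[OF Cc] in auto)
      have "(\<Union>n. C n) = U"
      proof
        show "U \<subseteq> (\<Union>n. C n)"
        proof
          fix x assume "x \<in> U"
          then have "infdist x (- U) > 0"
            using in_closed_iff_infdist_zero[of "- U" x] U ne infdist_nonneg[of x "- U"] by (auto simp: less_le)
          then obtain n where "1 / real (Suc n) < infdist x (- U)" using nat_approx_posE by metis
          then show "x \<in> (\<Union>n. C n)" by (auto simp: C_def intro: less_imp_le)
        qed
      qed (use CU in auto)
      with lim have "\<forall>\<^sub>F n in sequentially. measure M (C n) > measure M U - e"
        using Basic.prems by (intro order_tendstoD(1)) auto
      then obtain n where n: "measure M (C n) > measure M U - e" using eventually_happens by fastforce
      have "measure M (U - C n) = measure M U - measure M (C n)"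
        by (rule finite_measure_Diff) (use om[OF U] cm[OF Cc] CU in auto)
      then show ?thesis using U Cc[of n] CU[of n] n by (intro exI[of _ "C n"] exI[of _ U]) auto
    qed
  next
    case Empty
    then show ?case by (intro exI[of _ "{}"]) auto
  next
    case (Compl A)
    obtain C U where CU: "closed C" "open U" "C \<subseteq> A" "A \<subseteq> U" "measure M (U - C) < e"
      using Compl.IH[OF Compl.prems] by blast
    moreover have "(UNIV - C) - (UNIV - U) = U - C" by auto
    ultimately show ?case by (intro exI[of _ "UNIV - U"] exI[of _ "UNIV - C"]) (auto simp: closed_def Compl_eq_Diff_UNIV[symmetric])
  next
    case (Union A)
    \<comment> \<open>Half of \<open>e\<close> is spent on the members of the union, the other half
      on truncating the countable union of closed sets to a finite one, which is closed.\<close>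
    define d where "d i = e / 2 * (1 / 2) ^ Suc i" for i
    have d: "d i > 0" for i using Union.prems by (simp add: d_def)
    have "\<forall>i. \<exists>C U. closed C \<and> open U \<and> C \<subseteq> A i \<and> A i \<subseteq> U \<and> measure M (U - C) < d i"
      using Union.IH[OF d] by blast
    then obtain C U where CU: "\<And>i. closed (C i)" "\<And>i. open (U i)" "\<And>i. C i \<subseteq> A i" "\<And>i. A i \<subseteq> U i"
      "\<And>i. measure M (U i - C i) < d i" by metis
    have Cm [measurable]: "C i \<in> sets M" and Um [measurable]: "U i \<in> sets M" for i using cm om CU by auto
    have ds: "d sums (e / 2)"
      using sums_mult[OF power_half_series, of "e / 2"] by (simp only: d_def[abs_def] mult_1_right)
    have le: "measure M (U i - C i) \<le> d i" for i using CU(5)[of i] by linarith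
    have su: "summable (\<lambda>i. measure M (U i - C i))"
      by (rule summable_comparison_test'[OF sums_summable[OF ds], of 0]) (use le in simp)
    have "measure M (\<Union>i. U i - C i) \<le> (\<Sum>i. measure M (U i - C i))"
    proof (rule finite_measure_subadditive_countably[OF _ su])
      show "range (\<lambda>i. U i - C i) \<subseteq> sets M" by auto
    qed
    also have "\<dots> \<le> (\<Sum>i. d i)"
      by (rule suminf_le[OF le su sums_summable[OF ds]])
    also have "\<dots> = e / 2" using ds by (rule sums_unique[symmetric])
    finally have 1: "measure M (\<Union>i. U i - C i) \<le> e / 2" .
    define Cn where "Cn n = (\<Union>i<n. C i)" for n
    have Cnm [measurable]: "Cn n \<in> sets M" for n unfolding Cn_def by measurable
    have "(\<lambda>n. measure M (Cn n)) \<longlonglongrightarrow> measure M (\<Union>n. Cn n)"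
    proof (rule finite_Lim_measure_incseq)
      show "range Cn \<subseteq> sets M" using Cnm by auto
      show "incseq Cn" by (auto simp: incseq_def Cn_def intro: less_le_trans)
    qed
    moreover have Cun: "(\<Union>n. Cn n) = (\<Union>i. C i)" by (auto simp: Cn_def)
    ultimately have "\<forall>\<^sub>F n in sequentially. measure M (Cn n) > measure M (\<Union>i. C i) - e / 2"
      using Union.prems by (intro order_tendstoD(1)) auto
    then obtain n where n: "measure M (Cn n) > measure M (\<Union>i. C i) - e / 2" using eventually_happens by fastforce
    have Call [measurable]: "(\<Union>i. C i) \<in> sets M" by measurable
    have "measure M ((\<Union>i. C i) - Cn n) = measure M (\<Union>i. C i) - measure M (Cn n)"
      by (rule finite_measure_Diff) (use Cun in auto)
    then have 2: "measure M ((\<Union>i. C i) - Cn n) < e / 2" using n by linarith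
    have Uall: "(\<Union>i. U i - C i) \<in> sets M" by measurable
    have "measure M ((\<Union>i. U i) - Cn n) \<le> measure M ((\<Union>i. U i - C i) \<union> ((\<Union>i. C i) - Cn n))"
      by (rule finite_measure_mono) (auto intro!: sets.Un sets.Diff Uall Call Cnm)
    also have "\<dots> \<le> measure M (\<Union>i. U i - C i) + measure M ((\<Union>i. C i) - Cn n)"
      by (rule measure_Un_le) (auto intro!: sets.Diff Uall Call Cnm)
    finally have "measure M ((\<Union>i. U i) - Cn n) < e" using 1 2 by linarith
    moreover have "closed (Cn n)" unfolding Cn_def by (intro closed_UN) (auto simp: CU)
    moreover have "open (\<Union>i. U i)" using CU(2) by auto
    moreover have "Cn n \<subseteq> (\<Union>i. A i)" unfolding Cn_def using CU(3) by blast
    moreover have "(\<Union>i. A i) \<subseteq> (\<Union>i. U i)" using CU(4) by (intro UN_mono) auto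
    ultimately show ?case by blast
  qed
qed

section \<open>The metric and partition semimetrics\<close>

locale compact_measure_preserving_action = measure_preserving_action G M \<phi>
  for G :: "('g, 'm) monoid_scheme" (structure) and M :: "'x::metric_space measure" and \<phi> +
  assumes sets_borel: "sets M = sets borel" and compact_UNIV: "compact (UNIV :: 'x set)"
begin

lemma finite_net:
  assumes "e > 0"
  shows "\<exists>k :: 'x set. finite k \<and> (\<forall>x. \<exists>c\<in>k. dist x c < e)"
proof -
  obtain k :: "'x set" where k: "finite k" "UNIV \<subseteq> (\<Union>x\<in>k. ball x e)"
    using compact_UNIV assms unfolding compact_eq_totally_bounded by blast
  have "\<exists>c\<in>k. dist x c < e" for x
  proof -
    have "x \<in> (\<Union>c\<in>k. ball c e)" using k(2) by blast
    then show ?thesis by (auto simp: dist_commute)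
  qed
  with k(1) show ?thesis by blast
qed

lemma dist_section_measurable: "(\<lambda>x. dist x c) \<in> borel_measurable M"
  by (rule borel_measurable_subalgebra[of borel])
     (auto simp: sets_borel space_UNIV intro!: borel_measurable_continuous_onI continuous_intros)

text \<open>Finite nets supply a countable dense set \<open>D\<close>. Then
  \<open>dist x y < a\<close> holds iff \<open>dist x d + dist y d < a\<close> for some
  \<open>d\<close> in \<open>D\<close>, which is a countable union of sets in the product
  sigma-algebra.\<close>

lemma dist_measurable: "(\<lambda>(x, y). dist x y) \<in> borel_measurable (M \<Otimes>\<^sub>M M)"
proof -
  have "\<forall>n. \<exists>k :: 'x set. finite k \<and> (\<forall>x. \<exists>c\<in>k. dist x c < 1 / real (Suc n))"
    by (intro allI finite_net) simp
  then obtain k :: "nat \<Rightarrow> 'x set" where k: "\<And>n. finite (k n)" "\<And>n x. \<exists>c\<in>k n. dist x c < 1 / real (Suc n)"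
    by metis
  define D where "D = (\<Union>n. k n)"
  have D: "countable D" unfolding D_def using k(1) by (intro countable_UN) (auto intro: countable_finite)
  have "{z \<in> space (M \<Otimes>\<^sub>M M). (case z of (x, y) \<Rightarrow> dist x y) < a} \<in> sets (M \<Otimes>\<^sub>M M)" for a
  proof -
    have "{z \<in> space (M \<Otimes>\<^sub>M M). (case z of (x, y) \<Rightarrow> dist x y) < a}
        = (\<Union>d\<in>D. {z \<in> space (M \<Otimes>\<^sub>M M). dist (fst z) d + dist (snd z) d < a})"
    proof (intro equalityI subsetI)
      fix z assume z: "z \<in> {z \<in> space (M \<Otimes>\<^sub>M M). (case z of (x, y) \<Rightarrow> dist x y) < a}"
      obtain x y where xy: "z = (x, y)" by force
      have "0 < (a - dist x y) / 2" using z by (simp add: xy)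
      then obtain n where n: "1 / real (Suc n) < (a - dist x y) / 2" using nat_approx_posE by metis
      obtain c where c: "c \<in> k n" "dist x c < 1 / real (Suc n)" using k(2) by blast
      have "2 * dist x c < a - dist x y" using less_trans[OF c(2) n] by simp
      then have "dist x c + dist y c < a" using dist_triangle3[of y c x] dist_commute[of x y] by linarith
      then show "z \<in> (\<Union>d\<in>D. {z \<in> space (M \<Otimes>\<^sub>M M). dist (fst z) d + dist (snd z) d < a})"
        using c(1) z by (auto simp: xy D_def)
    next
      fix z assume "z \<in> (\<Union>d\<in>D. {z \<in> space (M \<Otimes>\<^sub>M M). dist (fst z) d + dist (snd z) d < a})"
      then obtain d where d: "z \<in> space (M \<Otimes>\<^sub>M M)" "dist (fst z) d + dist (snd z) d < a" by blast
      then show "z \<in> {z \<in> space (M \<Otimes>\<^sub>M M). (case z of (x, y) \<Rightarrow> dist x y) < a}"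
        using dist_triangle2[of "fst z" "snd z" d] by (auto simp: case_prod_beta')
    qed
    moreover have "{z \<in> space (M \<Otimes>\<^sub>M M). dist (fst z) d + dist (snd z) d < a} \<in> sets (M \<Otimes>\<^sub>M M)" for d
    proof -
      note [measurable] = dist_section_measurable[of d]
      show ?thesis by measurable
    qed
    ultimately show ?thesis using D by (auto intro: sets.countable_UN')
  qed
  then show ?thesis by (simp add: borel_measurable_iff_less)
qed

lemma dist_bounded: "\<exists>B. \<forall>x y :: 'x. dist x y \<le> B"
proof -
  have "bounded (UNIV :: 'x set)" using compact_imp_bounded[OF compact_UNIV] .
  then show ?thesis by (auto simp: bounded_two_points)
qed

text \<open>The functions are the distances to the points of a finite net: for \<open>c\<close>
  close to \<open>x\<close>, \<open>dist x y\<close> exceeds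
  \<open>\<bar>dist x c - dist y c\<bar>\<close> by at most \<open>2 * dist x c\<close>.\<close>

lemma tame_dist: "tame dist"
  unfolding tame_def
proof (intro allI impI)
  fix \<epsilon> :: real assume \<epsilon>: "\<epsilon> > 0"
  then obtain k :: "'x set" where k: "finite k" "\<And>x. \<exists>c\<in>k. dist x c < \<epsilon> / 2" using finite_net[of "\<epsilon> / 2"] by auto
  obtain B where B: "\<And>x y :: 'x. dist x y \<le> B" using dist_bounded by blast
  define fs where "fs = (\<lambda>c x. dist x c) ` k"
  have fin: "finite fs" using k(1) by (simp add: fs_def)
  have "dist x y \<le> \<epsilon> + (\<Sum>f\<in>fs. \<bar>f x - f y\<bar>)" for x y
  proof -
    obtain c where c: "c \<in> k" "dist x c < \<epsilon> / 2" using k(2) by blast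
    have "\<bar>dist x c - dist y c\<bar> \<le> (\<Sum>f\<in>fs. \<bar>f x - f y\<bar>)"
      using member_le_sum[of "\<lambda>x. dist x c" fs "\<lambda>f. \<bar>f x - f y\<bar>"] fin c(1) by (auto simp: fs_def)
    then show ?thesis using c(2) dist_triangle2[of x y c] by linarith
  qed
  moreover have "\<forall>f\<in>fs. f \<in> borel_measurable M \<and> (\<exists>B. \<forall>x. \<bar>f x\<bar> \<le> B)"
    using dist_section_measurable B by (auto simp: fs_def)
  ultimately show "\<exists>fs. finite fs \<and> (\<forall>f\<in>fs. f \<in> borel_measurable M \<and> (\<exists>B. \<forall>x. \<bar>f x\<bar> \<le> B)) \<and>
     (\<forall>x y. dist x y \<le> \<epsilon> + (\<Sum>f\<in>fs. \<bar>f x - f y\<bar>))" using fin by blast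
qed

lemma borel_partition_sets: "\<alpha> \<in> borel_partitions \<Longrightarrow> A \<in> \<alpha> \<Longrightarrow> A \<in> sets M"
  by (auto simp: borel_partitions_def sets_borel)

lemma partition_semimetric_measurable:
  assumes "\<alpha> \<in> borel_partitions"
  shows "(\<lambda>(x, y). partition_semimetric \<alpha> x y) \<in> borel_measurable (M \<Otimes>\<^sub>M M)"
proof -
  have "(\<lambda>z. \<bar>indicator A (fst z) - indicator A (snd z) :: real\<bar>) \<in> borel_measurable (M \<Otimes>\<^sub>M M)" if "A \<in> \<alpha>" for A
  proof -
    have [measurable]: "A \<in> sets M" by (rule borel_partition_sets[OF assms that])
    show ?thesis by measurable
  qed
  then show ?thesis
    unfolding partition_semimetric_def case_prod_beta'
    by (intro borel_measurable_times borel_measurable_const borel_measurable_sum)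
qed

lemma partition_semimetric_le: "partition_semimetric \<alpha> x y \<le> real (card \<alpha>)"
proof -
  have "(\<Sum>A\<in>\<alpha>. \<bar>indicator A x - indicator A y :: real\<bar>) \<le> real (card \<alpha>) * 1"
    by (rule sum_bounded_above) (auto simp: indicator_def)
  then show ?thesis by (simp add: partition_semimetric_def)
qed

lemma tame_partition_semimetric:
  assumes \<alpha>: "\<alpha> \<in> borel_partitions"
  shows "tame (partition_semimetric \<alpha>)"
  unfolding tame_def
proof (intro allI impI exI conjI)
  fix \<epsilon> :: real assume \<epsilon>: "\<epsilon> > 0"
  define fs where "fs = (indicator :: 'x set \<Rightarrow> 'x \<Rightarrow> real) ` \<alpha>"
  show "finite fs" using \<alpha> by (simp add: fs_def borel_partitions_def)
  show "\<forall>f\<in>fs. f \<in> borel_measurable M \<and> (\<exists>B. \<forall>x. \<bar>f x\<bar> \<le> B)"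
    using borel_partition_sets[OF \<alpha>] by (auto simp: fs_def indicator_def[abs_def] intro!: exI[of _ 1])
  fix x y
  have "inj_on (indicator :: 'x set \<Rightarrow> 'x \<Rightarrow> real) \<alpha>"
  proof (rule inj_onI)
    fix A B :: "'x set" assume "(indicator A :: 'x \<Rightarrow> real) = indicator B"
    then have "indicator A x = (indicator B x :: real)" for x by simp
    then have "x \<in> A \<longleftrightarrow> x \<in> B" for x by (metis indicator_simps zero_neq_one)
    then show "A = B" by blast
  qed
  then have "(\<Sum>f\<in>fs. \<bar>f x - f y\<bar>) = (\<Sum>A\<in>\<alpha>. \<bar>indicator A x - indicator A y\<bar>)"
    by (simp add: fs_def sum.reindex)
  moreover have "0 \<le> (\<Sum>A\<in>\<alpha>. \<bar>indicator A x - indicator A y :: real\<bar>)" by (simp add: sum_nonneg)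
  ultimately show "partition_semimetric \<alpha> x y \<le> \<epsilon> + (\<Sum>f\<in>fs. \<bar>f x - f y\<bar>)"
    using \<epsilon> by (simp add: partition_semimetric_def)
qed

lemma limit_kernel_exists:
  assumes F: "folner_sequence G F" and wm: "(\<lambda>(x, y). w x y) \<in> borel_measurable (M \<Otimes>\<^sub>M M)"
    and sw: "semimetric w" and wB: "\<And>x y. w x y \<le> B"
  shows "\<exists>v. limit_kernel F w v"
proof -
  have "0 \<le> w x y" "w x y = w y x" for x y using sw by (auto simp: semimetric_def)
  then have w0: "\<And>x y. 0 \<le> w x y" and wsym: "\<And>x y. w x y = w y x" by auto
  show ?thesis
  proof (rule invariant_kernel[OF F wm w0 wB wsym])
    fix v :: "'x \<Rightarrow> 'x \<Rightarrow> real"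
    assume "(\<lambda>(x, y). v x y) \<in> borel_measurable (M \<Otimes>\<^sub>M M)" "\<And>x y. 0 \<le> v x y" "\<And>x y. v x y \<le> B"
      "\<And>x y. v x y = v y x" "\<And>g. g \<in> carrier G \<Longrightarrow> AE (x, y) in M \<Otimes>\<^sub>M M. v (\<phi> g x) (\<phi> g y) = v x y"
      "(\<lambda>n. \<integral>(x, y). \<bar>averaged \<phi> w (F n) x y - v x y\<bar> \<partial>(M \<Otimes>\<^sub>M M)) \<longlonglongrightarrow> 0"
    then have "limit_kernel F w v" unfolding limit_kernel_def by blast
    then show "\<exists>v. limit_kernel F w v" by (intro exI[of _ v])
  qed
qed

section \<open>Towards discrete spectrum\<close>

text \<open>For a partition into \<open>A\<close> and its complement the semimetric is exactly the
  oscillation of the indicator of \<open>A\<close>. That indicator is therefore orthogonal to every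
  \<open>h\<close> orthogonal to the compact part, and indicators determine
  \<open>h\<close>.\<close>

lemma discrete_spectrum_if_partitions:
  assumes F: "folner_sequence G F"
    and bc: "\<And>A. A \<in> sets borel \<Longrightarrow> bounded_complexity M (\<lambda>n. averaged \<phi> (partition_semimetric {A, UNIV - A}) (F n))"
  shows "discrete_spectrum G \<phi> M"
proof (rule discrete_spectrumI, rule orthogonal_to_indicators_zero)
  fix h :: "'x \<Rightarrow> complex" assume h: "orthogonal_to_compact_part h"
  then show "h \<in> square_integrable M" by (simp add: orthogonal_to_compact_part_def)
  fix A c assume A [measurable]: "A \<in> sets M"
  let ?w = "partition_semimetric {A, UNIV - A}"
  have \<alpha>: "{A, UNIV - A} \<in> borel_partitions"
    using A by (auto simp: borel_partitions_def sets_borel disjoint_def)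
  note wm = partition_semimetric_measurable[OF \<alpha>]
  note sw = semimetric_partition[of "{A, UNIV - A}"]
  obtain v where v: "limit_kernel F ?w v"
    using limit_kernel_exists[OF F wm sw partition_semimetric_le] by blast
  have w0: "0 \<le> ?w x y" for x y using sw by (simp add: semimetric_def)
  have osc: "\<bar>indicator A x - indicator A y :: real\<bar> \<le> 1 * ?w x y" for x y
  proof -
    \<comment> \<open>Otherwise the sum over the set \<open>{A, UNIV - A}\<close> would have a
      single term.\<close>
    have "A \<noteq> UNIV - A" by auto
    then show ?thesis by (simp add: partition_semimetric_def) (auto simp: indicator_def)
  qed
  show "ip M (\<lambda>x. indicator A x *\<^sub>R c) h = 0"
  proof (rule orthogonal_to_oscillation_bounded[OF F wm w0 partition_semimetric_le v _ _ _ osc _ h])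
    fix \<epsilon> :: real assume "\<epsilon> > 0"
    moreover have "A \<in> sets borel" using A by (simp add: sets_borel)
    ultimately show "AE x in M. 0 < (\<integral>y. max 0 (1 - v x y / \<epsilon>) \<partial>M)"
      using bounded_complexity_nondegenerate[OF F wm sw partition_semimetric_le v bc] by blast
  qed (auto simp: indicator_def)
qed

text \<open>Indicators need not be Lipschitz for \<open>dist\<close>, so they are reached in two
  steps: closed sets by Lipschitz cut-offs, then Borel sets by regularity.\<close>

lemma discrete_spectrum_if_nondegenerate:
  assumes F: "folner_sequence G F" and v: "limit_kernel F dist v"
    and pos: "\<And>\<epsilon>. \<epsilon> > 0 \<Longrightarrow> AE x in M. 0 < (\<integral>y. max 0 (1 - v x y / \<epsilon>) \<partial>M)"
  shows "discrete_spectrum G \<phi> M"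
proof (rule discrete_spectrumI, rule orthogonal_to_indicators_zero)
  fix h :: "'x \<Rightarrow> complex" assume h: "orthogonal_to_compact_part h"
  then show hL: "h \<in> square_integrable M" by (simp add: orthogonal_to_compact_part_def)
  obtain B where B: "\<And>x y :: 'x. dist x y \<le> B" using dist_bounded by blast
  have cm: "C \<in> sets M" if "closed C" for C using that sets_borel by auto
  have iL: "(\<lambda>x. indicator A x *\<^sub>R c) \<in> square_integrable M" if "A \<in> sets M" for A and c :: complex
    by (rule square_integrable_bounded[where B="norm c"]) (use that in \<open>auto simp: indicator_def\<close>)
  have closed: "ip M (\<lambda>x. indicator C x *\<^sub>R c) h = 0" if C: "closed C" for C c
  \<comment> \<open>For the empty set \<open>infdist\<close> is 0 by convention, and the cut-offs
    would tend to 1 instead of 0.\<close>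
  proof (cases "C = {}")
    case False
    define f where "f n x = max 0 (1 - real n * infdist x C)" for n x
    have im [measurable]: "(\<lambda>x. infdist x C) \<in> borel_measurable M"
      by (rule borel_measurable_subalgebra[of borel])
         (auto simp: sets_borel space_UNIV intro!: borel_measurable_continuous_onI continuous_intros)
    have fm [measurable]: "f n \<in> borel_measurable M" for n unfolding f_def by measurable
    have f01: "0 \<le> f n x" "f n x \<le> 1" for n x by (auto simp: f_def infdist_nonneg)
    have fL: "\<bar>f n x - f n y\<bar> \<le> real n * dist x y" for n x y
    proof -
      have "\<bar>infdist x C - infdist y C\<bar> \<le> dist x y" by (rule infdist_triangle_abs)
      from mult_left_mono[OF this, of "real n"]
      have "\<bar>real n * infdist x C - real n * infdist y C\<bar> \<le> real n * dist x y"
        by (simp add: abs_mult flip: right_diff_distrib)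
      then show ?thesis by (auto simp: f_def max_def abs_if split: if_splits)
    qed
    have zero: "ip M (\<lambda>x. f n x *\<^sub>R c) h = 0" for n
      by (rule orthogonal_to_oscillation_bounded[OF F dist_measurable zero_le_dist B v pos fm _ fL _ h])
         (use f01 in auto)
    have "(\<lambda>n. \<integral>x. (f n x *\<^sub>R c) \<bullet> h x \<partial>M) \<longlonglongrightarrow> (\<integral>x. (indicator C x *\<^sub>R c) \<bullet> h x \<partial>M)"
    proof (rule integral_dominated_convergence[where w="\<lambda>x. norm c * norm (h x)"])
      have [measurable]: "C \<in> sets M" "h \<in> borel_measurable M" using cm[OF C] hL by auto
      show "(\<lambda>x. (indicator C x *\<^sub>R c) \<bullet> h x) \<in> borel_measurable M" by measurable
      show "(\<lambda>x. (f n x *\<^sub>R c) \<bullet> h x) \<in> borel_measurable M" for n by measurable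
      show "integrable M (\<lambda>x. norm c * norm (h x))"
        using square_integrable_imp_integrable_norm[OF hL] by auto
      show "AE x in M. (\<lambda>n. (f n x *\<^sub>R c) \<bullet> h x) \<longlonglongrightarrow> (indicator C x *\<^sub>R c) \<bullet> h x"
      proof (rule AE_I2)
        fix x
        have "(\<lambda>n. f n x) \<longlonglongrightarrow> indicator C x"
        proof (cases "x \<in> C")
          case True
          then show ?thesis by (simp add: f_def)
        next
          case xC: False
          then have "infdist x C > 0"
            using in_closed_iff_infdist_zero[OF C False, of x] infdist_nonneg[of x C] by (auto simp: less_le)
          then obtain N where N: "1 < real N * infdist x C" using reals_Archimedean3 by metis
          have "f n x = 0" if "n \<ge> N" for n
          proof -
            have "real N * infdist x C \<le> real n * infdist x C"
              using that by (intro mult_right_mono) (auto simp: infdist_nonneg)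
            then show ?thesis using N by (simp add: f_def)
          qed
          then have "\<forall>\<^sub>F n in sequentially. f n x = indicator C x"
            using xC by (auto simp: eventually_sequentially)
          then show ?thesis by (rule tendsto_eventually)
        qed
        then show "(\<lambda>n. (f n x *\<^sub>R c) \<bullet> h x) \<longlonglongrightarrow> (indicator C x *\<^sub>R c) \<bullet> h x"
          by (intro tendsto_intros)
      qed
      show "AE x in M. norm ((f n x *\<^sub>R c) \<bullet> h x) \<le> norm c * norm (h x)" for n
      proof (rule AE_I2)
        fix x
        have "norm ((f n x *\<^sub>R c) \<bullet> h x) \<le> norm (f n x *\<^sub>R c) * norm (h x)"
          unfolding real_norm_def by (rule Cauchy_Schwarz_ineq2)
        also have "\<dots> \<le> norm c * norm (h x)"
          using f01[of n x] by (intro mult_right_mono) (auto simp: mult_left_le_one_le)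
        finally show "norm ((f n x *\<^sub>R c) \<bullet> h x) \<le> norm c * norm (h x)" .
      qed
    qed
    then show ?thesis using zero by (simp add: ip_def LIMSEQ_const_iff)
  qed simp
  fix A c assume A: "A \<in> sets M"
  have bound: "\<bar>ip M (\<lambda>x. indicator A x *\<^sub>R c) h\<bar> \<le> sqrt e * (norm c * nrm M h)" if e: "e > 0" for e
  proof -
    obtain C U where C: "closed C" "C \<subseteq> A" "A \<subseteq> U" "open U" "measure M (U - C) < e"
      using closed_open_regular[OF finite_measure_axioms sets_borel A e] by blast
    have Cm: "C \<in> sets M" and Um: "U \<in> sets M" using C sets_borel by auto
    have "(\<lambda>x. indicator A x *\<^sub>R c - indicator C x *\<^sub>R c) = (\<lambda>x. indicator (A - C) x *\<^sub>R c)"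
    proof
      fix x
      show "indicator A x *\<^sub>R c - indicator C x *\<^sub>R c = indicator (A - C) x *\<^sub>R c"
        using C(2) by (cases "x \<in> C"; cases "x \<in> A") auto
    qed
    then have "ip M (\<lambda>x. indicator A x *\<^sub>R c) h = ip M (\<lambda>x. indicator (A - C) x *\<^sub>R c) h"
      using ip_diff_left[OF iL[OF A] iL[OF Cm] hL, of c c] closed[OF C(1), of c] by simp
    also have "\<bar>\<dots>\<bar> \<le> nrm M (\<lambda>x. indicator (A - C) x *\<^sub>R c) * nrm M h"
      by (intro ip_cauchy_schwarz iL hL) (use A Cm in auto)
    also have "nrm M (\<lambda>x. indicator (A - C) x *\<^sub>R c) \<le> sqrt e * norm c"
    proof -
      have "ip M (\<lambda>x. indicator (A - C) x *\<^sub>R c) (\<lambda>x. indicator (A - C) x *\<^sub>R c) = (\<integral>x. indicator (A - C) x * (norm c)\<^sup>2 \<partial>M)"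
        unfolding ip_self by (intro Bochner_Integration.integral_cong) (auto simp: indicator_def)
      also have "\<dots> = measure M (A - C) * (norm c)\<^sup>2" by (simp add: space_UNIV)
      also have "\<dots> \<le> e * (norm c)\<^sup>2"
      proof (intro mult_right_mono)
        have "measure M (A - C) \<le> measure M (U - C)"
          by (rule finite_measure_mono) (use C(3) Um Cm in auto)
        then show "measure M (A - C) \<le> e" using C(5) by linarith
      qed simp
      finally have "nrm M (\<lambda>x. indicator (A - C) x *\<^sub>R c) \<le> sqrt (e * (norm c)\<^sup>2)"
        unfolding nrm_def by (rule real_sqrt_le_mono)
      then show ?thesis by (simp add: real_sqrt_mult)
    qed
    finally show ?thesis by (simp add: mult_right_mono mult.assoc)
  qed
  have "(\<lambda>n. sqrt (inverse (real (Suc n))) * (norm c * nrm M h)) \<longlonglongrightarrow> sqrt 0 * (norm c * nrm M h)"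
    by (intro tendsto_intros LIMSEQ_inverse_real_of_nat)
  then have "\<bar>ip M (\<lambda>x. indicator A x *\<^sub>R c) h\<bar> \<le> sqrt 0 * (norm c * nrm M h)"
    by (rule LIMSEQ_le_const) (use bound in auto)
  then show "ip M (\<lambda>x. indicator A x *\<^sub>R c) h = 0" by simp
qed

lemma discrete_spectrum_if_bounded_complexity_dist:
  assumes F: "folner_sequence G F" and bc: "bounded_complexity M (\<lambda>n. averaged \<phi> dist (F n))"
  shows "discrete_spectrum G \<phi> M"
proof -
  obtain B where B: "\<And>x y :: 'x. dist x y \<le> B" using dist_bounded by blast
  obtain v where v: "limit_kernel F dist v"
    using limit_kernel_exists[OF F dist_measurable semimetric_dist B] by blast
  show ?thesis
    by (rule discrete_spectrum_if_nondegenerate[OF F v])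
       (rule bounded_complexity_nondegenerate[OF F dist_measurable semimetric_dist B v bc])
qed

text \<open>A compact set on which mean equicontinuity holds is cut by finitely many balls of radius
  \<open>\<delta> / 2\<close>; points in one piece are then closer than \<delta>, hence
  asymptotically close on average.\<close>

lemma discrete_spectrum_if_mean_equicontinuous:
  assumes F: "folner_sequence G F" and me: "mean_equicontinuous_measure \<phi> F M"
  shows "discrete_spectrum G \<phi> M"
proof -
  obtain B where B: "\<And>x y :: 'x. dist x y \<le> B" using dist_bounded by blast
  obtain v where v: "limit_kernel F dist v"
    using limit_kernel_exists[OF F dist_measurable semimetric_dist B] by blast
  show ?thesis
  proof (rule discrete_spectrum_if_nondegenerate[OF F v],
      rule asymptotically_close_nondegenerate[OF F dist_measurable zero_le_dist B v])
    fix \<epsilon> \<tau> :: real assume \<epsilon>: "\<epsilon> > 0" and \<tau>: "\<tau> > 0"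
    obtain K where K: "compact K" "measure M K > 1 - \<tau>" "mean_equicontinuous_on \<phi> F K"
      using me \<tau> unfolding mean_equicontinuous_measure_def by blast
    have "\<epsilon> / 2 > 0" using \<epsilon> by simp
    then obtain \<delta> where \<delta>: "\<delta> > 0" "\<And>x y. x \<in> K \<Longrightarrow> y \<in> K \<Longrightarrow> dist x y < \<delta> \<Longrightarrow>
        limsup (\<lambda>n. ereal (averaged \<phi> dist (F n) x y)) < ereal (\<epsilon> / 2)"
      using K(3) unfolding mean_equicontinuous_on_def by blast
    obtain k :: "'x set" where k: "finite k" "\<And>x. \<exists>c\<in>k. dist x c < \<delta> / 2" using finite_net[of "\<delta> / 2"] \<delta>(1) by auto
    define \<P> where "\<P> = (\<lambda>c. ball c (\<delta> / 2) \<inter> K) ` k"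
    have "K \<in> sets M" using compact_imp_closed[OF K(1)] sets_borel by auto
    moreover have "ball c (\<delta> / 2) \<in> sets M" for c using sets_borel by auto
    ultimately have sub: "\<P> \<subseteq> sets M" by (auto simp: \<P>_def)
    have U: "\<Union>\<P> = K"
    proof
      show "K \<subseteq> \<Union>\<P>"
      proof
        fix x assume "x \<in> K"
        moreover obtain c where "c \<in> k" "dist x c < \<delta> / 2" using k(2) by blast
        ultimately show "x \<in> \<Union>\<P>" by (auto simp: \<P>_def dist_commute intro!: bexI[of _ c])
      qed
    qed (auto simp: \<P>_def)
    have "limsup (\<lambda>n. ereal (averaged \<phi> dist (F n) x y)) < ereal (\<epsilon> / 2)" if "P \<in> \<P>" "x \<in> P" "y \<in> P" for P x y
    proof (rule \<delta>(2))
      from that obtain c where c: "x \<in> ball c (\<delta> / 2) \<inter> K" "y \<in> ball c (\<delta> / 2) \<inter> K" unfolding \<P>_def by blast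
      then show "x \<in> K" "y \<in> K" by auto
      show "dist x y < \<delta>" using c dist_triangle3[of x y c] by auto
    qed
    then show "\<exists>\<P>. finite \<P> \<and> \<P> \<subseteq> sets M \<and> measure M (\<Union>\<P>) > 1 - \<tau> \<and>
      (\<forall>P\<in>\<P>. \<forall>x\<in>P. \<forall>y\<in>P. limsup (\<lambda>n. ereal (averaged \<phi> dist (F n) x y)) < ereal (\<epsilon> / 2))"
      using k(1) sub U K(2) by (intro exI[of _ \<P>]) (auto simp: \<P>_def)
  qed
qed

lemma mean_equicontinuous_if_equicontinuous_in_mean:
  assumes "equicontinuous_in_mean_measure \<phi> F M"
  shows "mean_equicontinuous_measure \<phi> F M"
proof -
  have "mean_equicontinuous_on \<phi> F K" if K: "equicontinuous_in_mean_on \<phi> F K" for K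
    unfolding mean_equicontinuous_on_def
  proof (intro allI impI)
    fix \<epsilon> :: real assume \<epsilon>: "\<epsilon> > 0"
    \<comment> \<open>A strict bound for every \<open>n\<close> survives in the limsup only as a
      weak one.\<close>
    then have "\<epsilon> / 2 > 0" by simp
    from K[unfolded equicontinuous_in_mean_on_def, rule_format, OF this] obtain \<delta> where d: "\<delta> > 0"
      "\<forall>x\<in>K. \<forall>y\<in>K. dist x y < \<delta> \<longrightarrow> (\<forall>n. averaged \<phi> dist (F n) x y < \<epsilon> / 2)"
      by blast
    have \<delta>: "\<delta> > 0" "averaged \<phi> dist (F n) x y < \<epsilon> / 2" if "x \<in> K" "y \<in> K" "dist x y < \<delta>" for x y n
      using d that by auto
    have "limsup (\<lambda>n. ereal (averaged \<phi> dist (F n) x y)) < ereal \<epsilon>" if "x \<in> K" "y \<in> K" "dist x y < \<delta>" for x y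
    proof -
      have "limsup (\<lambda>n. ereal (averaged \<phi> dist (F n) x y)) \<le> ereal (\<epsilon> / 2)"
        using less_imp_le[OF \<delta>(2)[OF that]] by (intro Limsup_bounded always_eventually allI) simp
      also have "\<dots> < ereal \<epsilon>" using \<epsilon> by simp
      finally show ?thesis .
    qed
    with d(1) show "\<exists>\<delta>>0. \<forall>x\<in>K. \<forall>y\<in>K. dist x y < \<delta> \<longrightarrow> limsup (\<lambda>n. ereal (averaged \<phi> dist (F n) x y)) < ereal \<epsilon>"
      by blast
  qed
  with assms show ?thesis unfolding mean_equicontinuous_measure_def equicontinuous_in_mean_measure_def by blast
qed

section \<open>From discrete spectrum to equicontinuity in the mean\<close>

text \<open>Finitely many disjoint closed pieces are separated: each point of a piece has a
  neighbourhood missing the others. This is what will turn smallness within a piece into smallness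
  for nearby points.\<close>

lemma closed_small_partition:
  assumes ds: "discrete_spectrum G \<phi> M" and F: "folner_sequence G F" and temp: "tempered G F"
    and \<epsilon>: "\<epsilon> > 0" and \<tau>: "\<tau> > 0"
  shows "\<exists>\<C>. finite \<C> \<and> (\<forall>C\<in>\<C>. closed C) \<and> disjoint \<C> \<and> measure M (\<Union>\<C>) > 1 - \<tau> \<and>
    (\<forall>C\<in>\<C>. \<forall>x\<in>C. \<forall>y\<in>C. \<forall>n. averaged \<phi> dist (F n) x y < \<epsilon>)"
proof -
  have "\<tau> / 2 > 0" using \<tau> by simp
  from uniformly_small_partition[OF ds tame_dist F temp \<epsilon> this] obtain \<P> where \<P>: "finite \<P>" "\<P> \<subseteq> sets M" "disjoint \<P>"
    "measure M (\<Union>\<P>) > 1 - \<tau> / 2" and small: "\<forall>P\<in>\<P>. \<forall>x\<in>P. \<forall>y\<in>P. \<forall>n. averaged \<phi> dist (F n) x y < \<epsilon>"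
    by (elim exE conjE) (rule that)
  \<comment> \<open>The summand 1 keeps the denominator positive when the family is empty.\<close>
  define d where "d = \<tau> / 2 / (real (card \<P>) + 1)"
  have d: "d > 0" using \<tau> by (simp add: d_def add_nonneg_pos)
  have "\<forall>P\<in>\<P>. \<exists>C. closed C \<and> C \<subseteq> P \<and> measure M (P - C) < d"
  proof
    fix P assume P: "P \<in> \<P>"
    then have Pm: "P \<in> sets M" using \<P>(2) by blast
    obtain C U where C: "closed C" "C \<subseteq> P" "P \<subseteq> U" "open U" "measure M (U - C) < d"
      using closed_open_regular[OF finite_measure_axioms sets_borel Pm d] by blast
    have "U \<in> sets M" "C \<in> sets M" using C sets_borel by auto
    then have "measure M (P - C) \<le> measure M (U - C)" by (intro finite_measure_mono) (use C(3) in auto)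
    with C show "\<exists>C. closed C \<and> C \<subseteq> P \<and> measure M (P - C) < d" by (intro exI[of _ C]) auto
  qed
  then obtain C where C: "\<And>P. P \<in> \<P> \<Longrightarrow> closed (C P)" "\<And>P. P \<in> \<P> \<Longrightarrow> C P \<subseteq> P" "\<And>P. P \<in> \<P> \<Longrightarrow> measure M (P - C P) < d"
    by metis
  have Cm: "C P \<in> sets M" if "P \<in> \<P>" for P using C(1)[OF that] sets_borel by auto
  have "disjoint (C ` \<P>)"
    unfolding disjoint_def
  proof (intro ballI impI)
    fix A B assume "A \<in> C ` \<P>" "B \<in> C ` \<P>" "A \<noteq> B"
    then obtain P Q where PQ: "A = C P" "B = C Q" "P \<in> \<P>" "Q \<in> \<P>" "P \<noteq> Q" by blast
    then have "P \<inter> Q = {}" using \<P>(3) unfolding disjoint_def by blast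
    then show "A \<inter> B = {}" using C(2)[OF PQ(3)] C(2)[OF PQ(4)] PQ by blast
  qed
  moreover have "measure M (\<Union>(C ` \<P>)) > 1 - \<tau>"
  proof -
    have Um: "\<Union>(C ` \<P>) \<in> sets M" using \<P>(1) Cm by (intro sets.finite_UN) auto
    have Dm: "(\<Union>P\<in>\<P>. P - C P) \<in> sets M" using \<P>(1,2) Cm by (intro sets.finite_UN) auto
    have "measure M (\<Union>\<P>) \<le> measure M (\<Union>(C ` \<P>) \<union> (\<Union>P\<in>\<P>. P - C P))"
      by (rule finite_measure_mono) (use Um Dm in auto)
    also have "\<dots> \<le> measure M (\<Union>(C ` \<P>)) + measure M (\<Union>P\<in>\<P>. P - C P)"
      by (rule measure_Un_le[OF Um Dm])
    also have "measure M (\<Union>P\<in>\<P>. P - C P) \<le> (\<Sum>P\<in>\<P>. measure M (P - C P))"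
      by (rule finite_measure_subadditive_finite) (use \<P>(1,2) Cm in auto)
    also have "\<dots> \<le> (\<Sum>P\<in>\<P>. d)" by (intro sum_mono less_imp_le C(3))
    also have "\<dots> \<le> \<tau> / 2"
      using \<tau> by (simp add: d_def field_simps)
    finally show ?thesis using \<P>(4) by linarith
  qed
  moreover have "finite (C ` \<P>)" "\<forall>A\<in>C ` \<P>. closed A" using \<P>(1) C(1) by auto
  moreover have "\<forall>A\<in>C ` \<P>. \<forall>x\<in>A. \<forall>y\<in>A. \<forall>n. averaged \<phi> dist (F n) x y < \<epsilon>"
  proof (intro ballI allI)
    fix A x y n assume "A \<in> C ` \<P>" "x \<in> A" "y \<in> A"
    then obtain P where "P \<in> \<P>" "x \<in> P" "y \<in> P" using C(2) by blast
    then show "averaged \<phi> dist (F n) x y < \<epsilon>" using small by blast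
  qed
  ultimately show ?thesis by (intro exI[of _ "C ` \<P>"] conjI)
qed

text \<open>\<open>K\<close> lies in the union of the closed pieces for every accuracy
  \<open>1 / Suc j\<close> at once, and the losses of measure are summable. For a given accuracy,
  \<delta> is a Lebesgue number of an open cover of \<open>K\<close> derived from the
  pieces.\<close>

lemma equicontinuous_in_mean_if_discrete_spectrum:
  assumes ds: "discrete_spectrum G \<phi> M" and F: "folner_sequence G F" and temp: "tempered G F"
  shows "equicontinuous_in_mean_measure \<phi> F M"
  unfolding equicontinuous_in_mean_measure_def
proof (intro allI impI)
  fix \<tau> :: real assume \<tau>: "\<tau> > 0"
  \<comment> \<open>The sum is \<open>\<tau> / 2\<close>, which leaves room for the strict
    inequality.\<close>
  define t where "t j = \<tau> / 2 * (1 / 2) ^ Suc j" for j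
  have t: "t j > 0" for j using \<tau> by (simp add: t_def)
  have ts: "t sums (\<tau> / 2)"
    using sums_mult[OF power_half_series, of "\<tau> / 2"] by (simp only: t_def[abs_def] mult_1_right)
  have "\<exists>\<C>. finite \<C> \<and> (\<forall>C\<in>\<C>. closed C) \<and> disjoint \<C> \<and> measure M (\<Union>\<C>) > 1 - t j \<and>
    (\<forall>C\<in>\<C>. \<forall>x\<in>C. \<forall>y\<in>C. \<forall>n. averaged \<phi> dist (F n) x y < 1 / real (Suc j))" for j
    by (rule closed_small_partition[OF ds F temp _ t]) simp
  then obtain \<C> where \<C>: "\<And>j. finite (\<C> j)" "\<And>j. \<forall>C\<in>\<C> j. closed C" "\<And>j. disjoint (\<C> j)"
    "\<And>j. measure M (\<Union>(\<C> j)) > 1 - t j"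
    "\<And>j. \<forall>C\<in>\<C> j. \<forall>x\<in>C. \<forall>y\<in>C. \<forall>n. averaged \<phi> dist (F n) x y < 1 / real (Suc j)"
    by metis
  define K where "K = (\<Inter>j. \<Union>(\<C> j))"
  have Uc: "closed (\<Union>(\<C> j))" for j using \<C>(1,2) by (intro closed_Union) auto
  then have Kc: "closed K" unfolding K_def by (intro closed_INT) auto
  then have comp: "compact K" using compact_Int_closed[OF compact_UNIV, of K] by simp
  have Um: "\<Union>(\<C> j) \<in> sets M" for j using Uc sets_borel by auto
  have Km: "K \<in> sets M" using Kc sets_borel by auto
  have "measure M (\<Union>j. space M - \<Union>(\<C> j)) \<le> (\<Sum>j. measure M (space M - \<Union>(\<C> j)))"
    and "(\<Sum>j. measure M (space M - \<Union>(\<C> j))) \<le> (\<Sum>j. t j)"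
  proof -
    have le: "measure M (space M - \<Union>(\<C> j)) \<le> t j" for j using \<C>(4)[of j] prob_compl[OF Um[of j]] by simp
    have s: "summable (\<lambda>j. measure M (space M - \<Union>(\<C> j)))"
      by (rule summable_comparison_test'[OF sums_summable[OF ts], of 0]) (use le in auto)
    show "measure M (\<Union>j. space M - \<Union>(\<C> j)) \<le> (\<Sum>j. measure M (space M - \<Union>(\<C> j)))"
      by (rule finite_measure_subadditive_countably) (use Um s in auto)
    show "(\<Sum>j. measure M (space M - \<Union>(\<C> j))) \<le> (\<Sum>j. t j)"
      by (rule suminf_le[OF le s sums_summable[OF ts]])
  qed
  moreover have "(\<Sum>j. t j) = \<tau> / 2" using ts by (rule sums_unique[symmetric])
  moreover have "(\<Union>j. space M - \<Union>(\<C> j)) = space M - K" by (auto simp: K_def space_UNIV)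
  ultimately have "measure M K > 1 - \<tau>" using prob_compl[OF Km] \<tau> by simp
  moreover have "equicontinuous_in_mean_on \<phi> F K"
    unfolding equicontinuous_in_mean_on_def
  proof (intro allI impI)
    fix \<epsilon> :: real assume "\<epsilon> > 0"
    then obtain j where j: "1 / real (Suc j) < \<epsilon>" using nat_approx_posE by metis
    \<comment> \<open>The complement of all pieces other than \<open>C\<close> is open and meets
      \<open>K\<close> only inside \<open>C\<close>, so within a ball contained in it all points of
      \<open>K\<close> belong to one piece.\<close>
    define \<U> where "\<U> = (\<lambda>C. - \<Union>(\<C> j - {C})) ` \<C> j"
    have "K \<subseteq> \<Union>\<U>"
    proof
      fix x assume "x \<in> K"
      then obtain C where C: "C \<in> \<C> j" "x \<in> C" by (auto simp: K_def)
      then have "x \<notin> D" if "D \<in> \<C> j - {C}" for D using \<C>(3)[of j] that unfolding disjoint_def by blast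
      then show "x \<in> \<Union>\<U>" using C(1) by (auto simp: \<U>_def)
    qed
    moreover have "open U" if U: "U \<in> \<U>" for U
    proof -
      obtain C where "U = - \<Union>(\<C> j - {C})" using U unfolding \<U>_def by blast
      moreover have "closed (\<Union>(\<C> j - {C}))" using \<C>(1,2)[of j] by (intro closed_Union) auto
      ultimately show ?thesis by (simp add: open_Compl)
    qed
    ultimately have "\<exists>e>0. \<forall>x\<in>K. \<exists>U\<in>\<U>. ball x e \<subseteq> U"
    proof (rule Heine_Borel_lemma[OF comp])
      fix e :: real assume e: "0 < e" "\<And>x. x \<in> K \<Longrightarrow> \<exists>U\<in>\<U>. ball x e \<subseteq> U"
      show ?thesis by (intro exI[of _ e] conjI ballI e)
    qed
    then obtain e where e: "e > 0" "\<And>x. x \<in> K \<Longrightarrow> \<exists>U\<in>\<U>. ball x e \<subseteq> U" by blast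
    have "averaged \<phi> dist (F n) x y < \<epsilon>" if x: "x \<in> K" and y: "y \<in> K" and xy: "dist x y < e" for x y n
    proof -
      obtain C where C: "C \<in> \<C> j" "ball x e \<subseteq> - \<Union>(\<C> j - {C})" using e(2)[OF x] by (auto simp: \<U>_def)
      have "z \<in> C" if z: "z \<in> K" "z \<in> ball x e" for z
      proof -
        obtain D where "D \<in> \<C> j" "z \<in> D" using z(1) by (auto simp: K_def)
        then show ?thesis using C(2) z(2) by blast
      qed
      then have "x \<in> C" "y \<in> C" using x y xy e(1) by auto
      then have "averaged \<phi> dist (F n) x y < 1 / real (Suc j)" using \<C>(5) C(1) by blast
      then show ?thesis using j by linarith
    qed
    with e(1) show "\<exists>\<delta>>0. \<forall>x\<in>K. \<forall>y\<in>K. dist x y < \<delta> \<longrightarrow> (\<forall>n. averaged \<phi> dist (F n) x y < \<epsilon>)" by blast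
  qed
  ultimately show "\<exists>K. compact K \<and> measure M K > 1 - \<tau> \<and> equicontinuous_in_mean_on \<phi> F K"
    using comp by blast
qed

end

section \<open>The equivalences\<close>

lemma compact_measure_preserving_actionI:
  assumes "topological_dynamical_system G \<phi>" "\<mu> \<in> invariant_measures G \<phi>"
  shows "compact_measure_preserving_action G \<mu> \<phi>"
proof -
  interpret topological_dynamical_system G \<phi> by fact
  have sb: "sets \<mu> = sets borel" and ps: "prob_space \<mu>"
    and inv: "\<And>g. g \<in> carrier G \<Longrightarrow> distr \<mu> \<mu> (\<phi> g) = \<mu>"
    using assms(2) by (auto simp: invariant_measures_def)
  have G: "group G" "countable (carrier G)" using amenable by (auto simp: countable_amenable_group_def)
  have meas: "\<phi> g \<in> measurable \<mu> \<mu>" if "g \<in> carrier G" for g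
  proof -
    obtain h where "homeomorphism UNIV UNIV (\<phi> g) h" using homeomorphisms[OF \<open>g \<in> carrier G\<close>] by blast
    then have "continuous_on UNIV (\<phi> g)" by (simp add: homeomorphism_def)
    then have "\<phi> g \<in> borel_measurable borel" by (rule borel_measurable_continuous_onI)
    then show ?thesis using measurable_cong_sets[OF sb sb] by auto
  qed
  show ?thesis
    unfolding compact_measure_preserving_action_def measure_preserving_action_def
      measure_preserving_action_axioms_def compact_measure_preserving_action_axioms_def
    using G ps sb sets_eq_imp_space_eq[OF sb] meas inv compact_space composition_rule by auto
qed

theorem theorem1p1:
  fixes G :: "('g, 'm) monoid_scheme"
    and \<phi> :: "'g \<Rightarrow> 'x::metric_space \<Rightarrow> 'x"
    and \<mu> :: "'x measure"
    and F :: "nat \<Rightarrow> 'g set"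
  assumes "topological_dynamical_system G \<phi>"
    and "\<mu> \<in> invariant_measures G \<phi>"
    and "folner_sequence G F"
  shows "(discrete_spectrum G \<phi> \<mu> \<longleftrightarrow>
            bounded_complexity \<mu> (\<lambda>n. averaged \<phi> dist (F n)))
       \<and> (discrete_spectrum G \<phi> \<mu> \<longleftrightarrow>
            (\<forall>\<alpha>\<in>borel_partitions.
               bounded_complexity \<mu> (\<lambda>n. averaged \<phi> (partition_semimetric \<alpha>) (F n))))
       \<and> (discrete_spectrum G \<phi> \<mu> \<longleftrightarrow>
            (\<forall>\<alpha>\<in>borel_partitions. (\<exists>A. \<alpha> = {A, UNIV - A}) \<longrightarrow>
               bounded_complexity \<mu> (\<lambda>n. averaged \<phi> (partition_semimetric \<alpha>) (F n))))
       \<and> (tempered G F \<longrightarrow>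
            (discrete_spectrum G \<phi> \<mu> \<longleftrightarrow> mean_equicontinuous_measure \<phi> F \<mu>)
          \<and> (discrete_spectrum G \<phi> \<mu> \<longleftrightarrow> equicontinuous_in_mean_measure \<phi> F \<mu>))"
proof -
  interpret compact_measure_preserving_action G \<mu> \<phi>
    by (rule compact_measure_preserving_actionI[OF assms(1,2)])
  note F = assms(3)
  let ?D = "discrete_spectrum G \<phi> \<mu>"
  have 12: "bounded_complexity \<mu> (\<lambda>n. averaged \<phi> dist (F n))" if ?D
    by (rule bounded_complexity_if_discrete_spectrum[OF that tame_dist dist_measurable F])
  have 13: "bounded_complexity \<mu> (\<lambda>n. averaged \<phi> (partition_semimetric \<alpha>) (F n))"
    if ?D "\<alpha> \<in> borel_partitions" for \<alpha>
    by (rule bounded_complexity_if_discrete_spectrum[OF that(1) tame_partition_semimetric[OF that(2)]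
        partition_semimetric_measurable[OF that(2)] F])
  have 41: ?D if *: "\<forall>\<alpha>\<in>borel_partitions. (\<exists>A. \<alpha> = {A, UNIV - A}) \<longrightarrow>
               bounded_complexity \<mu> (\<lambda>n. averaged \<phi> (partition_semimetric \<alpha>) (F n))"
  proof (rule discrete_spectrum_if_partitions[OF F])
    fix A :: "'x set" assume "A \<in> sets borel"
    then have "{A, UNIV - A} \<in> borel_partitions" by (auto simp: borel_partitions_def disjoint_def)
    with * show "bounded_complexity \<mu> (\<lambda>n. averaged \<phi> (partition_semimetric {A, UNIV - A}) (F n))" by blast
  qed
  have 65: "mean_equicontinuous_measure \<phi> F \<mu>" if "equicontinuous_in_mean_measure \<phi> F \<mu>"
    by (rule mean_equicontinuous_if_equicontinuous_in_mean[OF that])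
  have 16: "equicontinuous_in_mean_measure \<phi> F \<mu>" if ?D "tempered G F"
    by (rule equicontinuous_in_mean_if_discrete_spectrum[OF that(1) F that(2)])
  \<comment> \<open>Two-set partitions are among all partitions, which closes the cycle through the
    partition semimetrics. The second cycle runs from discrete spectrum through equicontinuity in
    the mean to mean equicontinuity and back.\<close>
  show ?thesis
    using 12 13 41 65 16 discrete_spectrum_if_bounded_complexity_dist[OF F]
      discrete_spectrum_if_mean_equicontinuous[OF F] by blast
qed

end
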